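(* Assume: (1) for each $i=1,\ldots,M$ there exist a constant $\tau_i>0$ and a positive continuous function $\rho_i:\mathbb{R}^d\to\mathbb{R}_+$ with $k_i^0(x,x')=\tau_i^2\rho_i(x-x')$ such that (1a) $\rho_i(|\delta|)=\rho_i(\delta)$, where $|\cdot|$ is the component-wise absolute value; (1b) $\rho_i(\delta)$ is decreasing in $\delta$ component-wise for $\delta\ge 0$; (1c) $\rho_i(0)=1$ and $\rho_i(\delta)\to 0$ as $\|\delta\|\to\infty$ (Euclidean norm); (1d) there exist $0<C_i<\infty$ and $\varepsilon_i,u_i>0$ such that $1-\rho_i(\delta)\le C_i/|\log\|\delta\||^{1+\varepsilon_i}$ for all $\delta$ with $\|\delta\|<u_i$; (2) $\mathcal{X}\subset\mathbb{R}^d$ is compact with nonempty interior; (3) for each $i=1,\ldots,M$, the functions $\mu_i^0(\cdot)$, $\lambda_i(\cdot)>0$ and $c_i(\cdot)>0$ are continuous on $\mathcal{X}$, and $\gamma(\cdot)>0$ on $\mathcal{X}$. Then the IKG policy is consistent; that is, under the IKG policy: (i) $k_i^{N(B)}(x,x)\to 0$ almost surely as $B\to\infty$, for all $x\in\mathcal{X}$ and $i=1,\ldots,M$; (ii) $\mu_i^{N(B)}(x)\to\theta_i(x)$ almost surely as $B\to\infty$, for all $x\in\mathcal{X}$ and $i=1,\ldots,M$; (iii) $\operatorname{argmax}_{1\le i\le M}\mu_i^{N(B)}(x)\to\operatorname{argmax}_{1\le i\le M}\theta_i(x)$ almost surely as $B\to\infty$, for all $x\in\mathcal{X}$.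
   Context: Setting. There are $M\ge 2$ alternatives; $\mathcal{X}\subset\mathbb{R}^d$; $\gamma$ is a probability density on $\mathcal{X}$. Under the prior, $\theta_1,\ldots,\theta_M$ are mutually independent Gaussian processes on $\mathcal{X}$, $\theta_i$ having mean function $\mu_i^0$ and covariance function $k_i^0$. The sampling variances $\lambda_i(x)$ and sampling costs $c_i(x)>0$ are known functions on $\mathcal{X}$. At each time $n=0,1,2,\ldots$ a sampling decision $(a^n,v^n)\in\{1,\ldots,M\}\times\mathcal{X}$ is made and a sample $y^{n+1}$ is observed. $\mathscr{F}^n$ is the $\sigma$-algebra generated by $(a^0,v^0),y^1,\ldots,(a^{n-1},v^{n-1}),y^n$, and $(a^n,v^n)$ is $\mathscr{F}^n$-measurable. Given $\theta_{a^n}(v^n)$, $y^{n+1}$ is normal with mean $\theta_{a^n}(v^n)$ and variance $\lambda_{a^n}(v^n)$, with sampling noises independent across samples. Posterior. $\mu_i^n(x)=\mathbb{E}[\theta_i(x)\mid\mathscr{F}^n]$ and $k_i^n(x,x')=\mathrm{Cov}[\theta_i(x),\theta_i(x')\mid\mathscr{F}^n]$. Explicitly, with $V$ the list (with repetitions, in order of appearance) of the $v^\ell$ with $a^\ell=i$, $0\le\ell\le n-1$, and $y$ the vector of the corresponding $y^{\ell+1}$, $$\mu_i^n(x)=\mu_i^0(x)+k_i^0(x,V)[k_i^0(V,V)+\lambda_i(V)]^{-1}[y-\mu_i^0(V)],$$ $$k_i^n(x,x')=k_i^0(x,x')-k_i^0(x,V)[k_i^0(V,V)+\lambda_i(V)]^{-1}k_i^0(V,x'),$$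 where $\lambda_i(V)$ is the diagonal matrix with entries $\lambda_i(v)$, $v\in V$. Let $\tilde\sigma_i^n(x,v)=k_i^n(x,v)/\sqrt{k_i^n(v,v)+\lambda_i(v)}$. Conditionally on $\mathscr{F}^n$, $a^n=i$, $v^n=x$, one has $\mu_i^{n+1}(v)=\mu_i^n(v)+\tilde\sigma_i^n(v,x)Z^{n+1}$ and $\mu_a^{n+1}(v)=\mu_a^n(v)$ for $a\ne i$, with $Z^{n+1}$ standard normal independent of $\mathscr{F}^n$. IKG policy. Define $$\mathrm{IKG}^n(i,x)=\frac{1}{c_i(x)}\int_{\mathcal{X}}\Big\{\mathbb{E}\big[\max_{1\le a\le M}\mu_a^{n+1}(v)\,\big|\,\mathscr{F}^n,a^n=i,v^n=x\big]-\max_{1\le a\le M}\mu_a^n(v)\Big\}\gamma(v)\,dv.$$ The IKG policy takes $(a^n,v^n)\in\operatorname{argmax}_{1\le i\le M,\,x\in\mathcal{X}}\mathrm{IKG}^n(i,x)$ for every $n\ge 0$. Budget. For a budget $B>0$, $N(B)=\min\{N:\sum_{n=0}^N c_{a^n}(v^n)>B\}$. Convergence of argmax (a subset of the finite set $\{1,\ldots,M\}$) means eventual equality. Statements "almost surely for all $x$" mean: for each fixed $x$, almost surely.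
   Formalization: "γ>0 on X" is strengthened: every neighbourhood in X of each point of X must also have positive γ-mass (automatic if X is the closure of its interior); without it the claim fails, e.g. for X=[0,1]∪{2} with kernel exp(-|x-x'|). *)

theory Defs
  imports "HOL-Probability.Probability" "Jordan_Normal_Form.Gauss_Jordan_Elimination"
begin

subsection \<open>Gaussian processes\<close>

(* A Gaussian variable may be degenerate (variance 0). *)
definition normal_rv :: "'w measure \<Rightarrow> ('w \<Rightarrow> real) \<Rightarrow> real \<Rightarrow> real \<Rightarrow> bool" where
  "normal_rv P Y m s2 \<longleftrightarrow> Y \<in> borel_measurable P \<and>
     (if s2 = 0 then (AE \<omega> in P. Y \<omega> = m)
      else 0 < s2 \<and> distributed P lborel Y (normal_density m (sqrt s2)))"

(* A vector is jointly Gaussian iff each linear combination of its entries is Gaussian;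
   the stated mean and variance make m the mean function and \<kappa> the covariance function. *)
definition gaussian_process ::
  "'w measure \<Rightarrow> 'x set \<Rightarrow> ('x \<Rightarrow> 'w \<Rightarrow> real) \<Rightarrow> ('x \<Rightarrow> real) \<Rightarrow> ('x \<Rightarrow> 'x \<Rightarrow> real) \<Rightarrow> bool" where
  "gaussian_process P X f m \<kappa> \<longleftrightarrow>
     (\<forall>S w. finite S \<and> S \<subseteq> X \<longrightarrow>
        normal_rv P (\<lambda>\<omega>. \<Sum>x\<in>S. w x * f x \<omega>) (\<Sum>x\<in>S. w x * m x)
          (\<Sum>x\<in>S. \<Sum>x'\<in>S. w x * w x' * \<kappa> x x'))"


subsection \<open>Gaussian process regression\<close>

definition cov_row :: "('x \<Rightarrow> 'x \<Rightarrow> real) \<Rightarrow> 'x list \<Rightarrow> 'x \<Rightarrow> real Matrix.vec" where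
  "cov_row \<kappa> vs x = Matrix.vec (length vs) (\<lambda>r. \<kappa> x (vs ! r))"

definition cov_col :: "('x \<Rightarrow> 'x \<Rightarrow> real) \<Rightarrow> 'x list \<Rightarrow> 'x \<Rightarrow> real Matrix.vec" where
  "cov_col \<kappa> vs x = Matrix.vec (length vs) (\<lambda>r. \<kappa> (vs ! r) x)"

(* \<kappa>(V,V) + l(V). It is invertible whenever \<kappa> is a covariance function and l > 0. *)
definition noisy_gram :: "('x \<Rightarrow> 'x \<Rightarrow> real) \<Rightarrow> ('x \<Rightarrow> real) \<Rightarrow> 'x list \<Rightarrow> real Matrix.mat" where
  "noisy_gram \<kappa> l vs =
     Matrix.mat (length vs) (length vs) (\<lambda>(r, s). \<kappa> (vs ! r) (vs ! s))
     + mat_diag (length vs) (\<lambda>r. l (vs ! r))"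

definition gpr_mean ::
  "('x \<Rightarrow> real) \<Rightarrow> ('x \<Rightarrow> 'x \<Rightarrow> real) \<Rightarrow> ('x \<Rightarrow> real) \<Rightarrow> 'x list \<Rightarrow> real list \<Rightarrow> 'x \<Rightarrow> real" where
  "gpr_mean m \<kappa> l vs ys x =
     m x + scalar_prod (cov_row \<kappa> vs x)
       (the (mat_inverse (noisy_gram \<kappa> l vs)) *\<^sub>v (vec_of_list ys - vec_of_list (map m vs)))"

definition gpr_cov ::
  "('x \<Rightarrow> 'x \<Rightarrow> real) \<Rightarrow> ('x \<Rightarrow> real) \<Rightarrow> 'x list \<Rightarrow> 'x \<Rightarrow> 'x \<Rightarrow> real" where
  "gpr_cov \<kappa> l vs x x' =
     \<kappa> x x' - scalar_prod (cov_row \<kappa> vs x)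
       (the (mat_inverse (noisy_gram \<kappa> l vs)) *\<^sub>v cov_col \<kappa> vs x')"


subsection \<open>Sampling histories and posteriors\<close>

text \<open>
  Throughout, \<open>a n\<close> and \<open>v n\<close> are the alternative and the location sampled at time \<open>n\<close>, and
  \<open>y (Suc n)\<close> is the resulting observation (\<open>y 0\<close> is never used).
\<close>

definition hist_algebra ::
  "'w measure \<Rightarrow> (nat \<Rightarrow> 'w \<Rightarrow> nat) \<Rightarrow> (nat \<Rightarrow> 'w \<Rightarrow> 'x::topological_space) \<Rightarrow> (nat \<Rightarrow> 'w \<Rightarrow> real)
    \<Rightarrow> nat \<Rightarrow> 'w measure" where
  "hist_algebra P a v y n =
     vimage_algebra (space P) (\<lambda>\<omega>. \<lambda>l\<in>{..<n}. (a l \<omega>, v l \<omega>, y (Suc l) \<omega>))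
       (Pi\<^sub>M {..<n} (\<lambda>_. count_space UNIV \<Otimes>\<^sub>M borel \<Otimes>\<^sub>M borel))"

definition sample_times :: "(nat \<Rightarrow> 'w \<Rightarrow> nat) \<Rightarrow> nat \<Rightarrow> nat \<Rightarrow> 'w \<Rightarrow> nat list" where
  "sample_times a i n \<omega> = filter (\<lambda>l. a l \<omega> = i) [0..<n]"

(* The conditional mean and covariance of \<theta>_i given the history up to time n. As functions of the
   location they are taken in the version given by the regression formulas, since conditional
   expectations by themselves are determined only almost surely for each single location. *)
definition post_mean ::
  "(nat \<Rightarrow> 'x \<Rightarrow> real) \<Rightarrow> (nat \<Rightarrow> 'x \<Rightarrow> 'x \<Rightarrow> real) \<Rightarrow> (nat \<Rightarrow> 'x \<Rightarrow> real) \<Rightarrow>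
   (nat \<Rightarrow> 'w \<Rightarrow> nat) \<Rightarrow> (nat \<Rightarrow> 'w \<Rightarrow> 'x) \<Rightarrow> (nat \<Rightarrow> 'w \<Rightarrow> real) \<Rightarrow>
   nat \<Rightarrow> nat \<Rightarrow> 'x \<Rightarrow> 'w \<Rightarrow> real" where
  "post_mean \<mu>0 k0 lam a v y i n x \<omega> =
     gpr_mean (\<mu>0 i) (k0 i) (lam i)
       (map (\<lambda>l. v l \<omega>) (sample_times a i n \<omega>))
       (map (\<lambda>l. y (Suc l) \<omega>) (sample_times a i n \<omega>)) x"

definition post_cov ::
  "(nat \<Rightarrow> 'x \<Rightarrow> 'x \<Rightarrow> real) \<Rightarrow> (nat \<Rightarrow> 'x \<Rightarrow> real) \<Rightarrow>
   (nat \<Rightarrow> 'w \<Rightarrow> nat) \<Rightarrow> (nat \<Rightarrow> 'w \<Rightarrow> 'x) \<Rightarrow>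
   nat \<Rightarrow> nat \<Rightarrow> 'x \<Rightarrow> 'x \<Rightarrow> 'w \<Rightarrow> real" where
  "post_cov k0 lam a v i n x x' \<omega> =
     gpr_cov (k0 i) (lam i) (map (\<lambda>l. v l \<omega>) (sample_times a i n \<omega>)) x x'"

definition sigma_tilde ::
  "(nat \<Rightarrow> 'x \<Rightarrow> 'x \<Rightarrow> real) \<Rightarrow> (nat \<Rightarrow> 'x \<Rightarrow> real) \<Rightarrow>
   (nat \<Rightarrow> 'w \<Rightarrow> nat) \<Rightarrow> (nat \<Rightarrow> 'w \<Rightarrow> 'x) \<Rightarrow>
   nat \<Rightarrow> nat \<Rightarrow> 'x \<Rightarrow> 'x \<Rightarrow> 'w \<Rightarrow> real" where
  "sigma_tilde k0 lam a v i n x x' \<omega> =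
     post_cov k0 lam a v i n x x' \<omega> / sqrt (post_cov k0 lam a v i n x' x' \<omega> + lam i x')"


subsection \<open>The integrated knowledge gradient policy\<close>

(* The inner integral is the conditional expectation, given the history and a^n = i, v^n = x, of the
   largest posterior mean at u after the next sample: the posterior mean of i moves by
   sigma_tilde(u,x) times a standard normal variable, the others do not move. *)
definition ikg ::
  "nat \<Rightarrow> 'x::euclidean_space set \<Rightarrow> ('x \<Rightarrow> real) \<Rightarrow>
   (nat \<Rightarrow> 'x \<Rightarrow> real) \<Rightarrow> (nat \<Rightarrow> 'x \<Rightarrow> 'x \<Rightarrow> real) \<Rightarrow> (nat \<Rightarrow> 'x \<Rightarrow> real) \<Rightarrow> (nat \<Rightarrow> 'x \<Rightarrow> real) \<Rightarrow>
   (nat \<Rightarrow> 'w \<Rightarrow> nat) \<Rightarrow> (nat \<Rightarrow> 'w \<Rightarrow> 'x) \<Rightarrow> (nat \<Rightarrow> 'w \<Rightarrow> real) \<Rightarrow>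
   nat \<Rightarrow> nat \<Rightarrow> 'x \<Rightarrow> 'w \<Rightarrow> real" where
  "ikg M X \<gamma> \<mu>0 k0 lam c a v y n i x \<omega> =
     1 / c i x *
     (LINT u:X|lborel.
        ((LINT z|density lborel std_normal_density.
            (MAX j\<in>{1..M}. post_mean \<mu>0 k0 lam a v y j n u \<omega>
               + (if j = i then sigma_tilde k0 lam a v i n u x \<omega> * z else 0)))
         - (MAX j\<in>{1..M}. post_mean \<mu>0 k0 lam a v y j n u \<omega>)) * \<gamma> u)"

definition ikg_policy ::
  "'w measure \<Rightarrow> nat \<Rightarrow> 'x::euclidean_space set \<Rightarrow> ('x \<Rightarrow> real) \<Rightarrow>
   (nat \<Rightarrow> 'x \<Rightarrow> real) \<Rightarrow> (nat \<Rightarrow> 'x \<Rightarrow> 'x \<Rightarrow> real) \<Rightarrow> (nat \<Rightarrow> 'x \<Rightarrow> real) \<Rightarrow> (nat \<Rightarrow> 'x \<Rightarrow> real) \<Rightarrow>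
   (nat \<Rightarrow> 'w \<Rightarrow> nat) \<Rightarrow> (nat \<Rightarrow> 'w \<Rightarrow> 'x) \<Rightarrow> (nat \<Rightarrow> 'w \<Rightarrow> real) \<Rightarrow> bool" where
  "ikg_policy P M X \<gamma> \<mu>0 k0 lam c a v y \<longleftrightarrow>
     (\<forall>n. \<forall>\<omega>\<in>space P.
        is_arg_max (\<lambda>(i, x). ikg M X \<gamma> \<mu>0 k0 lam c a v y n i x \<omega>)
          (\<lambda>(i, x). i \<in> {1..M} \<and> x \<in> X) (a n \<omega>, v n \<omega>))"

definition budget_time ::
  "(nat \<Rightarrow> 'x \<Rightarrow> real) \<Rightarrow> (nat \<Rightarrow> 'w \<Rightarrow> nat) \<Rightarrow> (nat \<Rightarrow> 'w \<Rightarrow> 'x) \<Rightarrow> real \<Rightarrow> 'w \<Rightarrow> nat" where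
  "budget_time c a v B \<omega> = (LEAST N. (\<Sum>n=0..N. c (a n \<omega>) (v n \<omega>)) > B)"


subsection \<open>The probabilistic model\<close>

definition prob_density_on :: "'x::euclidean_space set \<Rightarrow> ('x \<Rightarrow> real) \<Rightarrow> bool" where
  "prob_density_on X \<gamma> \<longleftrightarrow>
     set_integrable lborel X \<gamma> \<and> (\<forall>x\<in>X. 0 \<le> \<gamma> x) \<and> (LINT x:X|lborel. \<gamma> x) = 1"

(* The prior and sampling mechanism, for an arbitrary adapted sampling policy (a, v).
   \<open>e n\<close> is the standardised noise of the observation \<open>y (Suc n)\<close>.
   \<open>prior_measurable\<close> selects a measurable version of the prior process (e.g. one with continuous
   paths). It is needed because the sampling model evaluates \<theta> at the random location \<open>v n \<omega>\<close>,
   where the finite-dimensional distributions alone do not determine its value. *)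
locale covariate_sampling = prob_space P
  for P :: "'w measure" +
  fixes M :: nat
    and X :: "'x::euclidean_space set"
    and \<mu>0 :: "nat \<Rightarrow> 'x \<Rightarrow> real"
    and k0 :: "nat \<Rightarrow> 'x \<Rightarrow> 'x \<Rightarrow> real"
    and lam :: "nat \<Rightarrow> 'x \<Rightarrow> real"
    and \<theta> :: "nat \<Rightarrow> 'x \<Rightarrow> 'w \<Rightarrow> real"
    and e :: "nat \<Rightarrow> 'w \<Rightarrow> real"
    and a :: "nat \<Rightarrow> 'w \<Rightarrow> nat"
    and v :: "nat \<Rightarrow> 'w \<Rightarrow> 'x"
    and y :: "nat \<Rightarrow> 'w \<Rightarrow> real"
  assumes prior_gaussian: "\<And>i. i \<in> {1..M} \<Longrightarrow> gaussian_process P X (\<theta> i) (\<mu>0 i) (k0 i)"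
    and prior_indep:
      "indep_vars (\<lambda>_. Pi\<^sub>M X (\<lambda>_. borel)) (\<lambda>i \<omega>. \<lambda>x\<in>X. \<theta> i x \<omega>) {1..M}"
    and prior_measurable: "\<And>i. i \<in> {1..M} \<Longrightarrow>
      (\<lambda>(x, \<omega>). \<theta> i x \<omega>) \<in> borel_measurable
        (restrict_space borel X \<Otimes>\<^sub>M
         vimage_algebra (space P) (\<lambda>\<omega>. \<lambda>x\<in>X. \<theta> i x \<omega>) (Pi\<^sub>M X (\<lambda>_. borel)))"
    and noise_normal: "\<And>n. distributed P lborel (e n) std_normal_density"
    and noise_indep: "indep_vars (\<lambda>_. borel) e UNIV"
    and noise_prior_indep:
      "indep_set
         (sets (vimage_algebra (space P)
            (\<lambda>\<omega>. \<lambda>(i, x)\<in>{1..M} \<times> X. \<theta> i x \<omega>) (Pi\<^sub>M ({1..M} \<times> X) (\<lambda>_. borel))))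
         (sets (vimage_algebra (space P) (\<lambda>\<omega> n. e n \<omega>) (Pi\<^sub>M UNIV (\<lambda>_. borel))))"
    and decision_range: "\<And>n \<omega>. \<omega> \<in> space P \<Longrightarrow> a n \<omega> \<in> {1..M} \<and> v n \<omega> \<in> X"
    and decision_adapted: "\<And>n.
      (\<lambda>\<omega>. (a n \<omega>, v n \<omega>)) \<in> hist_algebra P a v y n \<rightarrow>\<^sub>M count_space UNIV \<Otimes>\<^sub>M borel"
    and observation: "\<And>n \<omega>. \<omega> \<in> space P \<Longrightarrow>
      y (Suc n) \<omega> = \<theta> (a n \<omega>) (v n \<omega>) \<omega> + sqrt (lam (a n \<omega>) (v n \<omega>)) * e n \<omega>"


subsection \<open>Conditions on the correlation functions and on the covariate density\<close>

(* Norms 0 and 1 are excluded because of the conventions ln 0 = 0 and C / 0 = 0: at norm 1 the intended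
   bound is infinite, and at norm 0 it reads 1 - \<rho> 0 \<le> 0. *)
definition log_modulus :: "('x::euclidean_space \<Rightarrow> real) \<Rightarrow> bool" where
  "log_modulus \<rho> \<longleftrightarrow>
     (\<exists>C \<epsilon> u. 0 < C \<and> 0 < \<epsilon> \<and> 0 < u \<and>
        (\<forall>d. norm d < u \<and> norm d \<noteq> 0 \<and> norm d \<noteq> 1 \<longrightarrow>
           1 - \<rho> d \<le> C / \<bar>ln (norm d)\<bar> powr (1 + \<epsilon>)))"

(* Positivity of a density \<gamma> on X is understood as: \<gamma> > 0 pointwise, and every point of X belongs to
   the support of the distribution with density \<gamma>. The second part holds automatically when X is the
   closure of its interior, but not when parts of X are isolated Lebesgue null sets, where the values
   of a density carry no information. On such parts consistency can fail: for
   X = {0..1} \<union> {2}, constant \<mu>0, lam and c, and k0(x,x') = exp(-|x - x'|), sampling at 2 is at every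
   stage strictly worse than sampling at 1, so the policy never samples at 2 and the posterior
   variance there stays above 1 - exp(-2). *)
definition positive_density_on :: "'x::euclidean_space set \<Rightarrow> ('x \<Rightarrow> real) \<Rightarrow> bool" where
  "positive_density_on X \<gamma> \<longleftrightarrow>
     (\<forall>x\<in>X. 0 < \<gamma> x) \<and>
     (\<forall>x\<in>X. \<forall>U. open U \<and> x \<in> U \<longrightarrow> 0 < (LINT u:X \<inter> U|lborel. \<gamma> u))"

end

theory Submission
  imports Defs "Jordan_Normal_Form.Determinant"
begin

text \<open>
  Pairs of an arm and a location are treated as indices of one Gaussian process with a block diagonal
  kernel, and the regression formulas become a Kalman recursion. Since the designs are adapted, Bayes'
  formula expresses expectations by freezing the observed history \<open>\<omega>'\<close> and integrating the field
  \<open>\<omega>\<close> against the likelihood of that history; under this weight the field is again Gaussian, with the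
  regression mean and covariance. Hence the posterior means form closed martingales.

  Along any sampling path the squares of \<open>sigma_tilde\<close> telescope to at most the prior variance, so
  the knowledge gradient of the sampled point, and by the policy that of every point, tends to 0. If a
  posterior variance stayed above some \<open>\<delta> > 0\<close>, then \<open>sigma_tilde\<close> would stay bounded below near that
  point, while by Fatou's lemma the posterior means are bounded in \<open>L\<^sup>1\<close> along a subsequence; this
  keeps the knowledge gradient of that point away from 0. So the posterior variances vanish, the
  posterior means converge by the maximal inequality, and the budget only changes time.
\<close>


section \<open>Positive semidefinite kernels\<close>

text \<open>The obstacle is that the knowledge gradient at a point can be small although the
  posterior variance there is large, namely when the posterior means of the arms lie far apart. So
  the means must be controlled at infinitely many times and over all locations together, whereas a
  pathwise bound at a fixed location holds only off a null set that may depend on it. The remedy is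
  to integrate over the locations before passing to the limit: the bounds in mean are uniform in
  time and location, and Fubini with Fatou then yields one null set for all arms and locations. A
  subsequence suffices because the knowledge gradient of the sampled point tends to 0 along the
  whole sequence. The variances cause no such trouble: the bounds on them hold on every sampling
  path, with constants taken from the prior kernel. Freezing the history is what makes the Gaussian
  calculus available: the designs are random, but for a frozen \<open>\<omega>'\<close> they are
  constants, and each observation multiplies the weight by one Gaussian factor.\<close>

abbreviation quad_form :: "'i set \<Rightarrow> ('i \<Rightarrow> real) \<Rightarrow> ('i \<Rightarrow> 'i \<Rightarrow> real) \<Rightarrow> real" where
  "quad_form S w K \<equiv> (\<Sum>p\<in>S. \<Sum>q\<in>S. w p * w q * K p q)"

definition psd_on :: "'i set \<Rightarrow> ('i \<Rightarrow> 'i \<Rightarrow> real) \<Rightarrow> bool" where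
  "psd_on I K \<longleftrightarrow> (\<forall>p\<in>I. \<forall>q\<in>I. K p q = K q p) \<and>
     (\<forall>S w. finite S \<and> S \<subseteq> I \<longrightarrow> 0 \<le> quad_form S w K)"

text \<open>The conditional covariance of a Gaussian process after one observation at
  \<open>z\<close> with noise variance \<open>l\<close>; the denominator is the variance of that
  observation.\<close>

definition kalman_cov :: "('i \<Rightarrow> 'i \<Rightarrow> real) \<Rightarrow> real \<Rightarrow> 'i \<Rightarrow> 'i \<Rightarrow> 'i \<Rightarrow> real" where
  "kalman_cov K l z p q = K p q - K p z * K z q / (K z z + l)"

definition kalman_mean :: "('i \<Rightarrow> real) \<Rightarrow> ('i \<Rightarrow> 'i \<Rightarrow> real) \<Rightarrow> real \<Rightarrow> 'i \<Rightarrow> real \<Rightarrow> 'i \<Rightarrow> real" where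
  "kalman_mean m K l z r p = m p + K p z * (r - m z) / (K z z + l)"

lemma psd_on_sym: "psd_on I K \<Longrightarrow> p \<in> I \<Longrightarrow> q \<in> I \<Longrightarrow> K p q = K q p"
  by (simp add: psd_on_def)

lemma psd_on_nonneg:
  "psd_on I K \<Longrightarrow> finite S \<Longrightarrow> S \<subseteq> I \<Longrightarrow> 0 \<le> quad_form S w K"
  by (simp add: psd_on_def)

lemma psd_on_diag:
  assumes "psd_on I K" "p \<in> I" shows "0 \<le> K p p"
  using psd_on_nonneg[OF assms(1), of "{p}" "\<lambda>_. 1"] assms(2) by simp

text \<open>The point \<open>z\<close> may already belong to \<open>S\<close>; writing the new
  weight as a sum of two contributions covers both cases.\<close>

lemma sum_add_point:
  fixes w :: "'i \<Rightarrow> real"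
  assumes "finite S"
  shows "(\<Sum>p\<in>insert z S. ((if p \<in> S then w p else 0) + (if p = z then t else 0)) * h p)
    = (\<Sum>p\<in>S. w p * h p) + t * h z"
proof -
  have "(\<Sum>p\<in>insert z S. (if p \<in> S then w p else 0) * h p) = (\<Sum>p\<in>S. w p * h p)"
    by (rule sum.mono_neutral_cong_right) (use assms in auto)
  moreover have "(\<Sum>p\<in>insert z S. (if p = z then t else 0) * h p) = t * h z"
    using assms by (simp add: if_distrib[of "\<lambda>x. x * _"] sum.delta cong: if_cong)
  ultimately show ?thesis by (simp only: distrib_right sum.distrib)
qed

text \<open>As a polynomial in \<open>t\<close> the form serves twice: its nonnegativity gives the
  Cauchy-Schwarz inequality, and in \<open>gp_weight_observe\<close> it enters the exponent of a
  Fourier integral over \<open>t\<close>.\<close>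

lemma quadratic_form_add_point:
  fixes w :: "'i \<Rightarrow> real" and S z t
  assumes "finite S"
  defines "u \<equiv> \<lambda>p. (if p \<in> S then w p else 0) + (if p = z then t else 0)"
  shows "quad_form (insert z S) u K =
    quad_form S w K + t * (\<Sum>p\<in>S. w p * K p z) + t * (\<Sum>p\<in>S. w p * K z p) + t\<^sup>2 * K z z"
proof -
  have "quad_form (insert z S) u K
      = (\<Sum>p\<in>insert z S. u p * (\<Sum>q\<in>insert z S. u q * K p q))"
    by (simp only: sum_distrib_left mult.assoc)
  also have "\<dots> = (\<Sum>p\<in>S. w p * ((\<Sum>q\<in>S. w q * K p q) + t * K p z)) + t * ((\<Sum>q\<in>S. w q * K z q) + t * K z z)"
    unfolding u_def sum_add_point[OF assms(1)] ..
  also have "\<dots> = quad_form S w K + t * (\<Sum>p\<in>S. w p * K p z) + t * (\<Sum>p\<in>S. w p * K z p) + t\<^sup>2 * K z z"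
    by (simp add: distrib_left sum.distrib sum_distrib_left power2_eq_square mult_ac)
  finally show ?thesis .
qed

lemma psd_on_Cauchy_Schwarz:
  assumes K: "psd_on I K" and S: "finite S" "S \<subseteq> I" and z: "z \<in> I"
  shows "(\<Sum>p\<in>S. w p * K p z)\<^sup>2 \<le> quad_form S w K * K z z"
proof -
  define A where "A = quad_form S w K"
  define B where "B = (\<Sum>p\<in>S. w p * K p z)"
  have B2: "(\<Sum>p\<in>S. w p * K z p) = B"
    unfolding B_def by (intro sum.cong refl) (use S z psd_on_sym[OF K z] in auto)
  have "0 \<le> A + t * B + t * B + t\<^sup>2 * K z z" for t
    using psd_on_nonneg[OF K, of "insert z S" "\<lambda>p. (if p \<in> S then w p else 0) + (if p = z then t else 0)"] S z
    unfolding quadratic_form_add_point[OF S(1)] B2 A_def[symmetric] B_def[symmetric] by blast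
  then have quad: "0 \<le> A + 2 * t * B + t\<^sup>2 * K z z" for t
    by (simp only: mult_2 distrib_right add.assoc)
  have zz: "0 \<le> K z z" by (rule psd_on_diag[OF K z])
  have "B\<^sup>2 \<le> A * K z z"
  proof (cases "K z z = 0")
    case True
    have "B = 0"
    proof (rule ccontr)
      assume "B \<noteq> 0"
      \<comment> \<open>This \<open>t\<close> gives the polynomial the value -1.\<close>
      moreover have "0 \<le> A + 2 * (- (A + 1) / (2 * B)) * B"
        using quad[of "- (A + 1) / (2 * B)"] True by simp
      ultimately show False by (simp add: field_simps)
    qed
    then show ?thesis using True by simp
  next
    case False
    with zz have pos: "K z z > 0" by simp
    \<comment> \<open>\<open>- B / K z z\<close> is the minimiser of the polynomial.\<close>
    have "0 \<le> A + 2 * (- B / K z z) * B + (- B / K z z)\<^sup>2 * K z z" by (rule quad)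
    also have "\<dots> = A - B\<^sup>2 / K z z"
      using pos by (simp add: field_simps power2_eq_square)
    finally show ?thesis using pos by (simp add: field_simps)
  qed
  then show ?thesis by (simp add: A_def B_def)
qed

lemma psd_on_kernel_Cauchy_Schwarz:
  assumes "psd_on I K" "p \<in> I" "z \<in> I"
  shows "(K p z)\<^sup>2 \<le> K p p * K z z"
  using psd_on_Cauchy_Schwarz[OF assms(1), of "{p}" z "\<lambda>_. 1"] assms by simp

text \<open>Cauchy-Schwarz for the weights 1 at \<open>p\<close> and -1 at \<open>q\<close>. The
  case \<open>p = q\<close> is separate because \<open>{p, q}\<close> then has a single
  element.\<close>

lemma psd_on_increment_Cauchy_Schwarz:
  assumes "psd_on I K" "p \<in> I" "q \<in> I" "z \<in> I"
  shows "(K p z - K q z)\<^sup>2 \<le> (K p p - 2 * K p q + K q q) * K z z"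
proof (cases "p = q")
  case False
  then show ?thesis
    using psd_on_Cauchy_Schwarz[OF assms(1), of "{p, q}" z "\<lambda>x. if x = p then 1 else - 1"] assms
      psd_on_sym[OF assms(1-3)]
    by (simp add: algebra_simps)
qed simp

lemma quadratic_form_kalman_cov:
  assumes K: "psd_on I K" and z: "z \<in> I" and S: "S \<subseteq> I"
  shows "quad_form S w (kalman_cov K l z) =
     quad_form S w K - (\<Sum>p\<in>S. w p * K p z)\<^sup>2 / (K z z + l)"
proof -
  define B where "B = (\<Sum>p\<in>S. w p * K p z)"
  have B': "(\<Sum>p\<in>S. w p * K z p) = B"
    unfolding B_def by (intro sum.cong refl) (use S z psd_on_sym[OF K] in auto)
  have "quad_form S w (kalman_cov K l z) =
     quad_form S w K - (\<Sum>p\<in>S. \<Sum>q\<in>S. (w p * K p z) * (w q * K z q)) / (K z z + l)"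
    unfolding sum_divide_distrib sum_subtractf[symmetric] kalman_cov_def
    by (intro sum.cong refl) (simp add: field_simps)
  also have "(\<Sum>p\<in>S. \<Sum>q\<in>S. (w p * K p z) * (w q * K z q)) = B * B"
    unfolding sum_product[symmetric] B' by (simp add: B_def)
  finally show ?thesis by (simp add: power2_eq_square B_def)
qed

text \<open>By Cauchy-Schwarz the subtracted square is at most the old form times
  \<open>K z z\<close>, and the denominator exceeds \<open>K z z\<close> by the noise.\<close>

lemma psd_on_kalman_cov:
  assumes K: "psd_on I K" and z: "z \<in> I" and l: "0 < l"
  shows "psd_on I (kalman_cov K l z)"
  unfolding psd_on_def
proof (intro conjI allI impI ballI)
  fix p q assume "p \<in> I" "q \<in> I"
  then show "kalman_cov K l z p q = kalman_cov K l z q p"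
    using psd_on_sym[OF K] z by (simp add: kalman_cov_def)
next
  fix S and w :: "'a \<Rightarrow> real" assume S: "finite S \<and> S \<subseteq> I"
  have zz: "0 \<le> K z z" by (rule psd_on_diag[OF K z])
  have "(\<Sum>p\<in>S. w p * K p z)\<^sup>2 \<le> quad_form S w K * K z z"
    by (rule psd_on_Cauchy_Schwarz[OF K]) (use S z in auto)
  also have "\<dots> \<le> quad_form S w K * (K z z + l)"
    using psd_on_nonneg[OF K, of S w] S l by (intro mult_left_mono) auto
  finally show "0 \<le> quad_form S w (kalman_cov K l z)"
    using quadratic_form_kalman_cov[OF K z, of S w l] S zz l by (simp add: divide_le_eq)
qed

text \<open>The state of the Kalman recursion along designs \<open>d 0, d 1, \<dots>\<close> with observation \<open>r n\<close>
  at \<open>d n\<close>.\<close>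

primrec kcov :: "('i \<Rightarrow> 'i \<Rightarrow> real) \<Rightarrow> ('i \<Rightarrow> real) \<Rightarrow> (nat \<Rightarrow> 'i) \<Rightarrow> nat \<Rightarrow> 'i \<Rightarrow> 'i \<Rightarrow> real" where
  "kcov K l d 0 = K"
| "kcov K l d (Suc n) = kalman_cov (kcov K l d n) (l (d n)) (d n)"

primrec kmean :: "('i \<Rightarrow> real) \<Rightarrow> ('i \<Rightarrow> 'i \<Rightarrow> real) \<Rightarrow> ('i \<Rightarrow> real) \<Rightarrow> (nat \<Rightarrow> 'i) \<Rightarrow> (nat \<Rightarrow> real)
    \<Rightarrow> nat \<Rightarrow> 'i \<Rightarrow> real" where
  "kmean m K l d r 0 = m"
| "kmean m K l d r (Suc n) = kalman_mean (kmean m K l d r n) (kcov K l d n) (l (d n)) (d n) (r n)"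

section \<open>Bounds along a sampling path\<close>

context
  fixes I :: "'i set" and K :: "'i \<Rightarrow> 'i \<Rightarrow> real" and l :: "'i \<Rightarrow> real" and d :: "nat \<Rightarrow> 'i"
  assumes K: "psd_on I K" and d: "\<And>n. d n \<in> I" and l: "\<And>p. p \<in> I \<Longrightarrow> 0 < l p"
begin

lemma psd_on_kcov: "psd_on I (kcov K l d n)"
  by (induction n) (simp_all add: K psd_on_kalman_cov d l)

lemma kcov_noise_pos: "0 < kcov K l d n (d n) (d n) + l (d n)"
  using psd_on_diag[OF psd_on_kcov[of n] d[of n]] l[OF d[of n]] by linarith

lemma kcov_gain_sum:
  assumes "p \<in> I"
  shows "(\<Sum>n<N. (kcov K l d n p (d n))\<^sup>2 / (kcov K l d n (d n) (d n) + l (d n)))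
    = K p p - kcov K l d N p p"
proof (induction N)
  case (Suc N)
  then show ?case
    using psd_on_sym[OF psd_on_kcov[of N] d[of N] \<open>p \<in> I\<close>]
    by (simp add: kalman_cov_def power2_eq_square)
qed simp

lemma kcov_diag_antimono:
  assumes "p \<in> I" shows "decseq (\<lambda>n. kcov K l d n p p)"
proof (rule decseq_SucI)
  fix n
  have "kcov K l d (Suc n) p p = kcov K l d n p p - (kcov K l d n p (d n))\<^sup>2 / (kcov K l d n (d n) (d n) + l (d n))"
    using psd_on_sym[OF psd_on_kcov[of n] d[of n] \<open>p \<in> I\<close>] by (simp add: kalman_cov_def power2_eq_square)
  then show "kcov K l d (Suc n) p p \<le> kcov K l d n p p"
    using kcov_noise_pos[of n] by simp
qed

lemma kcov_diag_le:
  assumes "p \<in> I" shows "kcov K l d n p p \<le> K p p"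
  using decseqD[OF kcov_diag_antimono[OF assms], of 0 n] by simp

text \<open>An observation can only lower the variance of an increment. Hence the modulus of
  continuity of the prior kernel serves the posterior kernels at all times.\<close>

lemma kcov_increment_le:
  assumes p: "p \<in> I" "q \<in> I"
  shows "kcov K l d n p p - 2 * kcov K l d n p q + kcov K l d n q q \<le> K p p - 2 * K p q + K q q"
proof (induction n)
  case (Suc n)
  let ?k = "kcov K l d n"
  have s: "?k (d n) p = ?k p (d n)" "?k (d n) q = ?k q (d n)"
    by (rule psd_on_sym[OF psd_on_kcov d p(1)], rule psd_on_sym[OF psd_on_kcov d p(2)])
  have "kcov K l d (Suc n) p p - 2 * kcov K l d (Suc n) p q + kcov K l d (Suc n) q q
     = ?k p p - 2 * ?k p q + ?k q q - (?k p (d n) - ?k q (d n))\<^sup>2 / (?k (d n) (d n) + l (d n))"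
    by (simp add: kalman_cov_def s diff_divide_distrib add_divide_distrib power2_eq_square algebra_simps)
  also have "\<dots> \<le> ?k p p - 2 * ?k p q + ?k q q"
    using kcov_noise_pos[of n] by simp
  finally show ?case using Suc by linarith
qed simp

lemma kcov_gain_tendsto_0:
  assumes "p \<in> I"
  shows "(\<lambda>n. (kcov K l d n p (d n))\<^sup>2 / (kcov K l d n (d n) (d n) + l (d n))) \<longlonglongrightarrow> 0"
proof (rule summable_LIMSEQ_zero)
  show "summable (\<lambda>n. (kcov K l d n p (d n))\<^sup>2 / (kcov K l d n (d n) (d n) + l (d n)))"
  proof (rule summableI_nonneg_bounded)
    show "0 \<le> (kcov K l d n p (d n))\<^sup>2 / (kcov K l d n (d n) (d n) + l (d n))" for n
      using kcov_noise_pos[of n] by simp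
    show "(\<Sum>n<N. (kcov K l d n p (d n))\<^sup>2 / (kcov K l d n (d n) (d n) + l (d n))) \<le> K p p" for N
      unfolding kcov_gain_sum[OF assms] using psd_on_diag[OF psd_on_kcov[of N] assms] by simp
  qed
qed

text \<open>The left side is the drop of the variance at \<open>p\<close> that a sample at
  \<open>z\<close> would cause. The bound depends on neither \<open>n\<close> nor \<open>z\<close>
  and later provides the dominating constant for the knowledge gradient.\<close>

lemma kcov_gain_le:
  assumes "p \<in> I" "z \<in> I"
  shows "(kcov K l d n p z)\<^sup>2 / (kcov K l d n z z + l z) \<le> K p p"
proof -
  have pos: "0 < kcov K l d n z z + l z"
    using psd_on_diag[OF psd_on_kcov[of n] assms(2)] l[OF assms(2)] by linarith
  have "(kcov K l d n p z)\<^sup>2 \<le> kcov K l d n p p * kcov K l d n z z"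
    by (rule psd_on_kernel_Cauchy_Schwarz[OF psd_on_kcov assms])
  also have "\<dots> \<le> K p p * (kcov K l d n z z + l z)"
    using kcov_diag_le[OF assms(1), of n] psd_on_diag[OF psd_on_kcov[of n] assms(2)] assms l
      psd_on_diag[OF K assms(1)]
    by (intro mult_mono) (auto intro: less_imp_le)
  finally show ?thesis using pos by (simp add: divide_le_eq)
qed

end


section \<open>Gaussian process regression as a Kalman recursion\<close>

text \<open>The bilinear form of the inverse of \<open>noisy_gram\<close>. Both regression formulas
  are instances of it, so appending a design point is treated once for mean and covariance.\<close>

definition gram_form :: "('x \<Rightarrow> 'x \<Rightarrow> real) \<Rightarrow> ('x \<Rightarrow> real) \<Rightarrow> 'x list \<Rightarrow> (nat \<Rightarrow> real) \<Rightarrow> (nat \<Rightarrow> real) \<Rightarrow> real" where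
  "gram_form \<kappa> l vs h b = scalar_prod (Matrix.vec (length vs) h)
     (the (mat_inverse (noisy_gram \<kappa> l vs)) *\<^sub>v Matrix.vec (length vs) b)"

lemma gpr_cov_gram_form:
  "gpr_cov \<kappa> l vs x x' = \<kappa> x x' - gram_form \<kappa> l vs (\<lambda>r. \<kappa> x (vs ! r)) (\<lambda>r. \<kappa> (vs ! r) x')"
  by (simp add: gpr_cov_def gram_form_def cov_row_def cov_col_def)

lemma gpr_mean_gram_form:
  assumes "length ys = length vs"
  shows "gpr_mean m \<kappa> l vs ys x = m x + gram_form \<kappa> l vs (\<lambda>r. \<kappa> x (vs ! r)) (\<lambda>r. ys ! r - m (vs ! r))"
proof -
  have "vec_of_list ys - vec_of_list (map m vs) = Matrix.vec (length vs) (\<lambda>r. ys ! r - m (vs ! r))"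
    using assms by (intro eq_vecI) (auto simp: vec_of_list_index)
  then show ?thesis by (simp add: gpr_mean_def gram_form_def cov_row_def)
qed

lemma noisy_gram_carrier: "noisy_gram \<kappa> l vs \<in> carrier_mat (length vs) (length vs)"
  unfolding noisy_gram_def by simp

lemma noisy_gram_mult_vec_index:
  assumes "z \<in> carrier_vec (length vs)" "r < length vs"
  shows "(noisy_gram \<kappa> l vs *\<^sub>v z) $ r = (\<Sum>s<length vs. \<kappa> (vs ! r) (vs ! s) * z $ s) + l (vs ! r) * z $ r"
proof -
  have "(noisy_gram \<kappa> l vs *\<^sub>v z) $ r =
      (\<Sum>s<length vs. (\<kappa> (vs ! r) (vs ! s) + (if r = s then l (vs ! r) else 0)) * z $ s)"
    using assms unfolding noisy_gram_def
    by (auto simp: scalar_prod_def mat_diag_def lessThan_atLeast0 intro!: sum.cong)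
  also have "\<dots> = (\<Sum>s<length vs. \<kappa> (vs ! r) (vs ! s) * z $ s)
      + (\<Sum>s<length vs. if r = s then l (vs ! r) * z $ s else 0)"
    unfolding sum.distrib[symmetric] by (intro sum.cong refl) (simp add: distrib_right)
  also have "(\<Sum>s<length vs. if r = s then l (vs ! r) * z $ s else 0) = l (vs ! r) * z $ r"
    using assms by simp
  finally show ?thesis .
qed

text \<open>\<open>psd_on\<close> speaks of sets, while a list of designs may repeat points; the
  weights of equal entries are added up first.\<close>

lemma psd_on_list_nonneg:
  assumes "psd_on X \<kappa>" "set vs \<subseteq> X"
  shows "0 \<le> (\<Sum>r<length vs. \<Sum>s<length vs. z r * z s * \<kappa> (vs ! r) (vs ! s))"
proof -
  let ?N = "{..<length vs}"
  define w where "w x = (\<Sum>r | r \<in> ?N \<and> vs ! r = x. z r)" for x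
  have grp: "(\<Sum>x\<in>set vs. w x * f x) = (\<Sum>r\<in>?N. z r * f (vs ! r))" for f
  proof -
    have "(\<Sum>r\<in>?N. z r * f (vs ! r)) = (\<Sum>x\<in>set vs. \<Sum>r | r \<in> ?N \<and> vs ! r = x. z r * f (vs ! r))"
      by (rule sum.group[symmetric]) auto
    also have "\<dots> = (\<Sum>x\<in>set vs. w x * f x)"
      unfolding w_def sum_distrib_right by (intro sum.cong refl) auto
    finally show ?thesis by simp
  qed
  have "0 \<le> quad_form (set vs) w \<kappa>"
    by (rule psd_on_nonneg[OF assms(1)]) (use assms(2) in auto)
  also have "\<dots> = (\<Sum>p\<in>set vs. w p * (\<Sum>q\<in>set vs. w q * \<kappa> p q))"
    by (simp add: sum_distrib_left mult.assoc)
  also have "\<dots> = (\<Sum>r<length vs. \<Sum>s<length vs. z r * z s * \<kappa> (vs ! r) (vs ! s))"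
    unfolding grp by (simp add: sum_distrib_left mult.assoc)
  finally show ?thesis .
qed

text \<open>For a vector \<open>z\<close> in the kernel of the matrix the quadratic form is 0, but
  the noise alone contributes the sum of \<open>l (vs ! r) * (z $ r)\<^sup>2\<close>; so
  \<open>z\<close> vanishes.\<close>

lemma noisy_gram_inverse:
  assumes K: "psd_on X \<kappa>" and vs: "set vs \<subseteq> X" and l: "\<And>x. x \<in> X \<Longrightarrow> 0 < l x"
  obtains B where "mat_inverse (noisy_gram \<kappa> l vs) = Some B" "B \<in> carrier_mat (length vs) (length vs)"
    "noisy_gram \<kappa> l vs * B = 1\<^sub>m (length vs)" "B * noisy_gram \<kappa> l vs = 1\<^sub>m (length vs)"
proof -
  let ?n = "length vs" and ?A = "noisy_gram \<kappa> l vs"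
  have "Determinant.det ?A \<noteq> 0"
  proof
    assume "Determinant.det ?A = 0"
    then obtain z where z: "z \<in> carrier_vec ?n" "z \<noteq> 0\<^sub>v ?n" "?A *\<^sub>v z = 0\<^sub>v ?n"
      using det_0_iff_vec_prod_zero_field[OF noisy_gram_carrier] by blast
    have eq: "(\<Sum>s<?n. \<kappa> (vs ! r) (vs ! s) * z $ s) + l (vs ! r) * z $ r = 0" if "r < ?n" for r
      using noisy_gram_mult_vec_index[OF z(1) that, of \<kappa> l] z(3) that by simp
    have "0 = (\<Sum>r<?n. z $ r * ((\<Sum>s<?n. \<kappa> (vs ! r) (vs ! s) * z $ s) + l (vs ! r) * z $ r))"
      using eq by simp
    also have "\<dots> = (\<Sum>r<?n. \<Sum>s<?n. z $ r * z $ s * \<kappa> (vs ! r) (vs ! s)) + (\<Sum>r<?n. l (vs ! r) * (z $ r)\<^sup>2)"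
      unfolding sum.distrib[symmetric]
      by (intro sum.cong refl) (simp add: distrib_left sum_distrib_left power2_eq_square mult_ac)
    finally have "(\<Sum>r<?n. l (vs ! r) * (z $ r)\<^sup>2) \<le> 0"
      using psd_on_list_nonneg[OF K vs, of "\<lambda>r. z $ r"] by linarith
    moreover have pos: "\<And>r. r < ?n \<Longrightarrow> 0 < l (vs ! r)" using l vs by (meson nth_mem subsetD)
    ultimately have "\<forall>r\<in>{..<?n}. l (vs ! r) * (z $ r)\<^sup>2 = 0"
      by (subst sum_nonneg_eq_0_iff[symmetric])
        (auto intro!: antisym sum_nonneg mult_nonneg_nonneg intro: less_imp_le)
    then have "\<And>r. r < ?n \<Longrightarrow> z $ r = 0" using pos by (metis lessThan_iff less_irrefl mult_eq_0_iff power2_eq_square)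
    then have "z = 0\<^sub>v ?n" using z(1) by (intro eq_vecI) auto
    then show False using z(2) by simp
  qed
  \<comment> \<open>The argument \<open>()\<close> fills the dummy parameter of the matrix ring,
    whose units are the invertible matrices.\<close>
  from det_non_zero_imp_unit[OF noisy_gram_carrier this, of "()"]
    mat_inverse(1)[OF noisy_gram_carrier, of \<kappa> l vs "()"]
  obtain B where "mat_inverse ?A = Some B" by (cases "mat_inverse ?A") auto
  with mat_inverse(2)[OF noisy_gram_carrier this] that show thesis by blast
qed

context
  fixes \<kappa> :: "'x \<Rightarrow> 'x \<Rightarrow> real" and l :: "'x \<Rightarrow> real" and X vs
  assumes K: "psd_on X \<kappa>" and vs: "set vs \<subseteq> X" and l: "\<And>x. x \<in> X \<Longrightarrow> 0 < l x"
begin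

text \<open>Any solution of the linear system evaluates the form. Appending a design point thus only
  requires a solution of the larger system, not its inverse.\<close>

lemma gram_form_eq_sum:
  assumes z: "\<And>r. r < length vs \<Longrightarrow> (\<Sum>s<length vs. \<kappa> (vs ! r) (vs ! s) * z s) + l (vs ! r) * z r = b r"
  shows "gram_form \<kappa> l vs h b = (\<Sum>r<length vs. h r * z r)"
proof -
  let ?n = "length vs" and ?A = "noisy_gram \<kappa> l vs" and ?z = "Matrix.vec (length vs) z"
  obtain B where B: "mat_inverse ?A = Some B" "B \<in> carrier_mat ?n ?n" "B * ?A = 1\<^sub>m ?n"
    using noisy_gram_inverse[where l = l, OF K vs l] by blast
  have "?A *\<^sub>v ?z = Matrix.vec ?n b"
  proof (rule eq_vecI)
    fix r assume "r < dim_vec (Matrix.vec ?n b)"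
    then have r: "r < ?n" by simp
    show "(?A *\<^sub>v ?z) $ r = Matrix.vec ?n b $ r"
      unfolding noisy_gram_mult_vec_index[OF vec_carrier r] using z[OF r] r by simp
  qed (simp add: carrier_matD[OF noisy_gram_carrier])
  then have "B *\<^sub>v Matrix.vec ?n b = (B * ?A) *\<^sub>v ?z"
    using assoc_mult_mat_vec[OF B(2) noisy_gram_carrier, of ?z] by simp
  then have "B *\<^sub>v Matrix.vec ?n b = ?z" using B(3) by simp
  then show ?thesis
    by (simp add: gram_form_def B(1) scalar_prod_def lessThan_atLeast0)
qed

lemma gram_solution_exists:
  obtains z where
    "\<And>r. r < length vs \<Longrightarrow> (\<Sum>s<length vs. \<kappa> (vs ! r) (vs ! s) * z s) + l (vs ! r) * z r = b r"
proof -
  let ?n = "length vs" and ?A = "noisy_gram \<kappa> l vs"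
  obtain B where B: "B \<in> carrier_mat ?n ?n" "?A * B = 1\<^sub>m ?n"
    using noisy_gram_inverse[where l = l, OF K vs l] by blast
  define z where "z = B *\<^sub>v Matrix.vec ?n b"
  have zc: "z \<in> carrier_vec ?n" using B by (simp add: z_def)
  have "?A *\<^sub>v z = Matrix.vec ?n b"
    using assoc_mult_mat_vec[OF noisy_gram_carrier[of \<kappa> l vs] B(1), of "Matrix.vec ?n b"] B(2) by (simp add: z_def)
  then have "(\<Sum>s<?n. \<kappa> (vs ! r) (vs ! s) * z $ s) + l (vs ! r) * z $ r = b r" if "r < ?n" for r
    using noisy_gram_mult_vec_index[OF zc that, of \<kappa> l] that by simp
  then show thesis by (rule that)
qed

end

lemma gram_form_Nil: "gram_form \<kappa> l [] h b = 0"
  using gram_form_eq_sum[of "{}" \<kappa> "[]" l "\<lambda>_. 0" b h] by (simp add: psd_on_def)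

text \<open>Block elimination: appending a design point changes the form by a rank-one term with the
  Schur complement as denominator.\<close>

lemma gram_form_snoc:
  assumes K: "psd_on X \<kappa>" and vs: "set vs \<subseteq> X" "x \<in> X" and l: "\<And>x. x \<in> X \<Longrightarrow> 0 < l x"
    and n: "n = length vs" and g: "g = (\<lambda>r. \<kappa> (vs ! r) x)" and g': "g' = (\<lambda>r. \<kappa> x (vs ! r))"
    and D: "D = \<kappa> x x - gram_form \<kappa> l vs g' g + l x" "D \<noteq> 0"
  shows "gram_form \<kappa> l (vs @ [x]) h b = gram_form \<kappa> l vs h b
    + (h n - gram_form \<kappa> l vs h g) * (b n - gram_form \<kappa> l vs g' b) / D"
proof -
  obtain z where z: "\<And>r. r < n \<Longrightarrow> (\<Sum>s<n. \<kappa> (vs ! r) (vs ! s) * z s) + l (vs ! r) * z r = b r"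
    using gram_solution_exists[where l = l, OF K vs(1) l] unfolding n by metis
  obtain w where w: "\<And>r. r < n \<Longrightarrow> (\<Sum>s<n. \<kappa> (vs ! r) (vs ! s) * w s) + l (vs ! r) * w r = g r"
    using gram_solution_exists[where l = l, OF K vs(1) l] unfolding n by metis
  have Q: "gram_form \<kappa> l vs f b = (\<Sum>r<n. f r * z r)" "gram_form \<kappa> l vs f g = (\<Sum>r<n. f r * w r)" for f
    unfolding n by (rule gram_form_eq_sum[where l = l, OF K vs(1) l]; use z w n in simp)+
  \<comment> \<open>Elimination: \<beta> is the last coordinate of the new solution, and the other
    coordinates change by -\<beta> times \<open>w\<close>, the solution for the column
    \<open>g\<close> of the appended point.\<close>
  define \<beta> where "\<beta> = (b n - gram_form \<kappa> l vs g' b) / D"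
  define z' where "z' r = (if r < n then z r - \<beta> * w r else \<beta>)" for r
  have z'sum: "(\<Sum>s<Suc n. f s * z' s) = (\<Sum>s<n. f s * z s) - \<beta> * (\<Sum>s<n. f s * w s) + f n * \<beta>" for f
    by (simp add: z'_def right_diff_distrib sum_subtractf sum_distrib_left mult_ac)
  have len: "length (vs @ [x]) = Suc n" by (simp add: n)
  have "gram_form \<kappa> l (vs @ [x]) h b = (\<Sum>r<Suc n. h r * z' r)"
    unfolding len[symmetric]
  proof (rule gram_form_eq_sum[where l = l, OF K _ l])
    show "set (vs @ [x]) \<subseteq> X" using vs by simp
    fix r assume "r < length (vs @ [x])"
    then consider "r < n" | "r = n" using n by fastforce
    then show "(\<Sum>s<length (vs @ [x]). \<kappa> ((vs @ [x]) ! r) ((vs @ [x]) ! s) * z' s) + l ((vs @ [x]) ! r) * z' r = b r"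
    proof cases
      case 1
      have eq: "(\<Sum>s<n. \<kappa> (vs ! r) ((vs @ [x]) ! s) * f s) = (\<Sum>s<n. \<kappa> (vs ! r) (vs ! s) * f s)" for f :: "nat \<Rightarrow> real"
        by (intro sum.cong refl) (simp add: nth_append n)
      have "(\<Sum>s<Suc n. \<kappa> (vs ! r) ((vs @ [x]) ! s) * z' s) + l (vs ! r) * z' r = b r - \<beta> * g r + g r * \<beta>"
        unfolding z'sum eq using z[OF 1, symmetric] w[OF 1, symmetric] 1
        by (simp add: z'_def n g algebra_simps)
      then show ?thesis using 1 unfolding len by (simp add: nth_append n)
    next
      case 2
      have eq: "(\<Sum>s<n. \<kappa> x ((vs @ [x]) ! s) * f s) = (\<Sum>s<n. g' s * f s)" for f :: "nat \<Rightarrow> real"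
        by (intro sum.cong refl) (simp add: nth_append n g')
      have "(\<Sum>s<Suc n. \<kappa> x ((vs @ [x]) ! s) * z' s) + l x * z' n = gram_form \<kappa> l vs g' b + \<beta> * D"
        unfolding z'sum eq Q(1)[symmetric] Q(2)[symmetric] by (simp add: z'_def n D(1) algebra_simps)
      also have "\<dots> = b n" using D(2) by (simp add: \<beta>_def)
      finally show ?thesis using 2 unfolding len by (simp add: n)
    qed
  qed
  then show ?thesis
    unfolding z'sum Q(1)[symmetric] Q(2)[symmetric]
    by (simp add: \<beta>_def algebra_simps diff_divide_distrib add_divide_distrib)
qed

lemma gram_form_cong:
  "(\<And>r. r < length vs \<Longrightarrow> h r = h' r) \<Longrightarrow> (\<And>r. r < length vs \<Longrightarrow> b r = b' r) \<Longrightarrow>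
    gram_form \<kappa> l vs h b = gram_form \<kappa> l vs h' b'"
proof -
  assume "\<And>r. r < length vs \<Longrightarrow> h r = h' r" "\<And>r. r < length vs \<Longrightarrow> b r = b' r"
  then have "Matrix.vec (length vs) h = Matrix.vec (length vs) h'" "Matrix.vec (length vs) b = Matrix.vec (length vs) b'"
    by auto
  then show ?thesis by (simp add: gram_form_def)
qed

text \<open>\<open>D\<close> makes the Schur complement
  \<open>gpr_cov \<kappa> l vs x x + l x\<close> positive. It is a hypothesis because it becomes
  known inductively, once the regression on \<open>vs\<close> has been identified with the Kalman
  recursion.\<close>

lemma gpr_snoc:
  assumes K: "psd_on X \<kappa>" and vs: "set vs \<subseteq> X" "x \<in> X" and l: "\<And>x. x \<in> X \<Longrightarrow> 0 < l x"
    and D: "0 \<le> gpr_cov \<kappa> l vs x x"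
  shows "gpr_cov \<kappa> l (vs @ [x]) = kalman_cov (gpr_cov \<kappa> l vs) (l x) x"
    and "length ys = length vs \<Longrightarrow> gpr_mean m \<kappa> l (vs @ [x]) (ys @ [r])
      = kalman_mean (gpr_mean m \<kappa> l vs ys) (gpr_cov \<kappa> l vs) (l x) x r"
proof -
  have D': "\<kappa> x x - gram_form \<kappa> l vs (\<lambda>r. \<kappa> x (vs ! r)) (\<lambda>r. \<kappa> (vs ! r) x) + l x \<noteq> 0"
    using D l[OF vs(2)] unfolding gpr_cov_gram_form by linarith
  note snoc = gram_form_snoc[where l = l, OF K vs l refl refl refl refl D']
  have c: "gram_form \<kappa> l vs (\<lambda>r. \<kappa> p ((vs @ [x]) ! r)) b = gram_form \<kappa> l vs (\<lambda>r. \<kappa> p (vs ! r)) b"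
    "gram_form \<kappa> l vs b (\<lambda>r. \<kappa> ((vs @ [x]) ! r) p) = gram_form \<kappa> l vs b (\<lambda>r. \<kappa> (vs ! r) p)" for p b
    by (intro gram_form_cong; simp add: nth_append)+
  show "gpr_cov \<kappa> l (vs @ [x]) = kalman_cov (gpr_cov \<kappa> l vs) (l x) x"
    by (intro ext) (simp add: gpr_cov_gram_form kalman_cov_def snoc c)
  assume len: "length ys = length vs"
  then have len': "length (ys @ [r]) = length (vs @ [x])" by simp
  have c2: "gram_form \<kappa> l vs h (\<lambda>s. (ys @ [r]) ! s - m ((vs @ [x]) ! s)) = gram_form \<kappa> l vs h (\<lambda>s. ys ! s - m (vs ! s))" for h
    using len by (intro gram_form_cong) (simp_all add: nth_append)
  show "gpr_mean m \<kappa> l (vs @ [x]) (ys @ [r])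
      = kalman_mean (gpr_mean m \<kappa> l vs ys) (gpr_cov \<kappa> l vs) (l x) x r"
    using nth_append_length[of ys r "[]"] len by (intro ext) (simp add: gpr_mean_gram_form[OF len'] gpr_mean_gram_form[OF len]
      gpr_cov_gram_form kalman_mean_def snoc c c2 diff_diff_eq[symmetric])
qed

section \<open>Independent arms as one process\<close>

definition joint_kernel :: "('j \<Rightarrow> 'x \<Rightarrow> 'x \<Rightarrow> real) \<Rightarrow> 'j \<times> 'x \<Rightarrow> 'j \<times> 'x \<Rightarrow> real" where
  "joint_kernel k p q = (if fst p = fst q then k (fst p) (snd p) (snd q) else 0)"

text \<open>Terms between different arms vanish, which leaves one nonnegative form per arm.\<close>

lemma psd_on_joint_kernel:
  assumes "\<And>i. i \<in> J \<Longrightarrow> psd_on X (k i)"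
  shows "psd_on (J \<times> X) (joint_kernel k)"
  unfolding psd_on_def
proof (intro conjI ballI allI impI)
  fix p q assume "p \<in> J \<times> X" "q \<in> J \<times> X"
  then show "joint_kernel k p q = joint_kernel k q p"
    using psd_on_sym[OF assms, of "fst p" "snd p" "snd q"] by (auto simp: joint_kernel_def)
next
  fix S and w :: "'a \<times> 'b \<Rightarrow> real" assume S: "finite S \<and> S \<subseteq> J \<times> X"
  have "quad_form S w (joint_kernel k)
      = (\<Sum>i\<in>fst ` S. \<Sum>p | p \<in> S \<and> fst p = i. \<Sum>q\<in>S. w p * w q * joint_kernel k p q)"
    by (rule sum.group[symmetric]) (use S in auto)
  also have "\<dots> \<ge> 0"
  proof (rule sum_nonneg)
    fix i assume i: "i \<in> fst ` S"
    let ?T = "{x. (i, x) \<in> S}"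
    have T: "{p. p \<in> S \<and> fst p = i} = Pair i ` ?T" by auto
    have fin: "finite ?T" by (rule finite_subset[of _ "snd ` S"]) (use S in \<open>force+\<close>)
    have "(\<Sum>p | p \<in> S \<and> fst p = i. \<Sum>q\<in>S. w p * w q * joint_kernel k p q)
       = (\<Sum>p | p \<in> S \<and> fst p = i. \<Sum>q | q \<in> S \<and> fst q = i. w p * w q * joint_kernel k p q)"
      by (intro sum.cong refl sum.mono_neutral_right) (use S in \<open>auto simp: joint_kernel_def\<close>)
    also have "\<dots> = (\<Sum>x\<in>?T. \<Sum>x'\<in>?T. w (i, x) * w (i, x') * k i x x')"
      unfolding T by (simp add: sum.reindex inj_on_def joint_kernel_def)
    also have "\<dots> \<ge> 0"
      by (rule psd_on_nonneg[of X]) (use i S fin assms in auto)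
    finally show "0 \<le> (\<Sum>p | p \<in> S \<and> fst p = i. \<Sum>q\<in>S. w p * w q * joint_kernel k p q)" .
  qed
  finally show "0 \<le> quad_form S w (joint_kernel k)" .
qed

lemma sample_times_Suc:
  "sample_times a i (Suc n) \<omega> = sample_times a i n \<omega> @ (if a n \<omega> = i then [n] else [])"
  by (simp add: sample_times_def)

lemma posterior_eq_kalman:
  assumes K: "\<And>i. i \<in> J \<Longrightarrow> psd_on X (k0 i)" and l: "\<And>i x. i \<in> J \<Longrightarrow> x \<in> X \<Longrightarrow> 0 < lam i x"
    and d: "\<And>n. a n \<omega> \<in> J \<and> v n \<omega> \<in> X"
  defines "k \<equiv> kcov (joint_kernel k0) (case_prod lam) (\<lambda>n. (a n \<omega>, v n \<omega>))"
  shows post_cov_eq_kcov: "post_cov k0 lam a v i n x x' \<omega> = k n (i, x) (i, x')"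
    and post_mean_eq_kmean: "post_mean \<mu>0 k0 lam a v y i n x \<omega> =
      kmean (case_prod \<mu>0) (joint_kernel k0) (case_prod lam) (\<lambda>n. (a n \<omega>, v n \<omega>)) (\<lambda>n. y (Suc n) \<omega>) n (i, x)"
proof -
  let ?d = "\<lambda>n. (a n \<omega>, v n \<omega>)"
  let ?m = "kmean (case_prod \<mu>0) (joint_kernel k0) (case_prod lam) ?d (\<lambda>n. y (Suc n) \<omega>)"
  have diag: "0 \<le> k n p p" if "p \<in> J \<times> X" for n p
    unfolding k_def using that d l
    by (intro psd_on_diag[OF psd_on_kcov[OF psd_on_joint_kernel[OF K]]]) auto
  \<comment> \<open>Covariances between arms remain 0, so a sample of one arm leaves the others
    unchanged. This matches \<open>sample_times\<close>, whose list for another arm does not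
    grow.\<close>
  have off: "\<forall>i j x x'. i \<noteq> j \<longrightarrow> k n (i, x) (j, x') = 0" for n
  proof (induction n)
    case (Suc n)
    then show ?case by (simp add: k_def kalman_cov_def) metis
  qed (simp add: k_def joint_kernel_def)
  have cov: "\<forall>i x x'. post_cov k0 lam a v i n x x' \<omega> = k n (i, x) (i, x')" for n
  proof (induction n)
    case 0
    show ?case by (simp add: post_cov_def sample_times_def gpr_cov_gram_form gram_form_Nil k_def joint_kernel_def)
  next
    case (Suc n)
    show ?case
    proof (intro allI)
      fix i x x'
      show "post_cov k0 lam a v i (Suc n) x x' \<omega> = k (Suc n) (i, x) (i, x')"
      proof (cases "a n \<omega> = i")
        case True
        let ?vs = "map (\<lambda>j. v j \<omega>) (sample_times a i n \<omega>)"
        have eq: "gpr_cov (k0 i) (lam i) ?vs p q = k n (i, p) (i, q)" for p q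
          using Suc unfolding post_cov_def by simp
        have "gpr_cov (k0 i) (lam i) (?vs @ [v n \<omega>]) = kalman_cov (gpr_cov (k0 i) (lam i) ?vs) (lam i (v n \<omega>)) (v n \<omega>)"
          by (rule gpr_snoc(1)[where l = "lam i", OF K]) (use True d[of n] d l diag in \<open>auto simp: eq\<close>)
        then show ?thesis
          using True by (simp add: post_cov_def sample_times_Suc kalman_cov_def eq k_def)
      next
        case False
        then show ?thesis
          using Suc off[of n] by (simp add: post_cov_def sample_times_Suc k_def kalman_cov_def)
      qed
    qed
  qed
  show "post_cov k0 lam a v i n x x' \<omega> = k n (i, x) (i, x')" using cov by blast
  have "\<forall>i x. post_mean \<mu>0 k0 lam a v y i n x \<omega> = ?m n (i, x)" for n
  proof (induction n)
    case 0
    show ?case by (simp add: post_mean_def sample_times_def gpr_mean_gram_form gram_form_Nil)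
  next
    case (Suc n)
    show ?case
    proof (intro allI)
      fix i x
      show "post_mean \<mu>0 k0 lam a v y i (Suc n) x \<omega> = ?m (Suc n) (i, x)"
      proof (cases "a n \<omega> = i")
        case True
        let ?vs = "map (\<lambda>j. v j \<omega>) (sample_times a i n \<omega>)" and ?ys = "map (\<lambda>j. y (Suc j) \<omega>) (sample_times a i n \<omega>)"
        have eq: "gpr_cov (k0 i) (lam i) ?vs p q = k n (i, p) (i, q)" for p q
          using cov[of n] unfolding post_cov_def by simp
        have eqm: "gpr_mean (\<mu>0 i) (k0 i) (lam i) ?vs ?ys p = ?m n (i, p)" for p
          using Suc unfolding post_mean_def by simp
        have "gpr_mean (\<mu>0 i) (k0 i) (lam i) (?vs @ [v n \<omega>]) (?ys @ [y (Suc n) \<omega>])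
           = kalman_mean (gpr_mean (\<mu>0 i) (k0 i) (lam i) ?vs ?ys) (gpr_cov (k0 i) (lam i) ?vs) (lam i (v n \<omega>)) (v n \<omega>) (y (Suc n) \<omega>)"
          by (rule gpr_snoc(2)[where l = "lam i", OF K]) (use True d[of n] d l diag in \<open>auto simp: eq\<close>)
        then show ?thesis
          using True by (simp add: post_mean_def sample_times_Suc kalman_mean_def eq eqm) (simp add: k_def)
      next
        case False
        then show ?thesis
          using Suc off[of n] by (simp add: post_mean_def sample_times_Suc k_def kalman_mean_def)
      qed
    qed
  qed
  then show "post_mean \<mu>0 k0 lam a v y i n x \<omega> = ?m n (i, x)" by blast
qed


section \<open>Conditioning a Gaussian process on a noisy observation\<close>

lemma char_normal_density:
  assumes "0 < \<sigma>"
  shows "(LINT t|lborel. normal_density \<mu> \<sigma> t *\<^sub>R iexp (q * t)) = exp (\<i> * (q * \<mu>) - (\<sigma> * q)\<^sup>2 / 2)"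
proof -
  have std: "(LINT t|lborel. std_normal_density t *\<^sub>R iexp (s * t)) = exp (- (s\<^sup>2) / 2)" for s
    using fun_cong[OF char_std_normal_distribution, of s]
    by (simp add: char_def integral_density)
  have "(LINT t|lborel. normal_density \<mu> \<sigma> t *\<^sub>R iexp (q * t))
      = \<bar>\<sigma>\<bar> *\<^sub>R (LINT t|lborel. normal_density \<mu> \<sigma> (\<mu> + \<sigma> * t) *\<^sub>R iexp (q * (\<mu> + \<sigma> * t)))"
    by (rule lborel_integral_real_affine) (use assms in simp)
  also have "\<dots> = (LINT t|lborel. iexp (q * \<mu>) * (std_normal_density t *\<^sub>R iexp (\<sigma> * q * t)))"
    unfolding integral_scaleR_right[symmetric]
  proof (rule Bochner_Integration.integral_cong[OF refl])
    fix t :: real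
    have "\<sigma> * normal_density \<mu> \<sigma> (\<mu> + \<sigma> * t) = std_normal_density t"
      using assms by (simp add: normal_density_def power_mult_distrib real_sqrt_mult)
    moreover have "iexp (q * (\<mu> + \<sigma> * t)) = iexp (q * \<mu>) * iexp (\<sigma> * q * t)"
      by (simp add: exp_add[symmetric] algebra_simps)
    ultimately show "\<bar>\<sigma>\<bar> *\<^sub>R normal_density \<mu> \<sigma> (\<mu> + \<sigma> * t) *\<^sub>R iexp (q * (\<mu> + \<sigma> * t))
      = iexp (q * \<mu>) * (std_normal_density t *\<^sub>R iexp (\<sigma> * q * t))"
      using assms by (simp add: scaleR_conv_of_real of_real_mult[symmetric] mult.left_commute
          del: of_real_mult flip: mult.assoc)
  qed
  also have "\<dots> = iexp (q * \<mu>) * exp (- ((\<sigma> * q)\<^sup>2) / 2)"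
    by (simp only: integral_mult_right_zero std)
  finally show ?thesis by (simp add: exp_add[symmetric] exp_of_real[symmetric])
qed

text \<open>Completing the square. The real tilt \<open>b\<close> will be the covariance of a linear
  combination of the field with its value at the observed point.\<close>

lemma gaussian_fourier_integral:
  assumes "0 < a"
  shows "(LINT t|lborel. exp (- (a * t\<^sup>2) / 2 - b * t) *\<^sub>R iexp (q * t))
     = sqrt (2 * pi / a) *\<^sub>R exp ((\<i> * q - b)\<^sup>2 / (2 * a))"
    and "integrable lborel (\<lambda>t. exp (- (a * t\<^sup>2) / 2 - b * t))"
proof -
  define c where "c = exp (b\<^sup>2 / (2 * a)) * sqrt (2 * pi / a)"
  have eq: "exp (- (a * t\<^sup>2) / 2 - b * t) = c * normal_density (- b / a) (1 / sqrt a) t" for t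
  proof -
    have e: "- (a * t\<^sup>2) / 2 - b * t = b\<^sup>2 / (2 * a) + - (t - (- b / a))\<^sup>2 / (2 * (1 / sqrt a)\<^sup>2)"
      using assms by (simp add: field_simps power2_eq_square real_sqrt_mult_self)
    show ?thesis
      unfolding e exp_add using assms
      by (simp add: c_def normal_density_def power_divide real_sqrt_divide)
  qed
  show "integrable lborel (\<lambda>t. exp (- (a * t\<^sup>2) / 2 - b * t))"
    unfolding eq by (intro integrable_mult_right integrable_normal_density) (use assms in simp)
  have "(LINT t|lborel. exp (- (a * t\<^sup>2) / 2 - b * t) *\<^sub>R iexp (q * t))
     = c *\<^sub>R (LINT t|lborel. normal_density (- b / a) (1 / sqrt a) t *\<^sub>R iexp (q * t))"
    unfolding eq by (simp flip: scaleR_scaleR)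
  also have "\<dots> = c *\<^sub>R exp (\<i> * (q * (- b / a)) - (1 / sqrt a * q)\<^sup>2 / 2)"
    by (subst char_normal_density) (use assms in simp_all)
  also have "\<dots> = sqrt (2 * pi / a) *\<^sub>R exp (b\<^sup>2 / (2 * a) + (\<i> * (q * (- b / a)) - (1 / sqrt a * q)\<^sup>2 / 2))"
    by (simp add: c_def exp_add scaleR_conv_of_real exp_of_real[symmetric] mult_ac)
  also have "b\<^sup>2 / (2 * a) + (\<i> * (q * (- b / a)) - (1 / sqrt a * q)\<^sup>2 / 2) = (\<i> * q - b)\<^sup>2 / (2 * a)"
  proof -
    have "(1 / sqrt a * q)\<^sup>2 = q\<^sup>2 / a" using assms by (simp add: power_divide power_mult_distrib)
    then show ?thesis using assms
      by (simp add: power2_diff power_mult_distrib field_simps)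
  qed
  finally show "(LINT t|lborel. exp (- (a * t\<^sup>2) / 2 - b * t) *\<^sub>R iexp (q * t))
     = sqrt (2 * pi / a) *\<^sub>R exp ((\<i> * q - b)\<^sup>2 / (2 * a))" by simp
qed

text \<open>Writing the likelihood of an observation as an integral of characters in
  \<open>x\<close> turns multiplication by it into an integral of characteristic functions.\<close>

lemma normal_density_fourier:
  assumes "0 < l"
  shows "of_real (normal_density x (sqrt l) r) = (LINT t|lborel. exp (- (l * t\<^sup>2) / 2) *\<^sub>R iexp ((x - r) * t)) / (2 * pi)"
proof -
  have "(LINT t|lborel. exp (- (l * t\<^sup>2) / 2) *\<^sub>R iexp ((x - r) * t)) =
     of_real (sqrt (2 * pi / l) * exp (- (x - r)\<^sup>2 / (2 * l)))"
    using gaussian_fourier_integral(1)[OF assms, of 0 "x - r"]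
    by (simp add: power_mult_distrib scaleR_conv_of_real exp_of_real[symmetric])
  moreover have "sqrt (2 * pi / l) / (2 * pi) = 1 / sqrt (2 * pi * l)"
    using assms by (simp add: real_sqrt_divide real_sqrt_mult field_simps)
  ultimately show ?thesis
    using assms by (simp add: normal_density_def power2_commute[of x r] field_simps flip: of_real_mult of_real_divide)
qed

text \<open>Under the weight \<open>g\<close> the process is, up to normalisation, Gaussian with mean \<open>m\<close> and
  covariance \<open>K\<close>; stating this through characteristic functions makes degenerate and unnormalised
  weights harmless.\<close>

definition gp_weight :: "'w measure \<Rightarrow> ('w \<Rightarrow> real) \<Rightarrow> 'i set \<Rightarrow> ('i \<Rightarrow> 'w \<Rightarrow> real) \<Rightarrow> ('i \<Rightarrow> real)
    \<Rightarrow> ('i \<Rightarrow> 'i \<Rightarrow> real) \<Rightarrow> bool" where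
  "gp_weight P g I f m K \<longleftrightarrow> integrable P g \<and> (\<forall>p\<in>I. f p \<in> borel_measurable P) \<and>
     (\<forall>S w. finite S \<longrightarrow> S \<subseteq> I \<longrightarrow>
        (LINT \<omega>|P. g \<omega> *\<^sub>R iexp (\<Sum>p\<in>S. w p * f p \<omega>)) =
        (LINT \<omega>|P. g \<omega>) *\<^sub>R exp (\<i> * (\<Sum>p\<in>S. w p * m p) - quad_form S w K / 2))"

lemma normal_density_le: "0 < l \<Longrightarrow> normal_density x (sqrt l) r \<le> 1 / sqrt (2 * pi * l)"
  by (simp add: normal_density_def divide_simps)

text \<open>Insert the Fourier form of the likelihood and exchange the integrals: the inner one is a
  characteristic function of the old weight on \<open>insert z S\<close>, and the outer one is a
  Gaussian integral in the frequency \<open>t\<close>.\<close>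

lemma gp_weight_observe:
  assumes P: "sigma_finite_measure P" and gp: "gp_weight P g I f m K" and K: "psd_on I K"
    and z: "z \<in> I" and l: "0 < l"
  shows "gp_weight P (\<lambda>\<omega>. g \<omega> * normal_density (f z \<omega>) (sqrt l) r) I f (kalman_mean m K l z r) (kalman_cov K l z)"
proof -
  interpret sigma_finite_measure P by fact
  interpret PL: pair_sigma_finite lborel P ..
  define a where "a = K z z + l"
  have a: "0 < a" using psd_on_diag[OF K z] l by (simp add: a_def)
  have g: "integrable P g" and f[measurable]: "\<And>p. p \<in> I \<Longrightarrow> f p \<in> borel_measurable P"
    and ch: "\<And>S w. finite S \<Longrightarrow> S \<subseteq> I \<Longrightarrow> (LINT \<omega>|P. g \<omega> *\<^sub>R iexp (\<Sum>p\<in>S. w p * f p \<omega>)) =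
        (LINT \<omega>|P. g \<omega>) *\<^sub>R exp (\<i> * (\<Sum>p\<in>S. w p * m p) - quad_form S w K / 2)"
    using gp unfolding gp_weight_def by blast+
  have [measurable]: "g \<in> borel_measurable P" "f z \<in> borel_measurable P" using g f z by auto
  define N where "N \<omega> = normal_density (f z \<omega>) (sqrt l) r" for \<omega>
  have [measurable]: "N \<in> borel_measurable P" unfolding N_def normal_density_def by measurable
  define Eg where "Eg = (LINT \<omega>|P. g \<omega>)"
  have int: "integrable P (\<lambda>\<omega>. g \<omega> * N \<omega>)"
  proof (rule Bochner_Integration.integrable_bound[OF integrable_mult_right[OF g, of "1 / sqrt (2 * pi * l)"]])
    show "AE \<omega> in P. norm (g \<omega> * N \<omega>) \<le> norm (1 / sqrt (2 * pi * l) * g \<omega>)"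
    proof (rule AE_I2)
      fix \<omega>
      have "\<bar>g \<omega>\<bar> * N \<omega> \<le> \<bar>g \<omega>\<bar> * (1 / sqrt (2 * pi * l))"
        unfolding N_def by (intro mult_left_mono normal_density_le l) simp
      then show "norm (g \<omega> * N \<omega>) \<le> norm (1 / sqrt (2 * pi * l) * g \<omega>)"
        using l by (simp add: abs_mult N_def)
    qed
  qed measurable
  have formula: "(LINT \<omega>|P. (g \<omega> * N \<omega>) *\<^sub>R iexp (\<Sum>p\<in>S. w p * f p \<omega>)) =
      (Eg * normal_density (m z) (sqrt a) r) *\<^sub>R exp (\<i> * (\<Sum>p\<in>S. w p * kalman_mean m K l z r p)
         - quad_form S w (kalman_cov K l z) / 2)"
    if S: "finite S" "S \<subseteq> I" for S w
  proof -
    define W where "W \<omega> = (\<Sum>p\<in>S. w p * f p \<omega>)" for \<omega>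
    have [measurable]: "W \<in> borel_measurable P" unfolding W_def using S f by (intro borel_measurable_sum) auto
    define \<mu> where "\<mu> = (\<Sum>p\<in>S. w p * m p)"
    define A where "A = quad_form S w K"
    define B where "B = (\<Sum>p\<in>S. w p * K p z)"
    have B': "(\<Sum>p\<in>S. w p * K z p) = B"
      unfolding B_def by (intro sum.cong refl) (use S z psd_on_sym[OF K] in auto)
    have ch_t: "(LINT \<omega>|P. g \<omega> *\<^sub>R iexp (W \<omega> + t * f z \<omega>)) =
        Eg *\<^sub>R exp (\<i> * (\<mu> + t * m z) - (A + t * B + t * B + t\<^sup>2 * K z z) / 2)" for t
      using ch[of "insert z S" "\<lambda>p. (if p \<in> S then w p else 0) + (if p = z then t else 0)"] S z
      unfolding quadratic_form_add_point[OF S(1)] sum_add_point[OF S(1)] A_def[symmetric] B_def[symmetric] B'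
        \<mu>_def[symmetric] W_def[symmetric] Eg_def[symmetric] by simp
    let ?F = "\<lambda>\<omega> t. (g \<omega> * exp (- (l * t\<^sup>2) / 2)) *\<^sub>R (iexp (W \<omega>) * iexp ((f z \<omega> - r) * t))"
    have "(LINT \<omega>|P. (g \<omega> * N \<omega>) *\<^sub>R iexp (W \<omega>)) = (LINT \<omega>|P. (LINT t|lborel. ?F \<omega> t) / (2 * pi))"
    proof (rule Bochner_Integration.integral_cong[OF refl])
      fix \<omega>
      have "(LINT t|lborel. ?F \<omega> t) = (g \<omega> *\<^sub>R iexp (W \<omega>)) * (LINT t|lborel. exp (- (l * t\<^sup>2) / 2) *\<^sub>R iexp ((f z \<omega> - r) * t))"
        unfolding integral_mult_right_zero[symmetric]
        by (intro Bochner_Integration.integral_cong refl) (simp add: scaleR_conv_of_real mult_ac)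
      then have "(LINT t|lborel. ?F \<omega> t) / (2 * pi) = (g \<omega> *\<^sub>R iexp (W \<omega>)) * of_real (N \<omega>)"
        unfolding N_def normal_density_fourier[OF l] by simp
      then show "(g \<omega> * N \<omega>) *\<^sub>R iexp (W \<omega>) = (LINT t|lborel. ?F \<omega> t) / (2 * pi)"
        by (simp add: scaleR_conv_of_real mult_ac)
    qed
    also have "\<dots> = (LINT \<omega>|P. LINT t|lborel. ?F \<omega> t) / (2 * pi)"
      by (rule integral_divide_zero)
    also have "(LINT \<omega>|P. LINT t|lborel. ?F \<omega> t) = (LINT t|lborel. LINT \<omega>|P. ?F \<omega> t)"
    proof (rule PL.Fubini_integral)
      show "integrable (lborel \<Otimes>\<^sub>M P) (\<lambda>(t, \<omega>). ?F \<omega> t)"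
      proof (rule PL.Fubini_integrable)
        show "(\<lambda>(t, \<omega>). ?F \<omega> t) \<in> borel_measurable (lborel \<Otimes>\<^sub>M P)" by measurable
        have n: "norm (?F \<omega> t) = \<bar>g \<omega>\<bar> * exp (- (l * t\<^sup>2) / 2)" for \<omega> t
          by (simp add: norm_mult abs_mult)
        show "integrable lborel (\<lambda>t. LINT \<omega>|P. norm (case (t, \<omega>) of (t, \<omega>) \<Rightarrow> ?F \<omega> t))"
          unfolding prod.case n using gaussian_fourier_integral(2)[OF l, of 0] by simp
        show "AE t in lborel. integrable P (\<lambda>\<omega>. case (t, \<omega>) of (t, \<omega>) \<Rightarrow> ?F \<omega> t)"
          unfolding prod.case
        proof (rule AE_I2)
          fix t :: real
          have "integrable P (\<lambda>\<omega>. \<bar>g \<omega>\<bar> * exp (- (l * t\<^sup>2) / 2))" using g by simp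
          then have "integrable P (\<lambda>\<omega>. norm (?F \<omega> t))" unfolding n .
          then show "integrable P (\<lambda>\<omega>. ?F \<omega> t)" by (rule integrable_norm_cancel) measurable
        qed
      qed
    qed
    also have "\<dots> = (LINT t|lborel. (Eg *\<^sub>R exp (\<i> * \<mu> - A / 2)) * (exp (- (a * t\<^sup>2) / 2 - B * t) *\<^sub>R iexp ((m z - r) * t)))"
    proof (rule Bochner_Integration.integral_cong[OF refl])
      fix t :: real
      have "(LINT \<omega>|P. ?F \<omega> t) = (LINT \<omega>|P. (exp (- (l * t\<^sup>2) / 2) *\<^sub>R iexp (- r * t)) * (g \<omega> *\<^sub>R iexp (W \<omega> + t * f z \<omega>)))"
        by (intro Bochner_Integration.integral_cong refl)
          (simp add: scaleR_conv_of_real mult_ac exp_add[symmetric] algebra_simps)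
      also have "\<dots> = (exp (- (l * t\<^sup>2) / 2) *\<^sub>R iexp (- r * t)) *
          (Eg *\<^sub>R exp (\<i> * (\<mu> + t * m z) - (A + t * B + t * B + t\<^sup>2 * K z z) / 2))"
        unfolding integral_mult_right_zero ch_t ..
      also have "\<dots> = Eg *\<^sub>R exp (- (l * t\<^sup>2) / 2 + \<i> * (- r * t) + (\<i> * (\<mu> + t * m z) - (A + t * B + t * B + t\<^sup>2 * K z z) / 2))"
        unfolding exp_add by (simp add: scaleR_conv_of_real exp_of_real[symmetric] mult_ac)
      also have "- (l * t\<^sup>2) / 2 + \<i> * (- r * t) + (\<i> * (\<mu> + t * m z) - (A + t * B + t * B + t\<^sup>2 * K z z) / 2)
          = (\<i> * \<mu> - A / 2) + (of_real (- (a * t\<^sup>2) / 2 - B * t) + \<i> * of_real ((m z - r) * t))"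
        by (simp add: a_def field_simps)
      also have "Eg *\<^sub>R exp \<dots> = (Eg *\<^sub>R exp (\<i> * \<mu> - A / 2)) * (exp (- (a * t\<^sup>2) / 2 - B * t) *\<^sub>R iexp ((m z - r) * t))"
        unfolding exp_add exp_of_real by (simp add: scaleR_conv_of_real mult_ac)
      finally show "(LINT \<omega>|P. ?F \<omega> t) = (Eg *\<^sub>R exp (\<i> * \<mu> - A / 2)) * (exp (- (a * t\<^sup>2) / 2 - B * t) *\<^sub>R iexp ((m z - r) * t))" .
    qed
    also have "\<dots> = (Eg *\<^sub>R exp (\<i> * \<mu> - A / 2)) * (sqrt (2 * pi / a) *\<^sub>R exp ((\<i> * (m z - r) - B)\<^sup>2 / (2 * a)))"
      unfolding integral_mult_right_zero gaussian_fourier_integral(1)[OF a] by simp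
    \<comment> \<open>The square splits into the exponent of the predictive density of
      \<open>r\<close>, the shift of the mean and the reduction of the variance.\<close>
    also have "(\<i> * (m z - r) - B)\<^sup>2 / (2 * a) = of_real (- (r - m z)\<^sup>2 / (2 * a)) + (\<i> * (B * (r - m z) / a) + B\<^sup>2 / a / 2)"
      using a by (simp add: power2_eq_square field_simps)
    also have "(Eg *\<^sub>R exp (\<i> * \<mu> - A / 2)) * (sqrt (2 * pi / a) *\<^sub>R exp \<dots>) / (2 * pi)
      = (Eg * (sqrt (2 * pi / a) / (2 * pi) * exp (- (r - m z)\<^sup>2 / (2 * a)))) *\<^sub>R
         exp ((\<i> * \<mu> - A / 2) + (\<i> * (B * (r - m z) / a) + B\<^sup>2 / a / 2))"
      unfolding exp_add exp_of_real by (simp add: scaleR_conv_of_real mult_ac)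
    also have "sqrt (2 * pi / a) / (2 * pi) * exp (- (r - m z)\<^sup>2 / (2 * a)) = normal_density (m z) (sqrt a) r"
    proof -
      have "sqrt (2 * pi / a) / (2 * pi) = 1 / sqrt (2 * pi * a)"
        using a by (simp add: real_sqrt_divide real_sqrt_mult field_simps)
      then show ?thesis using a by (simp add: normal_density_def)
    qed
    also have "(\<i> * \<mu> - A / 2) + (\<i> * (B * (r - m z) / a) + B\<^sup>2 / a / 2)
      = \<i> * of_real (\<mu> + B * (r - m z) / a) - of_real (A - B\<^sup>2 / a) / 2"
      by (simp add: algebra_simps diff_divide_distrib)
    also have "\<mu> + B * (r - m z) / a = (\<Sum>p\<in>S. w p * kalman_mean m K l z r p)"
      by (simp add: \<mu>_def B_def a_def kalman_mean_def distrib_left sum.distrib sum_distrib_right sum_divide_distrib mult.assoc)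
    also have "A - B\<^sup>2 / a = quad_form S w (kalman_cov K l z)"
      unfolding quadratic_form_kalman_cov[OF K z S(2)] by (simp add: A_def B_def a_def)
    finally show ?thesis unfolding W_def by simp
  qed
  \<comment> \<open>The empty linear combination gives the total mass of the new weight.\<close>
  have "(LINT \<omega>|P. g \<omega> * N \<omega>) = Eg * normal_density (m z) (sqrt a) r"
    using formula[of "{}"] by (simp add: of_real_eq_iff integral_of_real scaleR_conv_of_real flip: of_real_mult)
  then show ?thesis
    unfolding gp_weight_def using formula int f unfolding N_def by simp
qed

lemma integrable_density_real:
  fixes h :: "'w \<Rightarrow> real"
  assumes "g \<in> borel_measurable P" "h \<in> borel_measurable P" "\<And>\<omega>. 0 \<le> g \<omega>"
  shows "integrable (density P g) h \<longleftrightarrow> integrable P (\<lambda>\<omega>. g \<omega> * h \<omega>)"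
    and "(LINT \<omega>|density P g. h \<omega>) = (LINT \<omega>|P. g \<omega> * h \<omega>)"
  using assms by (simp_all add: integrable_density integral_density)

text \<open>Once the weight is normalised, the law of \<open>f p\<close> has a Gaussian
  characteristic function, and Levy's uniqueness theorem identifies it as a normal law or, for
  variance 0, as a point mass.\<close>

lemma gp_weight_moments:
  assumes gp: "gp_weight P g I f m K" and K: "psd_on I K" and p: "p \<in> I"
    and g: "\<And>\<omega>. 0 \<le> g \<omega>" "0 < (LINT \<omega>|P. g \<omega>)"
  shows "integrable P (\<lambda>\<omega>. g \<omega> * (f p \<omega> - m p))" and "(LINT \<omega>|P. g \<omega> * (f p \<omega> - m p)) = 0"
    and "integrable P (\<lambda>\<omega>. g \<omega> * (f p \<omega> - m p)\<^sup>2)"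
    and "(LINT \<omega>|P. g \<omega> * (f p \<omega> - m p)\<^sup>2) = (LINT \<omega>|P. g \<omega>) * K p p"
proof -
  define Eg where "Eg = (LINT \<omega>|P. g \<omega>)"
  define Q where "Q = density P (\<lambda>\<omega>. ennreal (g \<omega> / Eg))"
  have [measurable]: "f p \<in> borel_measurable P" and intg: "integrable P g"
    and ch: "(LINT \<omega>|P. g \<omega> *\<^sub>R iexp (t * f p \<omega>)) = Eg *\<^sub>R exp (\<i> * (t * m p) - (t * t * K p p) / 2)" for t
    using gp p spec[of _ "{p}"] unfolding gp_weight_def Eg_def by (auto dest!: spec[of _ "{p}"] spec[of _ "\<lambda>_. t"])
  have [measurable]: "g \<in> borel_measurable P" using intg by auto
  have Eg: "0 < Eg" using g(2) by (simp add: Eg_def)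
  have gE: "0 \<le> g \<omega> / Eg" for \<omega> using g(1)[of \<omega>] Eg by simp
  have "emeasure Q (space Q) = (\<integral>\<^sup>+ \<omega>. ennreal (g \<omega> / Eg) \<partial>P)"
    unfolding Q_def by (simp add: emeasure_density nn_integral_set_ennreal cong: nn_integral_cong_simp)
  also have "\<dots> = ennreal (LINT \<omega>|P. g \<omega> / Eg)"
    by (rule nn_integral_eq_integral) (use intg gE in auto)
  also have "\<dots> = 1" using Eg by (simp add: Eg_def[symmetric])
  finally interpret Q: prob_space Q by (rule prob_spaceI)
  have [measurable]: "f p \<in> borel_measurable Q" by (simp add: Q_def)
  define R where "R = distr Q borel (f p)"
  interpret R: real_distribution R unfolding R_def by (rule Q.real_distribution_distr) simp
  have charR: "char R t = exp (\<i> * (t * m p) - (t * t * K p p) / 2)" for t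
  proof -
    have "char R t = (LINT \<omega>|Q. iexp (t * f p \<omega>))"
      unfolding char_def R_def by (subst integral_distr) auto
    also have "\<dots> = (LINT \<omega>|P. (g \<omega> / Eg) *\<^sub>R iexp (t * f p \<omega>))"
      unfolding Q_def by (rule integral_density) (use gE in auto)
    also have "\<dots> = (LINT \<omega>|P. (1 / Eg) *\<^sub>R (g \<omega> *\<^sub>R iexp (t * f p \<omega>)))"
      by simp
    also have "\<dots> = (1 / Eg) *\<^sub>R (Eg *\<^sub>R exp (\<i> * (t * m p) - (t * t * K p p) / 2))"
      unfolding integral_scaleR_right ch ..
    finally show ?thesis using Eg by simp
  qed
  have mom: "integrable R (\<lambda>x. x - m p)" "(LINT x|R. x - m p) = 0"
    "integrable R (\<lambda>x. (x - m p)\<^sup>2)" "(LINT x|R. (x - m p)\<^sup>2) = K p p"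
  proof -
    have "(integrable R (\<lambda>x. x - m p) \<and> (LINT x|R. x - m p) = 0) \<and>
      (integrable R (\<lambda>x. (x - m p)\<^sup>2) \<and> (LINT x|R. (x - m p)\<^sup>2) = K p p)"
    proof (cases "K p p = 0")
      case True
      interpret D: prob_space "return borel (m p)" by (rule prob_space_return) simp
      interpret D: real_distribution "return borel (m p)" by unfold_locales simp_all
      have "R = return borel (m p)"
      proof (rule Levy_uniqueness)
        show "real_distribution R" "real_distribution (return borel (m p))" by unfold_locales
        show "char R = char (return borel (m p))"
          by (rule ext, unfold charR) (simp add: True char_def integral_return)
      qed
      moreover have "AE x in return borel (m p). x - m p = 0 \<and> (x - m p)\<^sup>2 = 0"
        by (subst AE_return) auto
      then have "integrable (return borel (m p)) (\<lambda>x. x - m p)" "integrable (return borel (m p)) (\<lambda>x. (x - m p)\<^sup>2)"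
        by (auto intro!: integrable_cong_AE_imp[of _ "\<lambda>_. 0"])
      ultimately show ?thesis using True by (simp add: integral_return)
    next
      case False
      then have pos: "0 < K p p" using psd_on_diag[OF K p] by simp
      let ?N = "density lborel (normal_density (m p) (sqrt (K p p)))"
      interpret D: prob_space ?N by (rule prob_space_normal_density) (use pos in simp)
      interpret D: real_distribution ?N by unfold_locales simp_all
      have "R = ?N"
      proof (rule Levy_uniqueness)
        show "real_distribution R" "real_distribution ?N" by unfold_locales
        have "char ?N t = (LINT x|lborel. normal_density (m p) (sqrt (K p p)) x *\<^sub>R iexp (t * x))" for t
          unfolding char_def by (rule integral_density) simp_all
        moreover have "0 < sqrt (K p p)" using pos by simp
        ultimately show "char R = char ?N"
          using pos by (intro ext, simp only: charR char_normal_density)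
            (simp add: power_mult_distrib power2_eq_square mult_ac)
      qed
      moreover have "has_bochner_integral lborel (\<lambda>x. normal_density (m p) (sqrt (K p p)) x * (x - m p)) 0"
        using normal_moment_odd[of "sqrt (K p p)" "m p" 0] pos by simp
      moreover have "has_bochner_integral lborel (\<lambda>x. normal_density (m p) (sqrt (K p p)) x * (x - m p)\<^sup>2) (K p p)"
        using normal_moment_even[of "sqrt (K p p)" "m p" 1] pos by simp
      ultimately show ?thesis
        by (auto simp: integrable_density_real has_bochner_integral_iff)
    qed
    then show "integrable R (\<lambda>x. x - m p)" "(LINT x|R. x - m p) = 0"
      "integrable R (\<lambda>x. (x - m p)\<^sup>2)" "(LINT x|R. (x - m p)\<^sup>2) = K p p" by auto
  qed
  have tr: "integrable P (\<lambda>\<omega>. g \<omega> * h (f p \<omega>))" "(LINT \<omega>|P. g \<omega> * h (f p \<omega>)) = Eg * (LINT x|R. h x)"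
    if h: "integrable R h" for h :: "real \<Rightarrow> real"
  proof -
    have [measurable]: "h \<in> borel_measurable borel" using borel_measurable_integrable[OF h] by (simp add: R_def)
    have "integrable Q (\<lambda>\<omega>. h (f p \<omega>))"
      using h unfolding R_def by (subst (asm) integrable_distr_eq) auto
    then have "integrable P (\<lambda>\<omega>. g \<omega> / Eg * h (f p \<omega>))"
      unfolding Q_def by (subst (asm) integrable_density_real) (use gE in auto)
    then have "integrable P (\<lambda>\<omega>. Eg * (g \<omega> / Eg * h (f p \<omega>)))"
      by (rule integrable_mult_right)
    then show "integrable P (\<lambda>\<omega>. g \<omega> * h (f p \<omega>))" using Eg by simp
    have "(LINT x|R. h x) = (LINT \<omega>|Q. h (f p \<omega>))"
      unfolding R_def by (rule integral_distr) auto
    also have "\<dots> = (LINT \<omega>|P. g \<omega> / Eg * h (f p \<omega>))"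
      unfolding Q_def by (rule integrable_density_real(2)) (use gE in auto)
    finally show "(LINT \<omega>|P. g \<omega> * h (f p \<omega>)) = Eg * (LINT x|R. h x)"
      using Eg by simp
  qed
  show "integrable P (\<lambda>\<omega>. g \<omega> * (f p \<omega> - m p))" "(LINT \<omega>|P. g \<omega> * (f p \<omega> - m p)) = 0"
    "integrable P (\<lambda>\<omega>. g \<omega> * (f p \<omega> - m p)\<^sup>2)" "(LINT \<omega>|P. g \<omega> * (f p \<omega> - m p)\<^sup>2) = (LINT \<omega>|P. g \<omega>) * K p p"
    using tr[OF mom(1)] tr[OF mom(3)] mom by (simp_all add: Eg_def)
qed

text \<open>Variances of linear combinations are nonnegative. Symmetry is a separate hypothesis
  because quadratic forms do not see the antisymmetric part of \<kappa>.\<close>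

lemma gaussian_process_psd_on:
  assumes "gaussian_process P X f m \<kappa>" "\<And>x x'. x \<in> X \<Longrightarrow> x' \<in> X \<Longrightarrow> \<kappa> x x' = \<kappa> x' x"
  shows "psd_on X \<kappa>"
  unfolding psd_on_def
proof (intro conjI ballI allI impI)
  fix S w assume "finite S \<and> S \<subseteq> X"
  then have "normal_rv P (\<lambda>\<omega>. \<Sum>x\<in>S. w x * f x \<omega>) (\<Sum>x\<in>S. w x * m x) (quad_form S w \<kappa>)"
    using assms(1) unfolding gaussian_process_def by blast
  then show "0 \<le> quad_form S w \<kappa>"
    unfolding normal_rv_def by (auto split: if_splits)
qed (use assms in auto)

lemma (in prob_space) normal_rv_char:
  assumes "normal_rv M Y m s2"
  shows "(LINT \<omega>|M. iexp (Y \<omega>)) = exp (\<i> * m - s2 / 2)"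
proof (cases "s2 = 0")
  case True
  then have "(LINT \<omega>|M. iexp (Y \<omega>)) = (LINT \<omega>|M. iexp m)"
    using assms unfolding normal_rv_def by (intro integral_cong_AE) auto
  then show ?thesis using True by (simp add: prob_space)
next
  case False
  then have s2: "0 < s2" and D: "distributed M lborel Y (normal_density m (sqrt s2))"
    using assms by (auto simp: normal_rv_def)
  have [measurable]: "Y \<in> borel_measurable M" using assms by (simp add: normal_rv_def)
  have "(LINT \<omega>|M. iexp (Y \<omega>)) = (LINT x|distr M lborel Y. iexp x)"
    by (subst integral_distr) auto
  also have "distr M lborel Y = density lborel (normal_density m (sqrt s2))"
    by (rule distributed_distr_eq_density[OF D])
  also have "(LINT x|density lborel (normal_density m (sqrt s2)). iexp x)
     = (LINT x|lborel. normal_density m (sqrt s2) x *\<^sub>R iexp (1 * x))"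
    by (subst integral_density) auto
  also have "\<dots> = exp (\<i> * m - s2 / 2)"
    by (subst char_normal_density) (use s2 in simp_all)
  finally show ?thesis .
qed

text \<open>A finite linear combination splits into one Gaussian sum per arm. Independence turns its
  characteristic function into a product, and the added exponents form the block diagonal quadratic
  form.\<close>

lemma (in prob_space) gp_weight_joint_prior:
  assumes gp: "\<And>i. i \<in> J \<Longrightarrow> gaussian_process M X (f i) (m i) (k i)"
    and ind: "indep_vars (\<lambda>_. Pi\<^sub>M X (\<lambda>_. borel)) (\<lambda>i \<omega>. \<lambda>x\<in>X. f i x \<omega>) J"
  shows "gp_weight M (\<lambda>_. 1) (J \<times> X) (case_prod f) (case_prod m) (joint_kernel k)"
  unfolding gp_weight_def
proof (intro conjI allI impI ballI)
  fix p assume "p \<in> J \<times> X"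
  then have "normal_rv M (\<lambda>\<omega>. \<Sum>x\<in>{snd p}. 1 * f (fst p) x \<omega>) (\<Sum>x\<in>{snd p}. 1 * m (fst p) x)
    (\<Sum>x\<in>{snd p}. \<Sum>x'\<in>{snd p}. 1 * 1 * k (fst p) x x')"
    using gp[of "fst p", unfolded gaussian_process_def, rule_format, of "{snd p}" "\<lambda>_. 1"] by auto
  then show "case_prod f p \<in> borel_measurable M"
    by (simp add: normal_rv_def case_prod_beta)
next
  fix S and w :: "'b \<times> 'c \<Rightarrow> real" assume S: "finite S" "S \<subseteq> J \<times> X"
  define A where "A = fst ` S"
  define T where "T i = {x. (i, x) \<in> S}" for i
  have A: "finite A" "A \<subseteq> J" using S by (auto simp: A_def)
  have T: "finite (T i)" "T i \<subseteq> X" for i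
  proof -
    have "T i \<subseteq> snd ` S" by (force simp: T_def)
    then show "finite (T i)" using S(1) finite_surj by blast
    show "T i \<subseteq> X" using S by (auto simp: T_def)
  qed
  have S_eq: "S = Sigma A T" by (force simp: A_def T_def)
  define U where "U i \<omega> = (\<Sum>x\<in>T i. w (i, x) * f i x \<omega>)" for i \<omega>
  have sums: "(\<Sum>p\<in>S. w p * h p) = (\<Sum>i\<in>A. \<Sum>x\<in>T i. w (i, x) * h (i, x))" for h
    unfolding S_eq using A T by (simp add: sum.Sigma case_prod_beta)
  have indU: "indep_vars (\<lambda>_. borel) U A"
  proof -
    have "indep_vars (\<lambda>_. borel) (\<lambda>i \<omega>. \<Sum>x\<in>T i. w (i, x) * (\<lambda>x\<in>X. f i x \<omega>) x) A"
      by (rule indep_vars_compose2[OF indep_vars_subset[OF ind A(2)]])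
        (use T in \<open>auto intro!: borel_measurable_sum borel_measurable_times measurable_component_singleton\<close>)
    also have "(\<lambda>i \<omega>. \<Sum>x\<in>T i. w (i, x) * (\<lambda>x\<in>X. f i x \<omega>) x) = U"
      unfolding U_def using T by (intro ext sum.cong refl) auto
    finally show ?thesis .
  qed
  have rvU: "U i \<in> borel_measurable M" if "i \<in> A" for i
    using indU that by (auto simp: indep_vars_def)
  have normU: "normal_rv M (U i) (\<Sum>x\<in>T i. w (i, x) * m i x) (\<Sum>x\<in>T i. \<Sum>x'\<in>T i. w (i, x) * w (i, x') * k i x x')" if "i \<in> A" for i
    using gp[of i] A that T[of i] unfolding gaussian_process_def U_def by (auto dest: spec[of _ "T i"])
  have "(LINT \<omega>|M. 1 *\<^sub>R iexp (\<Sum>p\<in>S. w p * case_prod f p \<omega>)) = (LINT \<omega>|M. iexp (1 * (\<Sum>i\<in>A. U i \<omega>)))"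
    unfolding sums U_def by simp
  also have "\<dots> = char (distr M borel (\<lambda>\<omega>. \<Sum>i\<in>A. U i \<omega>)) 1"
    unfolding char_def by (subst integral_distr) (use rvU in auto)
  also have "\<dots> = (\<Prod>i\<in>A. char (distr M borel (U i)) 1)"
    by (rule char_distr_sum[OF indU])
  also have "\<dots> = (\<Prod>i\<in>A. exp (\<i> * (\<Sum>x\<in>T i. w (i, x) * m i x) - (\<Sum>x\<in>T i. \<Sum>x'\<in>T i. w (i, x) * w (i, x') * k i x x') / 2))"
  proof (rule prod.cong[OF refl])
    fix i assume i: "i \<in> A"
    show "char (distr M borel (U i)) 1 = exp (\<i> * (\<Sum>x\<in>T i. w (i, x) * m i x) - (\<Sum>x\<in>T i. \<Sum>x'\<in>T i. w (i, x) * w (i, x') * k i x x') / 2)"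
      using normal_rv_char[OF normU[OF i]] rvU[OF i] unfolding char_def by (subst integral_distr) auto
  qed
  also have "\<dots> = exp (\<Sum>i\<in>A. \<i> * (\<Sum>x\<in>T i. w (i, x) * m i x) - (\<Sum>x\<in>T i. \<Sum>x'\<in>T i. w (i, x) * w (i, x') * k i x x') / 2)"
    by (rule exp_sum[OF A(1), symmetric])
  also have "(\<Sum>i\<in>A. \<i> * (\<Sum>x\<in>T i. w (i, x) * m i x) - (\<Sum>x\<in>T i. \<Sum>x'\<in>T i. w (i, x) * w (i, x') * k i x x') / 2)
     = \<i> * (\<Sum>p\<in>S. w p * case_prod m p) - quad_form S w (joint_kernel k) / 2"
  proof -
    have "quad_form S w (joint_kernel k) = (\<Sum>p\<in>S. w p * (\<Sum>q\<in>S. w q * joint_kernel k p q))"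
      by (simp only: sum_distrib_left mult.assoc)
    also have "\<dots> = (\<Sum>i\<in>A. \<Sum>x\<in>T i. w (i, x) * (\<Sum>j\<in>A. \<Sum>x'\<in>T j. w (j, x') * joint_kernel k (i, x) (j, x')))"
      unfolding sums ..
    also have "\<dots> = (\<Sum>i\<in>A. \<Sum>x\<in>T i. w (i, x) * (\<Sum>x'\<in>T i. w (i, x') * k i x x'))"
    proof (intro sum.cong refl arg_cong[of _ _ "\<lambda>x. _ * x"])
      fix i x assume i: "i \<in> A"
      have "(\<Sum>j\<in>A. \<Sum>x'\<in>T j. w (j, x') * joint_kernel k (i, x) (j, x')) = (\<Sum>j\<in>A. if j = i then \<Sum>x'\<in>T j. w (j, x') * k i x x' else 0)"
        by (intro sum.cong refl) (simp add: joint_kernel_def)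
      then show "(\<Sum>j\<in>A. \<Sum>x'\<in>T j. w (j, x') * joint_kernel k (i, x) (j, x')) = (\<Sum>x'\<in>T i. w (i, x') * k i x x')"
        using i A(1) by simp
    qed
    finally show ?thesis
      unfolding sums by (simp add: sum_subtractf sum_distrib_left sum_divide_distrib mult.assoc)
  qed
  finally show "(LINT \<omega>|M. 1 *\<^sub>R iexp (\<Sum>p\<in>S. w p * case_prod f p \<omega>)) =
        (LINT \<omega>|M. 1) *\<^sub>R exp (\<i> * (\<Sum>p\<in>S. w p * case_prod m p) - quad_form S w (joint_kernel k) / 2)"
    by (simp add: prob_space)
qed simp


section \<open>Bayes' formula for adaptive designs\<close>

text \<open>The Doob-Dynkin factorisation for nonnegative functions. In \<open>Bayes\<close> it
  exhibits the last observation as a separate argument.\<close>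

lemma borel_measurable_vimage_algebra_factor:
  fixes F :: "'a \<Rightarrow> ennreal"
  assumes g: "g \<in> Z \<rightarrow> space N" and F: "F \<in> borel_measurable (vimage_algebra Z g N)"
  shows "\<exists>h\<in>borel_measurable N. \<forall>z\<in>Z. F z = h (g z)"
  using F
proof (induction rule: borel_measurable_induct)
  case (cong F G)
  then show ?case by simp
next
  case (set A)
  then obtain B where B: "B \<in> sets N" "A = g -` B \<inter> Z"
    using g by (auto simp: sets_vimage_algebra2)
  then show ?case
    by (intro bexI[of _ "indicator B"]) (auto split: split_indicator)
next
  case (mult u c)
  then obtain h where "h \<in> borel_measurable N" "\<forall>z\<in>Z. u z = h (g z)" by blast
  then show ?case by (intro bexI[of _ "\<lambda>x. c * h x"]) auto
next
  case (add u v)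
  then obtain h k where "h \<in> borel_measurable N" "\<forall>z\<in>Z. u z = h (g z)"
    "k \<in> borel_measurable N" "\<forall>z\<in>Z. v z = k (g z)" by blast
  then show ?case by (intro bexI[of _ "\<lambda>x. k x + h x"]) auto
next
  case (seq U)
  then have "\<forall>i. \<exists>h\<in>borel_measurable N. \<forall>z\<in>Z. U i z = h (g z)" by blast
  then obtain h where "\<And>i. h i \<in> borel_measurable N" "\<And>i z. z \<in> Z \<Longrightarrow> U i z = h i (g z)" by metis
  then show ?case
    by (intro bexI[of _ "\<lambda>x. SUP i. h i x"]) (auto simp: image_comp)
qed

text \<open>Adapted designs are functions of the past observations, so the observations
  \<open>y 1, \<dots>, y n\<close> alone already generate the history.\<close>

primrec obs_algebra :: "'w set \<Rightarrow> (nat \<Rightarrow> 'w \<Rightarrow> real) \<Rightarrow> nat \<Rightarrow> 'w measure" where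
  "obs_algebra \<Omega> y 0 = sigma \<Omega> {}"
| "obs_algebra \<Omega> y (Suc n) = vimage_algebra \<Omega> (\<lambda>\<omega>. (\<omega>, y (Suc n) \<omega>)) (obs_algebra \<Omega> y n \<Otimes>\<^sub>M borel)"

lemma space_obs_algebra [simp]: "space (obs_algebra \<Omega> y n) = \<Omega>"
  by (cases n) simp_all

lemma measurable_obs_algebra_pair:
  "(\<lambda>\<omega>. (\<omega>, y (Suc n) \<omega>)) \<in> obs_algebra \<Omega> y (Suc n) \<rightarrow>\<^sub>M obs_algebra \<Omega> y n \<Otimes>\<^sub>M borel"
  by (simp add: measurable_vimage_algebra1 space_pair_measure)

lemma obs_algebra_mono: "n \<le> n' \<Longrightarrow> (\<lambda>\<omega>. \<omega>) \<in> obs_algebra \<Omega> y n' \<rightarrow>\<^sub>M obs_algebra \<Omega> y n"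
proof (induction n' rule: dec_induct)
  case (step k)
  have "(\<lambda>\<omega>. \<omega>) \<in> obs_algebra \<Omega> y (Suc k) \<rightarrow>\<^sub>M obs_algebra \<Omega> y k"
    using measurable_compose[OF measurable_obs_algebra_pair measurable_fst] unfolding fst_conv .
  from measurable_compose[OF this step.IH] show ?case .
qed simp

lemma measurable_observation:
  assumes "Suc k \<le> n"
  shows "y (Suc k) \<in> borel_measurable (obs_algebra \<Omega> y n)"
proof -
  have "(\<lambda>\<omega>. y (Suc k) \<omega>) \<in> borel_measurable (obs_algebra \<Omega> y (Suc k))"
    using measurable_compose[OF measurable_obs_algebra_pair measurable_snd] unfolding snd_conv .
  from measurable_compose[OF obs_algebra_mono[OF assms] this] show ?thesis .
qed

text \<open>\<open>N0\<close> is the sigma-algebra that carries the field. Joint measurability of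
  \<open>f\<close> in index and outcome makes its value at a random design a random variable; the
  distribution of the field is left open here.\<close>

locale adaptive_sampling = prob_space P
  for P :: "'w measure" +
  fixes D :: "'i measure" and N0 :: "'w measure" and f :: "'i \<Rightarrow> 'w \<Rightarrow> real" and l :: "'i \<Rightarrow> real"
    and e :: "nat \<Rightarrow> 'w \<Rightarrow> real" and d :: "nat \<Rightarrow> 'w \<Rightarrow> 'i" and y :: "nat \<Rightarrow> 'w \<Rightarrow> real"
  assumes prior_algebra: "space N0 = space P" "sets N0 \<subseteq> sets P"
    and field_measurable: "case_prod f \<in> borel_measurable (D \<Otimes>\<^sub>M N0)"
    and noise_var: "l \<in> borel_measurable D" "\<And>p. p \<in> space D \<Longrightarrow> 0 < l p"
    and noise_normal: "\<And>n. distributed P lborel (e n) std_normal_density"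
    and noise_indep: "indep_vars (\<lambda>_. borel) e UNIV"
    and noise_prior_indep:
      "indep_set (sets N0) (sets (vimage_algebra (space P) (\<lambda>\<omega> n. e n \<omega>) (Pi\<^sub>M UNIV (\<lambda>_. borel))))"
    and design_adapted: "\<And>n. d n \<in> obs_algebra (space P) y n \<rightarrow>\<^sub>M D"
    and observation: "\<And>n \<omega>. \<omega> \<in> space P \<Longrightarrow> y (Suc n) \<omega> = f (d n \<omega>) \<omega> + sqrt (l (d n \<omega>)) * e n \<omega>"
begin

section \<open>The past and its independence of the next noise\<close>

abbreviation "obs \<equiv> obs_algebra (space P) y"

abbreviation "noise_vec n \<omega> \<equiv> \<lambda>j\<in>{..<n}. e j \<omega>"

text \<open>The sigma-algebra of the field and the first \<open>n\<close> noises, given by a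
  generator closed under intersections, so that independence can be checked on the
  generator.\<close>

definition past :: "nat \<Rightarrow> 'w measure" where
  "past n = sigma (space P) {A \<inter> (noise_vec n -` B \<inter> space P) | A B.
     A \<in> sets N0 \<and> B \<in> sets (Pi\<^sub>M {..<n} (\<lambda>_. borel))}"

lemma noise_measurable [measurable]: "e n \<in> borel_measurable P"
  using noise_normal[of n] by (simp add: distributed_def)

lemma prior_measurable: "(\<lambda>\<omega>. \<omega>) \<in> P \<rightarrow>\<^sub>M N0"
  using prior_algebra by (auto intro!: measurableI simp: Int_absorb2 dest: sets.sets_into_space)

lemma past_generator_subset:
  "{A \<inter> (noise_vec n -` B \<inter> space P) | A B.
     A \<in> sets N0 \<and> B \<in> sets (Pi\<^sub>M {..<n} (\<lambda>_. borel))} \<subseteq> sets P"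
proof clarify
  fix A B assume "A \<in> sets N0" and [measurable]: "B \<in> sets (Pi\<^sub>M {..<n} (\<lambda>_. borel :: real measure))"
  then have [measurable]: "A \<in> sets P" using prior_algebra by blast
  have [measurable]: "noise_vec n \<in> P \<rightarrow>\<^sub>M Pi\<^sub>M {..<n} (\<lambda>_. borel)" by measurable
  show "A \<inter> (noise_vec n -` B \<inter> space P) \<in> sets P" by measurable
qed

lemma space_past [simp]: "space (past n) = space P"
  using past_generator_subset[of n] sets.sets_into_space[of _ P]
  unfolding past_def by (intro space_measure_of) blast

lemma sets_past: "sets (past n) = sigma_sets (space P) {A \<inter> (noise_vec n -` B \<inter> space P) | A B.
     A \<in> sets N0 \<and> B \<in> sets (Pi\<^sub>M {..<n} (\<lambda>_. borel))}"
  using past_generator_subset[of n] sets.sets_into_space[of _ P]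
  unfolding past_def by (intro sets_measure_of) blast

lemma measurable_past: "(\<lambda>\<omega>. \<omega>) \<in> P \<rightarrow>\<^sub>M past n"
proof (rule measurableI)
  fix A assume "A \<in> sets (past n)"
  then have "A \<in> sets P" unfolding sets_past using sets.sigma_sets_subset[OF past_generator_subset] by blast
  then show "(\<lambda>\<omega>. \<omega>) -` A \<inter> space P \<in> sets P" by (simp add: Int_absorb2 sets.sets_into_space)
qed simp

lemma past_prior: "(\<lambda>\<omega>. \<omega>) \<in> past n \<rightarrow>\<^sub>M N0"
proof (rule measurableI)
  fix A assume A: "A \<in> sets N0"
  have "A \<inter> (noise_vec n -` space (Pi\<^sub>M {..<n} (\<lambda>_. borel)) \<inter> space P) \<in> sets (past n)"
    unfolding sets_past using A by (intro sigma_sets.Basic) blast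
  also have "A \<inter> (noise_vec n -` space (Pi\<^sub>M {..<n} (\<lambda>_. borel)) \<inter> space P) = (\<lambda>\<omega>. \<omega>) -` A \<inter> space (past n)"
    by (auto simp: space_PiM)
  finally show "(\<lambda>\<omega>. \<omega>) -` A \<inter> space (past n) \<in> sets (past n)" .
qed (simp add: prior_algebra)

lemma past_noise_vector: "noise_vec n \<in> past n \<rightarrow>\<^sub>M Pi\<^sub>M {..<n} (\<lambda>_. borel)"
proof (rule measurableI)
  fix B assume B: "B \<in> sets (Pi\<^sub>M {..<n} (\<lambda>_. borel :: real measure))"
  have "space P \<inter> (noise_vec n -` B \<inter> space P) \<in> sets (past n)"
    unfolding sets_past using B sets.top[of N0] prior_algebra by (intro sigma_sets.Basic) auto
  then show "noise_vec n -` B \<inter> space (past n) \<in> sets (past n)"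
    by (simp add: Int_left_absorb Int_commute)
qed (simp add: space_PiM)

lemma past_noise: "j < n \<Longrightarrow> e j \<in> borel_measurable (past n)"
  using measurable_compose[OF past_noise_vector measurable_component_singleton, of j n] by simp

lemma past_Suc: "(\<lambda>\<omega>. \<omega>) \<in> past (Suc n) \<rightarrow>\<^sub>M past n"
  unfolding past_def[of n]
proof (rule measurable_measure_of)
  fix C assume "C \<in> {A \<inter> (noise_vec n -` B \<inter> space P) | A B.
     A \<in> sets N0 \<and> B \<in> sets (Pi\<^sub>M {..<n} (\<lambda>_. borel :: real measure))}"
  then obtain A B where C: "C = A \<inter> (noise_vec n -` B \<inter> space P)"
    and A: "A \<in> sets N0" and B: "B \<in> sets (Pi\<^sub>M {..<n} (\<lambda>_. borel :: real measure))" by blast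
  have "noise_vec n \<in> past (Suc n) \<rightarrow>\<^sub>M Pi\<^sub>M {..<n} (\<lambda>_. borel)"
    by (rule measurable_restrict) (simp add: past_noise)
  note sets.Int[OF measurable_sets[OF past_prior A] measurable_sets[OF this B]]
  also have "(\<lambda>\<omega>. \<omega>) -` A \<inter> space (past (Suc n)) \<inter> (noise_vec n -` B \<inter> space (past (Suc n)))
    = (\<lambda>\<omega>. \<omega>) -` C \<inter> space (past (Suc n))"
    unfolding C by auto
  finally show "(\<lambda>\<omega>. \<omega>) -` C \<inter> space (past (Suc n)) \<in> sets (past (Suc n))" .
qed (use past_generator_subset[of n] sets.sets_into_space[of _ P] in auto)

text \<open>On the generator the probability factorises in two steps: the field splits off from all
  noises, then \<open>e n\<close> from the earlier ones. Closure under intersections extends this to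
  the whole past.\<close>

lemma past_indep_noise: "indep_set (sets (past n)) {e n -` C \<inter> space P | C. C \<in> sets borel}"
proof -
  let ?E = "\<lambda>\<omega>. \<lambda>j\<in>{..<n}. e j \<omega>" and ?Pi = "Pi\<^sub>M {..<n} (\<lambda>_. borel :: real measure)"
  let ?G = "{A \<inter> (?E -` B \<inter> space P) | A B. A \<in> sets N0 \<and> B \<in> sets ?Pi}"
  let ?H = "{e n -` C \<inter> space P | C. C \<in> sets borel}"
  let ?V = "vimage_algebra (space P) (\<lambda>\<omega> n. e n \<omega>) (Pi\<^sub>M UNIV (\<lambda>_. borel))"
  have V: "(\<lambda>\<omega>. e j \<omega>) \<in> borel_measurable ?V" for j
    using measurable_compose[OF measurable_vimage_algebra1[of "\<lambda>\<omega> n. e n \<omega>" "space P" "Pi\<^sub>M UNIV (\<lambda>_. borel)"]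
      measurable_component_singleton[of j UNIV "\<lambda>_. borel"]] by (simp add: space_PiM)
  have VE: "?E \<in> ?V \<rightarrow>\<^sub>M ?Pi" by (rule measurable_restrict) (rule V)
  \<comment> \<open>The single noise is treated as a family indexed by \<open>{n}\<close>, because
    independence is drawn from disjoint sets of indices.\<close>
  have ind: "indep_var ?Pi ?E (Pi\<^sub>M {n} (\<lambda>_. borel)) (\<lambda>\<omega>. \<lambda>j\<in>{n}. e j \<omega>)"
    by (rule indep_var_restrict[OF noise_indep]) auto
  have "indep_set ?G ?H"
  proof (rule indep_setI)
    show "?G \<subseteq> events" by (rule past_generator_subset)
    show "?H \<subseteq> events" by (auto intro: measurable_sets)
    fix a b assume "a \<in> ?G" "b \<in> ?H"
    then obtain A B C where A: "A \<in> sets N0" and B: "B \<in> sets ?Pi" and C: "C \<in> sets (borel :: real measure)"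
      and a: "a = A \<inter> (?E -` B \<inter> space P)" and b: "b = e n -` C \<inter> space P" by blast
    have BV: "?E -` B \<inter> space P \<in> sets ?V" "e n -` C \<inter> space P \<in> sets ?V"
      using measurable_sets[OF VE B] measurable_sets[OF V C] by simp_all
    have "prob (a \<inter> b) = prob (A \<inter> ((?E -` B \<inter> space P) \<inter> (e n -` C \<inter> space P)))"
      by (simp add: a b Int_assoc)
    also have "\<dots> = prob A * prob ((?E -` B \<inter> space P) \<inter> (e n -` C \<inter> space P))"
      by (rule indep_setD[OF noise_prior_indep A sets.Int[OF BV]])
    also have "(?E -` B \<inter> space P) \<inter> (e n -` C \<inter> space P)
        = (\<lambda>x. (?E x, \<lambda>j\<in>{n}. e j x)) -` (B \<times> (Pi\<^sub>E {n} (\<lambda>_. C))) \<inter> space P"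
      by (auto simp: PiE_iff)
    also have "prob \<dots> = prob (?E -` B \<inter> space P) * prob ((\<lambda>\<omega>. \<lambda>j\<in>{n}. e j \<omega>) -` (Pi\<^sub>E {n} (\<lambda>_. C)) \<inter> space P)"
      by (rule indep_varD[OF ind B]) (use C in \<open>auto intro!: sets_PiM_I_finite\<close>)
    also have "(\<lambda>\<omega>. \<lambda>j\<in>{n}. e j \<omega>) -` (Pi\<^sub>E {n} (\<lambda>_. C)) \<inter> space P = e n -` C \<inter> space P"
      by (auto simp: PiE_iff)
    also have "prob A * (prob (?E -` B \<inter> space P) * prob (e n -` C \<inter> space P)) = prob a * prob b"
      using indep_setD[OF noise_prior_indep A BV(1)] by (simp add: a b)
    finally show "prob (a \<inter> b) = prob a * prob b" .
  qed
  moreover have "Int_stable ?G"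
  proof (rule Int_stableI, clarify)
    fix A A' B B' assume "A \<in> sets N0" "A' \<in> sets N0" "B \<in> sets ?Pi" "B' \<in> sets ?Pi"
    then show "\<exists>A'' B''. A \<inter> (?E -` B \<inter> space P) \<inter> (A' \<inter> (?E -` B' \<inter> space P)) = A'' \<inter> (?E -` B'' \<inter> space P) \<and>
      A'' \<in> sets N0 \<and> B'' \<in> sets ?Pi"
      by (intro exI[of _ "A \<inter> A'"] exI[of _ "B \<inter> B'"]) auto
  qed
  moreover have "Int_stable ?H"
  proof (rule Int_stableI, clarify)
    fix C C' :: "real set" assume "C \<in> sets borel" "C' \<in> sets borel"
    then show "\<exists>C''. e n -` C \<inter> space P \<inter> (e n -` C' \<inter> space P) = e n -` C'' \<inter> space P \<and> C'' \<in> sets borel"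
      by (intro exI[of _ "C \<inter> C'"]) auto
  qed
  ultimately have "indep_set (sigma_sets (space P) ?G) (sigma_sets (space P) ?H)"
    by (rule indep_set_sigma_sets)
  then show ?thesis
    unfolding sets_past indep_set_def
    by (rule indep_sets_mono_sets) (auto split: bool.split intro: sigma_sets.Basic)
qed

text \<open>By independence the past and the new noise have a product law. \<open>H\<close> may
  depend on the outcome through anything determined by the field and the earlier noises.\<close>

lemma nn_integral_past_noise:
  fixes H :: "'w \<times> real \<Rightarrow> ennreal"
  assumes [measurable]: "H \<in> borel_measurable (past n \<Otimes>\<^sub>M borel)"
  shows "(\<integral>\<^sup>+\<omega>. H (\<omega>, e n \<omega>) \<partial>P) = (\<integral>\<^sup>+\<omega>. \<integral>\<^sup>+z. std_normal_density z * H (\<omega>, z) \<partial>lborel \<partial>P)"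
proof -
  have [measurable]: "(\<lambda>\<omega>. \<omega>) \<in> P \<rightarrow>\<^sub>M past n" by (rule measurable_past)
  interpret N: prob_space "distr P borel (e n)" by (rule prob_space_distr) simp
  have "(\<integral>\<^sup>+\<omega>. H (\<omega>, e n \<omega>) \<partial>P) = (\<integral>\<^sup>+x. H x \<partial>distr P (past n \<Otimes>\<^sub>M borel) (\<lambda>\<omega>. (\<omega>, e n \<omega>)))"
    by (subst nn_integral_distr) auto
  also have "distr P (past n \<Otimes>\<^sub>M borel) (\<lambda>\<omega>. (\<omega>, e n \<omega>)) = distr P (past n) (\<lambda>\<omega>. \<omega>) \<Otimes>\<^sub>M distr P borel (e n)"
  proof (rule pair_measure_eqI[symmetric])
    fix A C assume A: "A \<in> sets (distr P (past n) (\<lambda>\<omega>. \<omega>))" and C: "C \<in> sets (distr P borel (e n))"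
    have A': "A \<in> sets P" using measurable_sets[OF measurable_past[of n], of A] A
      by (simp add: Int_absorb2 sets.sets_into_space[of A "past n", simplified])
    have "emeasure (distr P (past n \<Otimes>\<^sub>M borel) (\<lambda>\<omega>. (\<omega>, e n \<omega>))) (A \<times> C) = emeasure P (A \<inter> (e n -` C \<inter> space P))"
      using A C A' by (subst emeasure_distr) (auto intro!: arg_cong[of _ _ "emeasure P"] dest: sets.sets_into_space)
    also have "\<dots> = emeasure P A * emeasure P (e n -` C \<inter> space P)"
    proof -
      have "prob (A \<inter> (e n -` C \<inter> space P)) = prob A * prob (e n -` C \<inter> space P)"
        by (rule indep_setD[OF past_indep_noise[of n]]) (use A C in auto)
      then show ?thesis by (simp add: emeasure_eq_measure ennreal_mult)
    qed
    also have "emeasure P A = emeasure (distr P (past n) (\<lambda>\<omega>. \<omega>)) A"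
      using A A' by (subst emeasure_distr) (auto simp: Int_absorb2 dest: sets.sets_into_space)
    also have "emeasure P (e n -` C \<inter> space P) = emeasure (distr P borel (e n)) C"
      using C by (subst emeasure_distr) auto
    finally show "emeasure (distr P (past n) (\<lambda>\<omega>. \<omega>)) A * emeasure (distr P borel (e n)) C
      = emeasure (distr P (past n \<Otimes>\<^sub>M borel) (\<lambda>\<omega>. (\<omega>, e n \<omega>))) (A \<times> C)" ..
  next
    show "sigma_finite_measure (distr P (past n) (\<lambda>\<omega>. \<omega>))" "sigma_finite_measure (distr P borel (e n))"
      by (intro finite_measure.axioms(1) prob_space.finite_measure prob_space_distr; simp)+
  qed simp
  also have "(\<integral>\<^sup>+x. H x \<partial>(distr P (past n) (\<lambda>\<omega>. \<omega>) \<Otimes>\<^sub>M distr P borel (e n)))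
     = (\<integral>\<^sup>+\<omega>. \<integral>\<^sup>+z. H (\<omega>, z) \<partial>distr P borel (e n) \<partial>distr P (past n) (\<lambda>\<omega>. \<omega>))"
    by (rule N.nn_integral_fst[symmetric]) simp
  also have "\<dots> = (\<integral>\<^sup>+\<omega>. \<integral>\<^sup>+z. H (\<omega>, z) \<partial>distr P borel (e n) \<partial>P)"
    by (subst nn_integral_distr) auto
  also have "distr P borel (e n) = density lborel std_normal_density"
    using distributed_distr_eq_density[OF noise_normal[of n]] by (simp cong: distr_cong)
  also have "(\<integral>\<^sup>+\<omega>. \<integral>\<^sup>+z. H (\<omega>, z) \<partial>density lborel std_normal_density \<partial>P)
     = (\<integral>\<^sup>+\<omega>. \<integral>\<^sup>+z. std_normal_density z * H (\<omega>, z) \<partial>lborel \<partial>P)"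
    by (intro nn_integral_cong) (subst nn_integral_density; auto simp: space_pair_measure)
  finally show ?thesis .
qed

end

lemma nn_integral_normal_density_affine:
  fixes g :: "real \<Rightarrow> ennreal"
  assumes s: "0 < s" and [measurable]: "g \<in> borel_measurable borel"
  shows "(\<integral>\<^sup>+z. std_normal_density z * g (m + s * z) \<partial>lborel) = (\<integral>\<^sup>+r. normal_density m s r * g r \<partial>lborel)"
proof -
  have "(\<integral>\<^sup>+r. normal_density m s r * g r \<partial>lborel)
      = ennreal \<bar>s\<bar> * (\<integral>\<^sup>+z. normal_density m s (m + s * z) * g (m + s * z) \<partial>lborel)"
    by (rule nn_integral_real_affine) (use s in auto)
  also have "\<dots> = (\<integral>\<^sup>+z. ennreal \<bar>s\<bar> * (normal_density m s (m + s * z) * g (m + s * z)) \<partial>lborel)"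
    by (rule nn_integral_cmult[symmetric]) measurable
  also have "\<dots> = (\<integral>\<^sup>+z. std_normal_density z * g (m + s * z) \<partial>lborel)"
  proof (rule nn_integral_cong)
    fix z :: real
    have "\<bar>s\<bar> * normal_density m s (m + s * z) = std_normal_density z"
      using s by (simp add: normal_density_def power_mult_distrib real_sqrt_mult)
    then show "ennreal \<bar>s\<bar> * (normal_density m s (m + s * z) * g (m + s * z)) = std_normal_density z * g (m + s * z)"
      by (simp add: mult.assoc[symmetric] ennreal_mult[symmetric])
  qed
  finally show ?thesis ..
qed

section \<open>Likelihoods and Bayes' formula\<close>

context adaptive_sampling
begin

text \<open>\<open>obs_density n \<omega> \<omega>'\<close> is the density of the observation following time \<open>n\<close> if the design is
  the one made in \<open>\<omega>'\<close> while the field is the one of \<open>\<omega>\<close>.\<close>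

definition obs_density :: "nat \<Rightarrow> 'w \<Rightarrow> 'w \<Rightarrow> real \<Rightarrow> real" where
  "obs_density n \<omega> \<omega>' r = normal_density (f (d n \<omega>') \<omega>) (sqrt (l (d n \<omega>'))) r"

definition likelihood :: "nat \<Rightarrow> 'w \<Rightarrow> 'w \<Rightarrow> real" where
  "likelihood n \<omega> \<omega>' = (\<Prod>j<n. obs_density j \<omega> \<omega>' (y (Suc j) \<omega>'))"

lemma field_compose: "g \<in> N \<rightarrow>\<^sub>M D \<Longrightarrow> h \<in> N \<rightarrow>\<^sub>M N0 \<Longrightarrow> (\<lambda>x. f (g x) (h x)) \<in> borel_measurable N"
  using measurable_compose[OF measurable_Pair field_measurable, of g N h] by simp

lemma design_obs: "j \<le> n \<Longrightarrow> d j \<in> obs n \<rightarrow>\<^sub>M D"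
  using measurable_compose[OF obs_algebra_mono design_adapted] by simp

lemma design_space: "\<omega> \<in> space P \<Longrightarrow> d n \<omega> \<in> space D"
  using measurable_space[OF design_adapted, of \<omega> n] by simp

lemma noise_var_pos: "\<omega> \<in> space P \<Longrightarrow> 0 < l (d n \<omega>)"
  using noise_var(2) design_space by simp

text \<open>Observations and adapted designs are functions of the field and the earlier noises; so
  the history at time \<open>n\<close> is independent of \<open>e n\<close>.\<close>

lemma past_obs: "(\<lambda>\<omega>. \<omega>) \<in> past n \<rightarrow>\<^sub>M obs n"
proof (induction n)
  case 0
  then show ?case by (auto intro!: measurable_measure_of)
next
  case (Suc n)
  have obs: "(\<lambda>\<omega>. \<omega>) \<in> past (Suc n) \<rightarrow>\<^sub>M obs n"
    by (rule measurable_compose[OF past_Suc Suc])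
  have d: "d n \<in> past (Suc n) \<rightarrow>\<^sub>M D"
    using measurable_compose[OF obs design_adapted] .
  have [measurable]: "(\<lambda>\<omega>. f (d n \<omega>) \<omega>) \<in> borel_measurable (past (Suc n))"
    "(\<lambda>\<omega>. l (d n \<omega>)) \<in> borel_measurable (past (Suc n))" "e n \<in> borel_measurable (past (Suc n))"
    using field_compose[OF d past_prior] measurable_compose[OF d noise_var(1)] past_noise[of n "Suc n"] by simp_all
  have "(\<lambda>\<omega>. f (d n \<omega>) \<omega> + sqrt (l (d n \<omega>)) * e n \<omega>) \<in> borel_measurable (past (Suc n))" by measurable
  then have "y (Suc n) \<in> borel_measurable (past (Suc n))"
    by (rule measurable_cong[THEN iffD1, rotated]) (simp add: observation)
  with obs show ?case
    unfolding obs_algebra.simps by (intro measurable_vimage_algebra2 measurable_Pair) simp_all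
qed

lemma measurable_obs: "(\<lambda>\<omega>. \<omega>) \<in> P \<rightarrow>\<^sub>M obs n"
  by (rule measurable_compose[OF measurable_past past_obs])

text \<open>The outcome of the field and the outcome that fixes the history enter through different
  maps \<open>g\<close> and \<open>h\<close>, as a frozen history requires.\<close>

lemma obs_density_measurable:
  assumes g: "g \<in> N \<rightarrow>\<^sub>M N0" and h: "h \<in> N \<rightarrow>\<^sub>M obs n" and r: "r \<in> borel_measurable N" and j: "j \<le> n"
  shows "(\<lambda>x. obs_density j (g x) (h x) (r x)) \<in> borel_measurable N"
proof -
  have d: "(\<lambda>x. d j (h x)) \<in> N \<rightarrow>\<^sub>M D" using measurable_compose[OF h design_obs[OF j]] .
  have [measurable]: "(\<lambda>x. f (d j (h x)) (g x)) \<in> borel_measurable N" "(\<lambda>x. l (d j (h x))) \<in> borel_measurable N"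
    using field_compose[OF d g] measurable_compose[OF d noise_var(1)] by simp_all
  note r[measurable]
  show ?thesis unfolding obs_density_def normal_density_def by measurable
qed

lemma likelihood_measurable:
  assumes g: "g \<in> N \<rightarrow>\<^sub>M N0" and h: "h \<in> N \<rightarrow>\<^sub>M obs n"
  shows "(\<lambda>x. likelihood n (g x) (h x)) \<in> borel_measurable N"
  unfolding likelihood_def
proof (rule borel_measurable_prod)
  fix j assume "j \<in> {..<n}"
  then have j: "Suc j \<le> n" by simp
  show "(\<lambda>x. obs_density j (g x) (h x) (y (Suc j) (h x))) \<in> borel_measurable N"
    using obs_density_measurable[OF g h measurable_compose[OF h measurable_observation[OF j]]] j by simp
qed

lemma obs_density_pos: "\<omega>' \<in> space P \<Longrightarrow> 0 < obs_density n \<omega> \<omega>' r"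
  unfolding obs_density_def by (intro normal_density_pos) (simp add: noise_var_pos)

lemma obs_density_bounded:
  "\<omega>' \<in> space P \<Longrightarrow> obs_density n \<omega> \<omega>' r \<le> 1 / sqrt (2 * pi * l (d n \<omega>'))"
  unfolding obs_density_def by (rule normal_density_le[OF noise_var_pos])

lemma likelihood_pos: "\<omega>' \<in> space P \<Longrightarrow> 0 < likelihood n \<omega> \<omega>'"
  unfolding likelihood_def by (intro prod_pos) (simp add: obs_density_pos)

lemma likelihood_bounded:
  "\<omega>' \<in> space P \<Longrightarrow> likelihood n \<omega> \<omega>' \<le> (\<Prod>j<n. 1 / sqrt (2 * pi * l (d j \<omega>')))"
  unfolding likelihood_def
  by (intro prod_mono conjI less_imp_le[OF obs_density_pos] obs_density_bounded) simp_all

text \<open>With a likelihood as \<open>g\<close>, the normalising integrals of Bayes' formula are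
  positive and finite, so that they cancel in \<open>ennreal\<close>.\<close>

lemma nn_integral_positive_bounded:
  assumes [measurable]: "g \<in> borel_measurable P" and g: "\<And>\<omega>. 0 < g \<omega>" "\<And>\<omega>. g \<omega> \<le> C"
  shows "0 < (\<integral>\<^sup>+\<omega>. ennreal (g \<omega>) \<partial>P)" "(\<integral>\<^sup>+\<omega>. ennreal (g \<omega>) \<partial>P) < \<infinity>"
proof -
  have "(\<integral>\<^sup>+\<omega>. ennreal (g \<omega>) \<partial>P) \<noteq> 0"
  proof
    assume "(\<integral>\<^sup>+\<omega>. ennreal (g \<omega>) \<partial>P) = 0"
    then have "AE \<omega> in P. ennreal (g \<omega>) = 0" by (subst (asm) nn_integral_0_iff_AE) auto
    then have "AE \<omega> in P. False" by (rule AE_mp) (use g(1) in \<open>auto simp: ennreal_eq_0_iff not_le\<close>)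
    then show False by simp
  qed
  then show "0 < (\<integral>\<^sup>+\<omega>. ennreal (g \<omega>) \<partial>P)" by (simp add: zero_less_iff_neq_zero)
  have "(\<integral>\<^sup>+\<omega>. ennreal (g \<omega>) \<partial>P) \<le> (\<integral>\<^sup>+\<omega>. ennreal C \<partial>P)"
    by (intro nn_integral_mono ennreal_leI g)
  also have "\<dots> < \<infinity>" by (simp add: emeasure_space_1)
  finally show "(\<integral>\<^sup>+\<omega>. ennreal (g \<omega>) \<partial>P) < \<infinity>" .
qed

text \<open>Given the past, the next observation has density
  \<open>obs_density n \<omega> \<omega>\<close>. The outcome occurs twice in \<open>h\<close>, once
  for the field and once for the history, because \<open>Bayes\<close> separates the two.\<close>

lemma nn_integral_observation:
  fixes h :: "'w \<times> 'w \<times> real \<Rightarrow> ennreal"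
  assumes h: "h \<in> borel_measurable (N0 \<Otimes>\<^sub>M (obs n \<Otimes>\<^sub>M borel))"
  shows "(\<integral>\<^sup>+\<omega>. h (\<omega>, \<omega>, y (Suc n) \<omega>) \<partial>P) = (\<integral>\<^sup>+\<omega>. \<integral>\<^sup>+r. obs_density n \<omega> \<omega> r * h (\<omega>, \<omega>, r) \<partial>lborel \<partial>P)"
proof -
  have d: "d n \<in> past n \<rightarrow>\<^sub>M D" using measurable_compose[OF past_obs design_adapted] .
  have [measurable]: "(\<lambda>\<omega>. f (d n \<omega>) \<omega>) \<in> borel_measurable (past n)" "(\<lambda>\<omega>. l (d n \<omega>)) \<in> borel_measurable (past n)"
    using field_compose[OF d past_prior] measurable_compose[OF d noise_var(1)] by simp_all
  have ids: "fst \<in> past n \<Otimes>\<^sub>M borel \<rightarrow>\<^sub>M N0" "fst \<in> past n \<Otimes>\<^sub>M (borel :: real measure) \<rightarrow>\<^sub>M obs n"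
    by (rule measurable_compose[OF measurable_fst past_prior], rule measurable_compose[OF measurable_fst past_obs])
  have H: "(\<lambda>x. h (fst x, fst x, f (d n (fst x)) (fst x) + sqrt (l (d n (fst x))) * snd x)) \<in> borel_measurable (past n \<Otimes>\<^sub>M borel)"
    by (rule measurable_compose[OF _ h]) (intro measurable_Pair ids; measurable)
  have "(\<integral>\<^sup>+\<omega>. h (\<omega>, \<omega>, y (Suc n) \<omega>) \<partial>P) = (\<integral>\<^sup>+\<omega>. h (\<omega>, \<omega>, f (d n \<omega>) \<omega> + sqrt (l (d n \<omega>)) * e n \<omega>) \<partial>P)"
    by (intro nn_integral_cong) (simp add: observation)
  also have "\<dots> = (\<integral>\<^sup>+\<omega>. \<integral>\<^sup>+z. std_normal_density z * h (\<omega>, \<omega>, f (d n \<omega>) \<omega> + sqrt (l (d n \<omega>)) * z) \<partial>lborel \<partial>P)"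
    using nn_integral_past_noise[OF H] by simp
  also have "\<dots> = (\<integral>\<^sup>+\<omega>. \<integral>\<^sup>+r. obs_density n \<omega> \<omega> r * h (\<omega>, \<omega>, r) \<partial>lborel \<partial>P)"
  proof (rule nn_integral_cong)
    fix \<omega> assume \<omega>: "\<omega> \<in> space P"
    have "(\<lambda>r. h (\<omega>, \<omega>, r)) \<in> borel_measurable borel"
      by (rule measurable_compose[OF _ h]) (intro measurable_Pair; use \<omega> prior_algebra in simp)
    then show "(\<integral>\<^sup>+z. std_normal_density z * h (\<omega>, \<omega>, f (d n \<omega>) \<omega> + sqrt (l (d n \<omega>)) * z) \<partial>lborel)
      = (\<integral>\<^sup>+r. obs_density n \<omega> \<omega> r * h (\<omega>, \<omega>, r) \<partial>lborel)"
      unfolding obs_density_def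
      by (intro nn_integral_normal_density_affine) (use noise_var_pos[OF \<omega>] in simp)
  qed
  finally show ?thesis .
qed

theorem Bayes:
  fixes F :: "'w \<times> 'w \<Rightarrow> ennreal"
  assumes "F \<in> borel_measurable (N0 \<Otimes>\<^sub>M obs n)"
  shows "(\<integral>\<^sup>+\<omega>. F (\<omega>, \<omega>) \<partial>P) = (\<integral>\<^sup>+\<omega>'. (\<integral>\<^sup>+\<omega>. likelihood n \<omega> \<omega>' * F (\<omega>, \<omega>') \<partial>P) / (\<integral>\<^sup>+\<omega>. likelihood n \<omega> \<omega>' \<partial>P) \<partial>P)"
  using assms
proof (induction n arbitrary: F)
  case 0
  \<comment> \<open>Before any observation the history algebra is trivial, so \<open>F\<close> is
    constant in its second argument.\<close>
  have const: "F (\<omega>, \<omega>') = F (\<omega>, \<omega>)" if \<omega>: "\<omega> \<in> space P" "\<omega>' \<in> space P" for \<omega> \<omega>'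
  proof -
    have "(\<lambda>\<omega>'. F (\<omega>, \<omega>')) \<in> borel_measurable (sigma (space P) {})"
      using 0 \<omega> prior_algebra by (intro measurable_compose[OF _ 0] measurable_Pair) simp_all
    from measurable_sets[OF this, of "{F (\<omega>, \<omega>)}"]
    have "(\<lambda>\<omega>'. F (\<omega>, \<omega>')) -` {F (\<omega>, \<omega>)} \<inter> space P \<in> {{}, space P}"
      by (simp add: sigma_sets_empty_eq)
    then show ?thesis using \<omega> by blast
  qed
  have "(\<integral>\<^sup>+\<omega>. likelihood 0 \<omega> \<omega>' * F (\<omega>, \<omega>') \<partial>P) / (\<integral>\<^sup>+\<omega>. likelihood 0 \<omega> \<omega>' \<partial>P) = (\<integral>\<^sup>+\<omega>. F (\<omega>, \<omega>) \<partial>P)"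
    if "\<omega>' \<in> space P" for \<omega>'
  proof -
    have "(\<integral>\<^sup>+\<omega>. likelihood 0 \<omega> \<omega>' * F (\<omega>, \<omega>') \<partial>P) = (\<integral>\<^sup>+\<omega>. F (\<omega>, \<omega>) \<partial>P)"
      by (rule nn_integral_cong) (simp add: likelihood_def const[OF _ that])
    then show ?thesis by (simp add: likelihood_def emeasure_space_1 divide_ennreal_def)
  qed
  then have "(\<integral>\<^sup>+\<omega>'. (\<integral>\<^sup>+\<omega>. likelihood 0 \<omega> \<omega>' * F (\<omega>, \<omega>') \<partial>P) / (\<integral>\<^sup>+\<omega>. likelihood 0 \<omega> \<omega>' \<partial>P) \<partial>P)
     = (\<integral>\<^sup>+\<omega>'. (\<integral>\<^sup>+\<omega>. F (\<omega>, \<omega>) \<partial>P) \<partial>P)"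
    by (rule nn_integral_cong)
  then show ?case by (simp add: emeasure_space_1)
next
  case (Suc n)
  interpret LP: pair_sigma_finite lborel P ..
  let ?T = "N0 \<Otimes>\<^sub>M (obs n \<Otimes>\<^sub>M borel)"
  let ?Z = "space P \<times> space P" and ?G = "\<lambda>x. (fst x, snd x, y (Suc n) (snd x))"
  have G: "?G \<in> ?Z \<rightarrow> space ?T" by (auto simp: space_pair_measure prior_algebra)
  have "F \<in> borel_measurable (vimage_algebra ?Z ?G ?T)"
  proof -
    have V: "?G \<in> vimage_algebra ?Z ?G ?T \<rightarrow>\<^sub>M ?T" by (rule measurable_vimage_algebra1[OF G])
    have 1: "fst \<in> vimage_algebra ?Z ?G ?T \<rightarrow>\<^sub>M N0"
      using measurable_compose[OF V measurable_fst] by simp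
    have 2: "snd \<in> vimage_algebra ?Z ?G ?T \<rightarrow>\<^sub>M obs (Suc n)"
      using measurable_compose[OF V measurable_snd]
      unfolding obs_algebra.simps by (intro measurable_vimage_algebra2) auto
    show ?thesis using measurable_compose[OF measurable_Pair[OF 1 2] Suc.prems] by simp
  qed
  from borel_measurable_vimage_algebra_factor[OF G this]
  obtain h where h: "h \<in> borel_measurable ?T"
    and Fh: "\<And>\<omega> \<omega>'. \<omega> \<in> space P \<Longrightarrow> \<omega>' \<in> space P \<Longrightarrow> F (\<omega>, \<omega>') = h (\<omega>, \<omega>', y (Suc n) \<omega>')"
    by auto
  let ?L = "\<lambda>\<omega> \<omega>'. ennreal (likelihood n \<omega> \<omega>')"
  let ?q = "\<lambda>\<omega> \<omega>' r. ennreal (obs_density n \<omega> \<omega>' r)"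
  define num where "num \<omega>' r = (\<integral>\<^sup>+\<omega>. ?L \<omega> \<omega>' * (?q \<omega> \<omega>' r * h (\<omega>, \<omega>', r)) \<partial>P)" for \<omega>' r
  define den where "den \<omega>' r = (\<integral>\<^sup>+\<omega>. ?L \<omega> \<omega>' * ?q \<omega> \<omega>' r \<partial>P)" for \<omega>' r
  note q_meas = measurable_compose[OF obs_density_measurable[OF _ _ _ order_refl] measurable_ennreal]
  note L_meas = measurable_compose[OF likelihood_measurable measurable_ennreal]
  note h_meas = measurable_compose[OF measurable_Pair[OF _ measurable_Pair] h]
  note meas = borel_measurable_times_ennreal q_meas L_meas h_meas
  have num_meas: "(\<lambda>x. num (fst x) (snd x)) \<in> borel_measurable (obs n \<Otimes>\<^sub>M borel)"
    unfolding num_def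
    by (intro borel_measurable_nn_integral, unfold case_prod_beta, intro meas
        measurable_compose[OF measurable_snd prior_measurable]) measurable
  have den_meas: "(\<lambda>x. den (fst x) (snd x)) \<in> borel_measurable (obs n \<Otimes>\<^sub>M borel)"
    unfolding den_def
    by (intro borel_measurable_nn_integral, unfold case_prod_beta, intro meas
        measurable_compose[OF measurable_snd prior_measurable]) measurable
  have post_meas: "(\<lambda>x. num (fst x) (snd x) / den (fst x) (snd x)) \<in> borel_measurable (obs n \<Otimes>\<^sub>M borel)"
    using num_meas den_meas by measurable
  have den_pos: "0 < den \<omega>' r" "den \<omega>' r < \<infinity>" if \<omega>': "\<omega>' \<in> space P" for \<omega>' r
  proof -
    have const: "(\<lambda>_. \<omega>') \<in> P \<rightarrow>\<^sub>M obs n" using \<omega>' by simp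
    have m: "(\<lambda>\<omega>. likelihood n \<omega> \<omega>' * obs_density n \<omega> \<omega>' r) \<in> borel_measurable P"
      by (intro borel_measurable_times likelihood_measurable prior_measurable const
          obs_density_measurable[where j = n and n = n]) simp_all
    have e: "den \<omega>' r = (\<integral>\<^sup>+\<omega>. ennreal (likelihood n \<omega> \<omega>' * obs_density n \<omega> \<omega>' r) \<partial>P)"
      unfolding den_def using \<omega>' by (simp add: ennreal_mult less_imp_le[OF likelihood_pos] less_imp_le[OF obs_density_pos])
    have b: "likelihood n \<omega> \<omega>' * obs_density n \<omega> \<omega>' r
        \<le> (\<Prod>j<n. 1 / sqrt (2 * pi * l (d j \<omega>'))) * (1 / sqrt (2 * pi * l (d n \<omega>')))" for \<omega>
      using \<omega>' by (intro mult_mono likelihood_bounded obs_density_bounded less_imp_le[OF obs_density_pos] prod_nonneg)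
        (simp_all add: less_imp_le[OF noise_var_pos])
    have p: "0 < likelihood n \<omega> \<omega>' * obs_density n \<omega> \<omega>' r" for \<omega>
      using \<omega>' by (intro mult_pos_pos likelihood_pos obs_density_pos)
    show "0 < den \<omega>' r" "den \<omega>' r < \<infinity>"
      unfolding e by (rule nn_integral_positive_bounded[OF m p b])+
  qed
  \<comment> \<open>With the field integrated first, the left side produces \<open>den\<close> times
    \<open>num / den\<close> and the right side \<open>num\<close>, at every
    \<open>r\<close>.\<close>
  have inner: "(\<integral>\<^sup>+\<omega>. ?L \<omega> \<omega>' * (\<integral>\<^sup>+r. ?q \<omega> \<omega>' r * (num \<omega>' r / den \<omega>' r) \<partial>lborel) \<partial>P)
    = (\<integral>\<^sup>+\<omega>. ?L \<omega> \<omega>' * (\<integral>\<^sup>+r. ?q \<omega> \<omega>' r * h (\<omega>, \<omega>', r) \<partial>lborel) \<partial>P)" if \<omega>': "\<omega>' \<in> space P" for \<omega>'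
  proof -
    have const: "(\<lambda>_. \<omega>') \<in> N \<rightarrow>\<^sub>M obs n" for N :: "(real \<times> 'w) measure" using \<omega>' by simp
    have const': "(\<lambda>_. \<omega>') \<in> N \<rightarrow>\<^sub>M obs n" for N :: "real measure" using \<omega>' by simp
    have constP: "(\<lambda>_. \<omega>') \<in> N \<rightarrow>\<^sub>M obs n" for N :: "'w measure" using \<omega>' by simp
    have post: "(\<lambda>r. num \<omega>' r / den \<omega>' r) \<in> borel_measurable lborel"
    proof -
      have "(\<lambda>r. (\<omega>', r)) \<in> lborel \<rightarrow>\<^sub>M obs n \<Otimes>\<^sub>M borel" by (intro measurable_Pair) (simp_all add: \<omega>')
      from measurable_compose[OF this post_meas] show ?thesis by simp
    qed
    have swap: "(\<integral>\<^sup>+\<omega>. ?L \<omega> \<omega>' * (\<integral>\<^sup>+r. ?q \<omega> \<omega>' r * k \<omega> r \<partial>lborel) \<partial>P)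
       = (\<integral>\<^sup>+r. \<integral>\<^sup>+\<omega>. ?L \<omega> \<omega>' * (?q \<omega> \<omega>' r * k \<omega> r) \<partial>P \<partial>lborel)"
      if k: "(\<lambda>x. k (snd x) (fst x)) \<in> borel_measurable (lborel \<Otimes>\<^sub>M P)" for k
    proof -
      have m: "(\<lambda>x. ?L (snd x) \<omega>' * (?q (snd x) \<omega>' (fst x) * k (snd x) (fst x))) \<in> borel_measurable (lborel \<Otimes>\<^sub>M P)"
        by (intro meas k const measurable_compose[OF measurable_snd prior_measurable]) measurable
      have "(\<integral>\<^sup>+\<omega>. ?L \<omega> \<omega>' * (\<integral>\<^sup>+r. ?q \<omega> \<omega>' r * k \<omega> r \<partial>lborel) \<partial>P)
        = (\<integral>\<^sup>+\<omega>. \<integral>\<^sup>+r. ?L \<omega> \<omega>' * (?q \<omega> \<omega>' r * k \<omega> r) \<partial>lborel \<partial>P)"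
      proof (intro nn_integral_cong nn_integral_cmult[symmetric])
        fix \<omega> assume \<omega>: "\<omega> \<in> space P"
        have "(\<lambda>r. k \<omega> r) \<in> borel_measurable lborel"
          using measurable_compose[OF measurable_Pair[OF measurable_ident measurable_const[OF \<omega>]] k] by simp
        then show "(\<lambda>r. ?q \<omega> \<omega>' r * k \<omega> r) \<in> borel_measurable lborel"
          by (intro meas const') (use \<omega> prior_algebra in auto)
      qed
      also have "\<dots> = (\<integral>\<^sup>+r. \<integral>\<^sup>+\<omega>. ?L \<omega> \<omega>' * (?q \<omega> \<omega>' r * k \<omega> r) \<partial>P \<partial>lborel)"
        by (rule LP.Fubini') (use m in \<open>simp add: case_prod_beta\<close>)
      finally show ?thesis .
    qed
    have "(\<integral>\<^sup>+\<omega>. ?L \<omega> \<omega>' * (\<integral>\<^sup>+r. ?q \<omega> \<omega>' r * (num \<omega>' r / den \<omega>' r) \<partial>lborel) \<partial>P)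
      = (\<integral>\<^sup>+r. \<integral>\<^sup>+\<omega>. ?L \<omega> \<omega>' * (?q \<omega> \<omega>' r * (num \<omega>' r / den \<omega>' r)) \<partial>P \<partial>lborel)"
      by (rule swap[of "\<lambda>_ r. num \<omega>' r / den \<omega>' r"]) (rule measurable_compose[OF measurable_fst post])
    also have "\<dots> = (\<integral>\<^sup>+r. num \<omega>' r \<partial>lborel)"
    proof (rule nn_integral_cong)
      fix r :: real
      have "(\<integral>\<^sup>+\<omega>. ?L \<omega> \<omega>' * (?q \<omega> \<omega>' r * (num \<omega>' r / den \<omega>' r)) \<partial>P) = den \<omega>' r * (num \<omega>' r / den \<omega>' r)"
        unfolding den_def mult.assoc[symmetric]
        by (rule nn_integral_multc) (intro meas prior_measurable constP; simp)
      also have "\<dots> = num \<omega>' r"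
        using den_pos[OF \<omega>', of r] by (metis ennreal_times_divide infinity_ennreal_def less_irrefl mult.commute mult_divide_eq_ennreal)
      finally show "(\<integral>\<^sup>+\<omega>. ?L \<omega> \<omega>' * (?q \<omega> \<omega>' r * (num \<omega>' r / den \<omega>' r)) \<partial>P) = num \<omega>' r" .
    qed
    also have "\<dots> = (\<integral>\<^sup>+\<omega>. ?L \<omega> \<omega>' * (\<integral>\<^sup>+r. ?q \<omega> \<omega>' r * h (\<omega>, \<omega>', r) \<partial>lborel) \<partial>P)"
      unfolding num_def
      by (rule swap[symmetric]) (intro h_meas const measurable_compose[OF measurable_snd prior_measurable]; measurable)
    finally show ?thesis .
  qed
  have IH: "(\<integral>\<^sup>+\<omega>. (\<integral>\<^sup>+r. ?q \<omega> \<omega> r * k \<omega> \<omega> r \<partial>lborel) \<partial>P)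
    = (\<integral>\<^sup>+\<omega>'. (\<integral>\<^sup>+\<omega>. ?L \<omega> \<omega>' * (\<integral>\<^sup>+r. ?q \<omega> \<omega>' r * k \<omega> \<omega>' r \<partial>lborel) \<partial>P) / (\<integral>\<^sup>+\<omega>. ?L \<omega> \<omega>' \<partial>P) \<partial>P)"
    if k: "(\<lambda>x. k (fst (fst x)) (snd (fst x)) (snd x)) \<in> borel_measurable ((N0 \<Otimes>\<^sub>M obs n) \<Otimes>\<^sub>M borel)" for k
  proof -
    have "(\<lambda>x. \<integral>\<^sup>+r. ?q (fst x) (snd x) r * k (fst x) (snd x) r \<partial>lborel) \<in> borel_measurable (N0 \<Otimes>\<^sub>M obs n)"
      by (intro lborel.borel_measurable_nn_integral, unfold case_prod_beta, intro meas) (use k in \<open>measurable\<close>)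
    from Suc.IH[OF this] show ?thesis by simp
  qed
  have "(\<integral>\<^sup>+\<omega>. F (\<omega>, \<omega>) \<partial>P) = (\<integral>\<^sup>+\<omega>. h (\<omega>, \<omega>, y (Suc n) \<omega>) \<partial>P)"
    by (intro nn_integral_cong) (simp add: Fh)
  also have "\<dots> = (\<integral>\<^sup>+\<omega>. \<integral>\<^sup>+r. ?q \<omega> \<omega> r * h (\<omega>, \<omega>, r) \<partial>lborel \<partial>P)"
    by (rule nn_integral_observation[OF h])
  also have "\<dots> = (\<integral>\<^sup>+\<omega>'. (\<integral>\<^sup>+\<omega>. ?L \<omega> \<omega>' * (\<integral>\<^sup>+r. ?q \<omega> \<omega>' r * h (\<omega>, \<omega>', r) \<partial>lborel) \<partial>P) / (\<integral>\<^sup>+\<omega>. ?L \<omega> \<omega>' \<partial>P) \<partial>P)"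
    by (rule IH) (intro h_meas; measurable)
  also have "\<dots> = (\<integral>\<^sup>+\<omega>'. (\<integral>\<^sup>+\<omega>. ?L \<omega> \<omega>' * (\<integral>\<^sup>+r. ?q \<omega> \<omega>' r * (num \<omega>' r / den \<omega>' r) \<partial>lborel) \<partial>P) / (\<integral>\<^sup>+\<omega>. ?L \<omega> \<omega>' \<partial>P) \<partial>P)"
    by (intro nn_integral_cong) (simp add: inner)
  also have "\<dots> = (\<integral>\<^sup>+\<omega>. \<integral>\<^sup>+r. ?q \<omega> \<omega> r * (num \<omega> r / den \<omega> r) \<partial>lborel \<partial>P)"
  proof (rule IH[symmetric])
    have "(\<lambda>x. (snd (fst x), snd x)) \<in> (N0 \<Otimes>\<^sub>M obs n) \<Otimes>\<^sub>M borel \<rightarrow>\<^sub>M obs n \<Otimes>\<^sub>M (borel :: real measure)" by measurable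
    from measurable_compose[OF this post_meas]
    show "(\<lambda>x. num (snd (fst x)) (snd x) / den (snd (fst x)) (snd x)) \<in> borel_measurable ((N0 \<Otimes>\<^sub>M obs n) \<Otimes>\<^sub>M borel)"
      by simp
  qed
  also have "\<dots> = (\<integral>\<^sup>+\<omega>. num \<omega> (y (Suc n) \<omega>) / den \<omega> (y (Suc n) \<omega>) \<partial>P)"
    using nn_integral_observation[OF measurable_compose[OF measurable_snd post_meas]] by simp
  also have "\<dots> = (\<integral>\<^sup>+\<omega>'. (\<integral>\<^sup>+\<omega>. likelihood (Suc n) \<omega> \<omega>' * F (\<omega>, \<omega>') \<partial>P) / (\<integral>\<^sup>+\<omega>. likelihood (Suc n) \<omega> \<omega>' \<partial>P) \<partial>P)"
  proof (intro nn_integral_cong arg_cong2[of _ _ _ _ "(/)"])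
    fix \<omega>' assume \<omega>': "\<omega>' \<in> space P"
    have e: "ennreal (likelihood (Suc n) \<omega> \<omega>') = ?L \<omega> \<omega>' * ?q \<omega> \<omega>' (y (Suc n) \<omega>')" for \<omega>
      using \<omega>' by (simp add: likelihood_def ennreal_mult prod_nonneg less_imp_le[OF obs_density_pos])
    show "den \<omega>' (y (Suc n) \<omega>') = (\<integral>\<^sup>+\<omega>. likelihood (Suc n) \<omega> \<omega>' \<partial>P)"
      unfolding den_def e ..
    show "num \<omega>' (y (Suc n) \<omega>') = (\<integral>\<^sup>+\<omega>. likelihood (Suc n) \<omega> \<omega>' * F (\<omega>, \<omega>') \<partial>P)"
      unfolding num_def e by (intro nn_integral_cong) (simp add: Fh \<omega>' mult.assoc)
  qed
  finally show ?case .
qed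

end


section \<open>Convergence of closed martingales\<close>

text \<open>Inclusions of sigma-algebras are stated as measurability of the identity.
  \<open>closed\<close> expresses that \<open>X n\<close> is the conditional expectation of
  \<open>Z\<close> given \<open>F n\<close>.\<close>

locale closed_martingale = prob_space P
  for P :: "'w measure" +
  fixes F :: "nat \<Rightarrow> 'w measure" and Z :: "'w \<Rightarrow> real" and X :: "nat \<Rightarrow> 'w \<Rightarrow> real"
  assumes filtration: "\<And>n. (\<lambda>\<omega>. \<omega>) \<in> P \<rightarrow>\<^sub>M F n" "\<And>m n. m \<le> n \<Longrightarrow> (\<lambda>\<omega>. \<omega>) \<in> F n \<rightarrow>\<^sub>M F m"
    "\<And>n. space (F n) = space P"
    and adapted: "\<And>n. X n \<in> borel_measurable (F n)"
    and integrable: "\<And>n. integrable P (X n)" "integrable P Z"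
    and closed: "\<And>n A. A \<in> sets (F n) \<Longrightarrow> (LINT \<omega>|P. indicator A \<omega> * (Z \<omega> - X n \<omega>)) = 0"
begin

lemma sets_filtration: "A \<in> sets (F n) \<Longrightarrow> A \<in> sets P"
  using measurable_sets[OF filtration(1), of A n] sets.sets_into_space[of A "F n"]
  by (simp add: filtration(3) Int_absorb2)

lemma adapted_mono: "m \<le> n \<Longrightarrow> X m \<in> borel_measurable (F n)"
  using measurable_compose[OF filtration(2) adapted] by simp

text \<open>Over events of \<open>F k\<close> the integrals of \<open>X k\<close> and
  \<open>Z\<close> agree. Splitting \<open>A\<close> by the sign of \<open>X k - X n\<close> removes
  the absolute value before \<open>X k\<close> is replaced by \<open>Z\<close>.\<close>

lemma first_exceedance_bound:
  assumes A: "A \<in> sets (F k)" and k: "n \<le> k" and \<epsilon>: "\<And>\<omega>. \<omega> \<in> A \<Longrightarrow> \<epsilon> \<le> \<bar>X k \<omega> - X n \<omega>\<bar>"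
  shows "\<epsilon> * prob A \<le> (LINT \<omega>|P. indicator A \<omega> * \<bar>Z \<omega> - X n \<omega>\<bar>)"
proof -
  note [measurable] = adapted_mono[OF k] adapted[of k] A
  note [measurable (raw)] = sets_filtration[OF A]
  define U where "U = {\<omega>\<in>space (F k). \<omega> \<in> A \<and> X n \<omega> \<le> X k \<omega>}"
  define V where "V = {\<omega>\<in>space (F k). \<omega> \<in> A \<and> \<not> X n \<omega> \<le> X k \<omega>}"
  have UV: "U \<in> sets (F k)" "V \<in> sets (F k)" unfolding U_def V_def by measurable
  note UV' = this[THEN sets_filtration]
  have i [simp]: "integrable P (\<lambda>\<omega>. indicator B \<omega> * g \<omega>)" if "B \<in> sets P" "integrable P g" for B and g :: "'w \<Rightarrow> real"
    using integrable_real_mult_indicator[OF that] by (simp add: mult.commute)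
  have eq: "(LINT \<omega>|P. indicator B \<omega> * (X k \<omega> - X n \<omega>)) = (LINT \<omega>|P. indicator B \<omega> * (Z \<omega> - X n \<omega>))"
    if B: "B \<in> sets (F k)" for B
  proof -
    have "(LINT \<omega>|P. indicator B \<omega> * (Z \<omega> - X n \<omega>)) =
      (LINT \<omega>|P. indicator B \<omega> * (Z \<omega> - X k \<omega>) + indicator B \<omega> * (X k \<omega> - X n \<omega>))"
      by (intro Bochner_Integration.integral_cong) (simp_all add: algebra_simps)
    also have "\<dots> = (LINT \<omega>|P. indicator B \<omega> * (X k \<omega> - X n \<omega>))"
      by (subst Bochner_Integration.integral_add) (simp_all add: closed[OF B] sets_filtration[OF B] integrable)
    finally show ?thesis ..
  qed
  have "\<epsilon> * prob A = (LINT \<omega>|P. \<epsilon> * indicator A \<omega>)"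
    using sets_filtration[OF A] by simp
  also have "\<dots> \<le> (LINT \<omega>|P. indicator U \<omega> * (X k \<omega> - X n \<omega>) - indicator V \<omega> * (X k \<omega> - X n \<omega>))"
  proof (rule integral_mono)
    show "integrable P (\<lambda>\<omega>. \<epsilon> * indicator A \<omega> :: real)"
      using sets_filtration[OF A] by (simp add: less_top[symmetric] emeasure_eq_measure)
    show "integrable P (\<lambda>\<omega>. indicator U \<omega> * (X k \<omega> - X n \<omega>) - indicator V \<omega> * (X k \<omega> - X n \<omega>))"
      using UV' integrable by simp
    fix \<omega> assume "\<omega> \<in> space P"
    then show "\<epsilon> * indicator A \<omega> \<le> indicator U \<omega> * (X k \<omega> - X n \<omega>) - indicator V \<omega> * (X k \<omega> - X n \<omega>)"
      using \<epsilon>[of \<omega>] by (auto simp: U_def V_def filtration(3) split: split_indicator)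
  qed
  also have "\<dots> = (LINT \<omega>|P. indicator U \<omega> * (X k \<omega> - X n \<omega>)) - (LINT \<omega>|P. indicator V \<omega> * (X k \<omega> - X n \<omega>))"
    using UV' integrable by simp
  also have "\<dots> = (LINT \<omega>|P. indicator U \<omega> * (Z \<omega> - X n \<omega>) - indicator V \<omega> * (Z \<omega> - X n \<omega>))"
    unfolding eq[OF UV(1)] eq[OF UV(2)] using UV' integrable by simp
  also have "\<dots> \<le> (LINT \<omega>|P. indicator A \<omega> * \<bar>Z \<omega> - X n \<omega>\<bar>)"
  proof (rule integral_mono)
    show "integrable P (\<lambda>\<omega>. indicator U \<omega> * (Z \<omega> - X n \<omega>) - indicator V \<omega> * (Z \<omega> - X n \<omega>))"
      using UV' integrable by simp
    show "integrable P (\<lambda>\<omega>. indicator A \<omega> * \<bar>Z \<omega> - X n \<omega>\<bar>)"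
      using sets_filtration[OF A] integrable by simp
  qed (auto simp: U_def V_def split: split_indicator)
  finally show ?thesis .
qed

text \<open>Doob's inequality: the event is split by the first time of exceedance, and the bounds on
  the pieces add up in the measure whose density is the absolute value of \<open>Z - X n\<close>. In
  this form the bound vanishes once \<open>X n\<close> tends to \<open>Z\<close> in mean.\<close>

lemma maximal_inequality:
  assumes \<epsilon>: "0 < \<epsilon>"
  shows "{\<omega>\<in>space P. \<exists>k\<ge>n. \<epsilon> \<le> \<bar>X k \<omega> - X n \<omega>\<bar>} \<in> sets P"
    and "\<epsilon> * prob {\<omega>\<in>space P. \<exists>k\<ge>n. \<epsilon> \<le> \<bar>X k \<omega> - X n \<omega>\<bar>} \<le> (LINT \<omega>|P. \<bar>Z \<omega> - X n \<omega>\<bar>)"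
proof -
  have [measurable]: "X k \<in> borel_measurable P" "Z \<in> borel_measurable P" for k
    using integrable by auto
  show meas: "{\<omega>\<in>space P. \<exists>k\<ge>n. \<epsilon> \<le> \<bar>X k \<omega> - X n \<omega>\<bar>} \<in> sets P" by measurable
  define A where "A k = {\<omega>\<in>space (F (n + k)). \<epsilon> \<le> \<bar>X (n + k) \<omega> - X n \<omega>\<bar> \<and> (\<forall>j<k. \<bar>X (n + j) \<omega> - X n \<omega>\<bar> < \<epsilon>)}" for k
  have A: "A k \<in> sets (F (n + k))" for k
  proof -
    note [measurable] = adapted_mono[of n "n + k", OF le_add1] adapted[of "n + k"]
    have "{\<omega>\<in>space (F (n + k)). \<bar>X (n + j) \<omega> - X n \<omega>\<bar> < \<epsilon>} \<in> sets (F (n + k))" if "j \<in> {..<k}" for j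
    proof -
      have [measurable]: "X (n + j) \<in> borel_measurable (F (n + k))"
        using that by (intro adapted_mono) simp
      show ?thesis by measurable
    qed
    then have 2: "{\<omega>\<in>space (F (n + k)). \<forall>j\<in>{..<k}. \<bar>X (n + j) \<omega> - X n \<omega>\<bar> < \<epsilon>} \<in> sets (F (n + k))"
      by (rule sets.sets_Collect_finite_All) simp_all
    have 1: "{\<omega>\<in>space (F (n + k)). \<epsilon> \<le> \<bar>X (n + k) \<omega> - X n \<omega>\<bar>} \<in> sets (F (n + k))"
      by measurable
    have "A k = {\<omega>\<in>space (F (n + k)). \<epsilon> \<le> \<bar>X (n + k) \<omega> - X n \<omega>\<bar>} \<inter>
        {\<omega>\<in>space (F (n + k)). \<forall>j\<in>{..<k}. \<bar>X (n + j) \<omega> - X n \<omega>\<bar> < \<epsilon>}"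
      by (auto simp: A_def)
    also have "\<dots> \<in> sets (F (n + k))"
      by (rule sets.Int[OF 1 2])
    finally show ?thesis .
  qed
  note A' = sets_filtration[OF A]
  have disj: "disjoint_family A"
    unfolding disjoint_family_on_def
  proof (intro ballI impI)
    have lt: "A i \<inter> A j = {}" if "i < j" for i j
      using that unfolding A_def by (fastforce simp: not_le)
    fix i j :: nat assume "i \<noteq> j"
    then show "A i \<inter> A j = {}"
      using lt[of i j] lt[of j i] by (auto simp: neq_iff)
  qed
  have un: "{\<omega>\<in>space P. \<exists>k\<ge>n. \<epsilon> \<le> \<bar>X k \<omega> - X n \<omega>\<bar>} = (\<Union>k. A k)"
  proof (rule subset_antisym; rule subsetI)
    fix \<omega> assume "\<omega> \<in> {\<omega>\<in>space P. \<exists>k\<ge>n. \<epsilon> \<le> \<bar>X k \<omega> - X n \<omega>\<bar>}"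
    then obtain k where \<omega>: "\<omega> \<in> space P" and k: "\<epsilon> \<le> \<bar>X (n + k) \<omega> - X n \<omega>\<bar>"
      by (auto simp: le_iff_add)
    define k0 where "k0 = (LEAST k. \<epsilon> \<le> \<bar>X (n + k) \<omega> - X n \<omega>\<bar>)"
    have "\<epsilon> \<le> \<bar>X (n + k0) \<omega> - X n \<omega>\<bar>" unfolding k0_def by (rule LeastI[of _ k]) (rule k)
    moreover have "\<bar>X (n + j) \<omega> - X n \<omega>\<bar> < \<epsilon>" if "j < k0" for j
      using not_less_Least[OF that[unfolded k0_def]] by simp
    ultimately show "\<omega> \<in> (\<Union>k. A k)" using \<omega> by (auto simp: A_def filtration(3))
  qed (auto simp: A_def filtration(3) intro: le_add1)
  let ?W = "\<lambda>\<omega>. \<bar>Z \<omega> - X n \<omega>\<bar>"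
  have "ennreal \<epsilon> * emeasure P (\<Union>k. A k) = (\<Sum>k. ennreal \<epsilon> * emeasure P (A k))"
    using A' disj by (subst suminf_emeasure[symmetric]) (auto intro: ennreal_suminf_cmult[symmetric])
  also have "\<dots> \<le> (\<Sum>k. emeasure (density P (\<lambda>\<omega>. ennreal (?W \<omega>))) (A k))"
  proof (rule suminf_le)
    fix k
    have "ennreal \<epsilon> * emeasure P (A k) = ennreal (\<epsilon> * prob (A k))"
      using \<epsilon> by (simp add: emeasure_eq_measure ennreal_mult)
    also have "\<dots> \<le> ennreal (LINT \<omega>|P. indicator (A k) \<omega> * ?W \<omega>)"
      by (intro ennreal_leI first_exceedance_bound[OF A]) (auto simp: A_def)
    also have "\<dots> = (\<integral>\<^sup>+\<omega>. ennreal (indicator (A k) \<omega> * ?W \<omega>) \<partial>P)"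
    proof (rule nn_integral_eq_integral[symmetric])
      show "integrable P (\<lambda>\<omega>. indicator (A k) \<omega> * ?W \<omega>)"
        using integrable_real_mult_indicator[OF A', of ?W] integrable by (simp add: mult.commute)
    qed simp
    also have "\<dots> = emeasure (density P (\<lambda>\<omega>. ennreal (?W \<omega>))) (A k)"
      by (subst emeasure_density) (auto simp: A' intro!: nn_integral_cong split: split_indicator)
    finally show "ennreal \<epsilon> * emeasure P (A k) \<le> emeasure (density P (\<lambda>\<omega>. ennreal (?W \<omega>))) (A k)" .
  qed auto
  also have "\<dots> = emeasure (density P (\<lambda>\<omega>. ennreal (?W \<omega>))) (\<Union>k. A k)"
    using A' disj by (intro suminf_emeasure) auto
  also have "\<dots> \<le> emeasure (density P (\<lambda>\<omega>. ennreal (?W \<omega>))) (space (density P (\<lambda>\<omega>. ennreal (?W \<omega>))))"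
    by (rule emeasure_space)
  also have "\<dots> = (\<integral>\<^sup>+\<omega>. ennreal (?W \<omega>) \<partial>P)"
    by (subst emeasure_density) (auto intro!: nn_integral_cong)
  also have "\<dots> = ennreal (LINT \<omega>|P. ?W \<omega>)"
    by (rule nn_integral_eq_integral) (use integrable in auto)
  finally have "ennreal (\<epsilon> * prob (\<Union>k. A k)) \<le> ennreal (LINT \<omega>|P. ?W \<omega>)"
    using \<epsilon> by (simp add: emeasure_eq_measure ennreal_mult)
  then show "\<epsilon> * prob {\<omega>\<in>space P. \<exists>k\<ge>n. \<epsilon> \<le> \<bar>X k \<omega> - X n \<omega>\<bar>} \<le> (LINT \<omega>|P. ?W \<omega>)"
    unfolding un by (subst (asm) ennreal_le_iff) simp_all
qed

text \<open>If \<open>X k\<close> is \<open>2 * \<epsilon>\<close> away from \<open>Z\<close> for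
  some \<open>k \<ge> n\<close>, then it has moved by \<epsilon> since time \<open>n\<close>, or
  \<open>X n\<close> was already \<epsilon> away from \<open>Z\<close>. The maximal inequality
  bounds the first event and Markov's inequality the second.\<close>

theorem AE_convergent:
  assumes L1: "(\<lambda>n. LINT \<omega>|P. \<bar>Z \<omega> - X n \<omega>\<bar>) \<longlonglongrightarrow> 0"
  shows "AE \<omega> in P. (\<lambda>n. X n \<omega>) \<longlonglongrightarrow> Z \<omega>"
proof -
  have [measurable]: "X k \<in> borel_measurable P" "Z \<in> borel_measurable P" for k
    using integrable by auto
  have "AE \<omega> in P. \<exists>n. \<forall>k\<ge>n. \<bar>X k \<omega> - Z \<omega>\<bar> < 2 * \<epsilon>" if \<epsilon>: "0 < \<epsilon>" for \<epsilon> :: real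
  proof -
    define B where "B = {\<omega>\<in>space P. \<forall>n. \<exists>k\<ge>n. 2 * \<epsilon> \<le> \<bar>X k \<omega> - Z \<omega>\<bar>}"
    have B: "B \<in> sets P" unfolding B_def by measurable
    have "prob B \<le> 2 / \<epsilon> * (LINT \<omega>|P. \<bar>Z \<omega> - X n \<omega>\<bar>)" for n
    proof -
      let ?C = "{\<omega>\<in>space P. \<exists>k\<ge>n. \<epsilon> \<le> \<bar>X k \<omega> - X n \<omega>\<bar>}" and ?D = "{\<omega>\<in>space P. \<epsilon> \<le> \<bar>Z \<omega> - X n \<omega>\<bar>}"
      have "B \<subseteq> ?C \<union> ?D"
      proof
        fix \<omega> assume "\<omega> \<in> B"
        then obtain k where "\<omega> \<in> space P" "k \<ge> n" "2 * \<epsilon> \<le> \<bar>X k \<omega> - Z \<omega>\<bar>" by (auto simp: B_def)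
        moreover from this(3) have "\<epsilon> \<le> \<bar>X k \<omega> - X n \<omega>\<bar> \<or> \<epsilon> \<le> \<bar>Z \<omega> - X n \<omega>\<bar>" by linarith
        ultimately show "\<omega> \<in> ?C \<union> ?D" by auto
      qed
      then have "prob B \<le> prob (?C \<union> ?D)"
        by (intro finite_measure_mono) measurable
      also have "\<dots> \<le> prob ?C + prob ?D"
        by (intro measure_subadditive) (auto simp: emeasure_eq_measure)
      also have "prob ?D \<le> (LINT \<omega>|P. \<bar>Z \<omega> - X n \<omega>\<bar>) / \<epsilon>"
        by (rule integral_Markov_inequality_measure[where A = "space P", simplified]) (use integrable \<epsilon> in auto)
      also have "prob ?C \<le> (LINT \<omega>|P. \<bar>Z \<omega> - X n \<omega>\<bar>) / \<epsilon>"
        using maximal_inequality(2)[OF \<epsilon>, of n] \<epsilon> by (simp add: field_simps)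
      finally show ?thesis by (simp add: field_simps)
    qed
    moreover have "(\<lambda>n. 2 / \<epsilon> * (LINT \<omega>|P. \<bar>Z \<omega> - X n \<omega>\<bar>)) \<longlonglongrightarrow> 2 / \<epsilon> * 0"
      by (intro tendsto_intros L1)
    ultimately have "prob B \<le> 2 / \<epsilon> * 0"
      by (intro LIMSEQ_le_const) auto
    then have "prob B = 0" by (simp add: measure_le_0_iff)
    then have "AE \<omega> in P. \<omega> \<notin> B"
      using B by (intro AE_not_in) (simp add: null_sets_def emeasure_eq_measure)
    then show ?thesis
    proof (rule AE_mp, intro AE_I2 impI)
      fix \<omega> assume "\<omega> \<in> space P" "\<omega> \<notin> B"
      then show "\<exists>n. \<forall>k\<ge>n. \<bar>X k \<omega> - Z \<omega>\<bar> < 2 * \<epsilon>" unfolding B_def by (simp add: not_le) (meson not_le)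
    qed
  qed
  note eps = this
  have "AE \<omega> in P. \<forall>i. \<exists>n. \<forall>k\<ge>n. \<bar>X k \<omega> - Z \<omega>\<bar> < 2 * (1 / real (Suc i))"
    unfolding AE_all_countable by (intro allI eps) simp
  then show ?thesis
  proof (rule AE_mp, intro AE_I2 impI)
    fix \<omega> assume *: "\<forall>i. \<exists>n. \<forall>k\<ge>n. \<bar>X k \<omega> - Z \<omega>\<bar> < 2 * (1 / real (Suc i))"
    show "(\<lambda>n. X n \<omega>) \<longlonglongrightarrow> Z \<omega>"
    proof (rule LIMSEQ_I)
      fix r :: real assume "0 < r"
      then obtain i where "1 / real (Suc i) < r / 2" using nat_approx_posE[of "r / 2"] by auto
      then show "\<exists>n0. \<forall>n\<ge>n0. norm (X n \<omega> - Z \<omega>) < r"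
        using spec[OF *, of i] by (metis mult.commute mult_imp_div_pos_less nless_le order.strict_trans pos_less_divide_eq real_norm_def zero_less_numeral)
    qed
  qed
qed

end


section \<open>Posterior moments under adaptive sampling\<close>

locale gp_sampling = adaptive_sampling P D N0 f l e d y
  for P :: "'w measure" and D :: "'i measure" and N0 f l e d y +
  fixes m :: "'i \<Rightarrow> real" and K :: "'i \<Rightarrow> 'i \<Rightarrow> real"
  assumes prior_gp: "gp_weight P (\<lambda>_. 1) (space D) f m K"
    and psd: "psd_on (space D) K"
    and mean_measurable: "m \<in> borel_measurable D"
    and kernel_measurable: "case_prod K \<in> borel_measurable (D \<Otimes>\<^sub>M D)"
begin

definition post_m :: "nat \<Rightarrow> 'w \<Rightarrow> 'i \<Rightarrow> real" where
  "post_m n \<omega> = kmean m K l (\<lambda>j. d j \<omega>) (\<lambda>j. y (Suc j) \<omega>) n"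

definition post_k :: "nat \<Rightarrow> 'w \<Rightarrow> 'i \<Rightarrow> 'i \<Rightarrow> real" where
  "post_k n \<omega> = kcov K l (\<lambda>j. d j \<omega>) n"

lemma psd_on_post_k: "\<omega> \<in> space P \<Longrightarrow> psd_on (space D) (post_k n \<omega>)"
  unfolding post_k_def by (rule psd_on_kcov[OF psd]) (simp_all add: design_space noise_var)

lemma post_k_diag_nonneg: "\<omega> \<in> space P \<Longrightarrow> p \<in> space D \<Longrightarrow> 0 \<le> post_k n \<omega> p p"
  by (rule psd_on_diag[OF psd_on_post_k])

lemma post_k_diag_le: "\<omega> \<in> space P \<Longrightarrow> p \<in> space D \<Longrightarrow> post_k n \<omega> p p \<le> K p p"
  unfolding post_k_def by (rule kcov_diag_le[OF psd]) (simp_all add: design_space noise_var)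

text \<open>For a frozen history the designs are constants, so each factor of the likelihood is one
  application of \<open>gp_weight_observe\<close>.\<close>

lemma likelihood_gp_weight:
  assumes \<omega>': "\<omega>' \<in> space P"
  shows "gp_weight P (\<lambda>\<omega>. likelihood n \<omega> \<omega>') (space D) f (post_m n \<omega>') (post_k n \<omega>')"
proof (induction n)
  case 0
  show ?case using prior_gp by (simp add: likelihood_def post_m_def post_k_def)
next
  case (Suc n)
  from gp_weight_observe[OF sigma_finite_measure_axioms Suc psd_on_post_k[OF \<omega>'] design_space[OF \<omega>', of n] noise_var_pos[OF \<omega>', of n]]
  show ?case by (simp add: likelihood_def obs_density_def post_m_def post_k_def)
qed

text \<open>The points \<open>p\<close> and \<open>q\<close> may be random, because the recursion
  evaluates the kernel at the random design \<open>d n\<close>.\<close>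

lemma post_k_measurable:
  assumes h: "h \<in> N \<rightarrow>\<^sub>M obs n" and p: "p \<in> N \<rightarrow>\<^sub>M D" "q \<in> N \<rightarrow>\<^sub>M D"
  shows "(\<lambda>x. post_k n (h x) (p x) (q x)) \<in> borel_measurable N"
  using h p
proof (induction n arbitrary: p q)
  case 0
  then show ?case
    using measurable_compose[OF measurable_Pair[of p N D q D] kernel_measurable] by (simp add: post_k_def)
next
  case (Suc n)
  have h: "h \<in> N \<rightarrow>\<^sub>M obs n"
    using measurable_compose[OF Suc.prems(1) obs_algebra_mono[of n "Suc n"]] by simp
  have d: "(\<lambda>x. d n (h x)) \<in> N \<rightarrow>\<^sub>M D" using measurable_compose[OF h design_adapted] .
  note [measurable] = Suc.IH[OF h Suc.prems(2,3)] Suc.IH[OF h Suc.prems(2) d] Suc.IH[OF h d Suc.prems(3)] Suc.IH[OF h d d]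
    measurable_compose[OF d noise_var(1)]
  show ?case
    unfolding post_k_def kcov.simps kalman_cov_def unfolding post_k_def[symmetric] by measurable
qed

lemma post_m_measurable:
  assumes h: "h \<in> N \<rightarrow>\<^sub>M obs n" and p: "p \<in> N \<rightarrow>\<^sub>M D"
  shows "(\<lambda>x. post_m n (h x) (p x)) \<in> borel_measurable N"
  using h p
proof (induction n arbitrary: p)
  case 0
  then show ?case
    using measurable_compose[OF _ mean_measurable, of p N] by (simp add: post_m_def)
next
  case (Suc n)
  have h: "h \<in> N \<rightarrow>\<^sub>M obs n"
    using measurable_compose[OF Suc.prems(1) obs_algebra_mono[of n "Suc n"]] by simp
  have d: "(\<lambda>x. d n (h x)) \<in> N \<rightarrow>\<^sub>M D" using measurable_compose[OF h design_adapted] .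
  note [measurable] = Suc.IH[OF h Suc.prems(2)] Suc.IH[OF h d] post_k_measurable[OF h Suc.prems(2) d]
    post_k_measurable[OF h d d] measurable_compose[OF d noise_var(1)]
    measurable_compose[OF Suc.prems(1) measurable_observation[OF order_refl]]
  show ?case
    unfolding post_m_def kmean.simps kalman_mean_def unfolding post_k_def[symmetric] post_m_def[symmetric]
    by measurable
qed

lemma field_in_prior:
  assumes "p \<in> space D" shows "f p \<in> borel_measurable N0"
  using field_compose[of "\<lambda>_. p" N0 "\<lambda>\<omega>. \<omega>"] assms by simp

lemma field_borel_measurable:
  assumes "p \<in> space D" shows "f p \<in> borel_measurable P"
  using measurable_compose[OF prior_measurable field_in_prior[OF assms]] by simp

lemma likelihood_integral_pos:
  assumes \<omega>': "\<omega>' \<in> space P"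
  shows "0 < (LINT \<omega>|P. likelihood n \<omega> \<omega>')" and
    "(\<integral>\<^sup>+\<omega>. likelihood n \<omega> \<omega>' \<partial>P) = ennreal (LINT \<omega>|P. likelihood n \<omega> \<omega>')"
proof -
  have int: "integrable P (\<lambda>\<omega>. likelihood n \<omega> \<omega>')"
    using likelihood_gp_weight[OF \<omega>'] by (simp add: gp_weight_def)
  show e: "(\<integral>\<^sup>+\<omega>. likelihood n \<omega> \<omega>' \<partial>P) = ennreal (LINT \<omega>|P. likelihood n \<omega> \<omega>')"
    by (rule nn_integral_eq_integral[OF int]) (simp add: less_imp_le likelihood_pos \<omega>')
  have "0 < (\<integral>\<^sup>+\<omega>. likelihood n \<omega> \<omega>' \<partial>P)"
    by (rule nn_integral_positive_bounded(1)[OF _ likelihood_pos[OF \<omega>'] likelihood_bounded[OF \<omega>']])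
      (use int in auto)
  then show "0 < (LINT \<omega>|P. likelihood n \<omega> \<omega>')" unfolding e by simp
qed

lemma likelihood_moments:
  assumes \<omega>': "\<omega>' \<in> space P" and p: "p \<in> space D"
  shows "integrable P (\<lambda>\<omega>. likelihood n \<omega> \<omega>' * (f p \<omega> - post_m n \<omega>' p))"
    and "(LINT \<omega>|P. likelihood n \<omega> \<omega>' * (f p \<omega> - post_m n \<omega>' p)) = 0"
    and "integrable P (\<lambda>\<omega>. likelihood n \<omega> \<omega>' * (f p \<omega> - post_m n \<omega>' p)\<^sup>2)"
    and "(LINT \<omega>|P. likelihood n \<omega> \<omega>' * (f p \<omega> - post_m n \<omega>' p)\<^sup>2) = (LINT \<omega>|P. likelihood n \<omega> \<omega>') * post_k n \<omega>' p p"
  using gp_weight_moments[OF likelihood_gp_weight[OF \<omega>'] psd_on_post_k[OF \<omega>'] p less_imp_le[OF likelihood_pos[OF \<omega>']] likelihood_integral_pos(1)[OF \<omega>']]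
  by auto

text \<open>With the history frozen, the quotient in \<open>Bayes\<close> is the second moment about
  the mean of the normalised Gaussian weight, that is, its variance.\<close>

lemma post_error_second_moment:
  assumes p: "p \<in> space D"
  shows "(\<integral>\<^sup>+\<omega>. ennreal ((f p \<omega> - post_m n \<omega> p)\<^sup>2) \<partial>P) = (\<integral>\<^sup>+\<omega>. ennreal (post_k n \<omega> p p) \<partial>P)"
proof -
  have "(\<lambda>x. ennreal ((f p (fst x) - post_m n (snd x) p)\<^sup>2)) \<in> borel_measurable (N0 \<Otimes>\<^sub>M obs n)"
    using post_m_measurable[OF measurable_snd, of "\<lambda>_. p" N0 n] p measurable_compose[OF measurable_fst field_in_prior[OF p], of "obs n"]
    by measurable
  from Bayes[OF this]
  have "(\<integral>\<^sup>+\<omega>. ennreal ((f p \<omega> - post_m n \<omega> p)\<^sup>2) \<partial>P) = (\<integral>\<^sup>+\<omega>'. (\<integral>\<^sup>+\<omega>. ennreal (likelihood n \<omega> \<omega>') * ennreal ((f p \<omega> - post_m n \<omega>' p)\<^sup>2) \<partial>P)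
      / (\<integral>\<^sup>+\<omega>. ennreal (likelihood n \<omega> \<omega>') \<partial>P) \<partial>P)" by simp
  also have "\<dots> = (\<integral>\<^sup>+\<omega>. ennreal (post_k n \<omega> p p) \<partial>P)"
  proof (rule nn_integral_cong)
    fix \<omega>' assume \<omega>': "\<omega>' \<in> space P"
    let ?L = "LINT \<omega>|P. likelihood n \<omega> \<omega>'"
    have "(\<integral>\<^sup>+\<omega>. ennreal (likelihood n \<omega> \<omega>') * ennreal ((f p \<omega> - post_m n \<omega>' p)\<^sup>2) \<partial>P)
      = (\<integral>\<^sup>+\<omega>. ennreal (likelihood n \<omega> \<omega>' * (f p \<omega> - post_m n \<omega>' p)\<^sup>2) \<partial>P)"
      by (intro nn_integral_cong) (simp add: ennreal_mult less_imp_le[OF likelihood_pos[OF \<omega>']])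
    also have "\<dots> = ennreal (?L * post_k n \<omega>' p p)"
      unfolding likelihood_moments(4)[OF \<omega>' p, symmetric]
      by (rule nn_integral_eq_integral[OF likelihood_moments(3)[OF \<omega>' p]])
        (simp add: less_imp_le[OF likelihood_pos[OF \<omega>']])
    finally show "(\<integral>\<^sup>+\<omega>. ennreal (likelihood n \<omega> \<omega>') * ennreal ((f p \<omega> - post_m n \<omega>' p)\<^sup>2) \<partial>P)
      / (\<integral>\<^sup>+\<omega>. ennreal (likelihood n \<omega> \<omega>') \<partial>P) = ennreal (post_k n \<omega>' p p)"
      using likelihood_integral_pos[OF \<omega>', of n] post_k_diag_nonneg[OF \<omega>' p, of n]
      by (simp add: divide_ennreal)
  qed
  finally show ?thesis .
qed

lemma post_m_borel_measurable: "p \<in> space D \<Longrightarrow> (\<lambda>\<omega>. post_m n \<omega> p) \<in> borel_measurable P"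
  by (rule post_m_measurable[OF measurable_obs]) simp

lemma post_k_borel_measurable: "p \<in> space D \<Longrightarrow> q \<in> space D \<Longrightarrow> (\<lambda>\<omega>. post_k n \<omega> p q) \<in> borel_measurable P"
  by (rule post_k_measurable[OF measurable_obs]) simp_all

lemma post_error_square_integrable:
  assumes p: "p \<in> space D"
  shows "integrable P (\<lambda>\<omega>. (f p \<omega> - post_m n \<omega> p)\<^sup>2)" "integrable P (\<lambda>\<omega>. f p \<omega> - post_m n \<omega> p)"
    "integrable P (\<lambda>\<omega>. post_k n \<omega> p p)"
    "(LINT \<omega>|P. (f p \<omega> - post_m n \<omega> p)\<^sup>2) = (LINT \<omega>|P. post_k n \<omega> p p)"
proof -
  note [measurable] = field_borel_measurable[OF p] post_m_borel_measurable[OF p, of n] post_k_borel_measurable[OF p p, of n]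
  show k: "integrable P (\<lambda>\<omega>. post_k n \<omega> p p)"
    by (rule integrable_const_bound[where B = "K p p"])
      (use post_k_diag_nonneg post_k_diag_le p in \<open>auto intro!: AE_I2\<close>)
  have "(\<integral>\<^sup>+\<omega>. ennreal (post_k n \<omega> p p) \<partial>P) = ennreal (LINT \<omega>|P. post_k n \<omega> p p)"
    by (rule nn_integral_eq_integral[OF k]) (use post_k_diag_nonneg p in \<open>auto intro!: AE_I2\<close>)
  then have e: "(\<integral>\<^sup>+\<omega>. ennreal ((f p \<omega> - post_m n \<omega> p)\<^sup>2) \<partial>P) = ennreal (LINT \<omega>|P. post_k n \<omega> p p)"
    unfolding post_error_second_moment[OF p] .
  show i: "integrable P (\<lambda>\<omega>. (f p \<omega> - post_m n \<omega> p)\<^sup>2)"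
    by (rule integrableI_nonneg) (auto simp: e)
  show "integrable P (\<lambda>\<omega>. f p \<omega> - post_m n \<omega> p)"
    by (rule square_integrable_imp_integrable[OF _ i]) measurable
  have nn: "0 \<le> (LINT \<omega>|P. post_k n \<omega> p p)"
    by (rule integral_nonneg_AE) (use post_k_diag_nonneg p in \<open>auto intro!: AE_I2\<close>)
  show "(LINT \<omega>|P. (f p \<omega> - post_m n \<omega> p)\<^sup>2) = (LINT \<omega>|P. post_k n \<omega> p p)"
    by (subst integral_eq_nn_integral) (auto simp: e nn)
qed

text \<open>\<open>Bayes\<close> speaks of nonnegative functions; centred errors are therefore
  treated by comparing their positive and negative parts.\<close>

lemma nn_integral_pos_neg_eq:
  fixes h :: "'w \<Rightarrow> real"
  assumes "integrable P h" "(LINT \<omega>|P. h \<omega>) = 0"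
  shows "(\<integral>\<^sup>+\<omega>. ennreal (h \<omega>) \<partial>P) = (\<integral>\<^sup>+\<omega>. ennreal (- h \<omega>) \<partial>P)"
proof -
  have fin: "(\<integral>\<^sup>+\<omega>. ennreal (h \<omega>) \<partial>P) \<noteq> \<infinity>" "(\<integral>\<^sup>+\<omega>. ennreal (- h \<omega>) \<partial>P) \<noteq> \<infinity>"
    using assms(1) by (simp_all add: real_integrable_def)
  have "enn2real (\<integral>\<^sup>+\<omega>. ennreal (h \<omega>) \<partial>P) = enn2real (\<integral>\<^sup>+\<omega>. ennreal (- h \<omega>) \<partial>P)"
    using assms by (simp add: real_lebesgue_integral_def)
  then show ?thesis using fin
    by (metis ennreal_enn2real infinity_ennreal_def less_top)
qed

lemma post_error_orthogonal:
  assumes p: "p \<in> space D" and A: "A \<in> sets (obs n)"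
  shows "(LINT \<omega>|P. indicator A \<omega> * (f p \<omega> - post_m n \<omega> p)) = 0"
proof -
  let ?W = "\<lambda>\<omega> \<omega>'. f p \<omega> - post_m n \<omega>' p"
  have mW: "(\<lambda>x. ?W (fst x) (snd x)) \<in> borel_measurable (N0 \<Otimes>\<^sub>M obs n)"
    using post_m_measurable[OF measurable_snd, of "\<lambda>_. p" N0 n] p measurable_compose[OF measurable_fst field_in_prior[OF p], of "obs n"]
    by measurable
  have mA: "(\<lambda>x. indicator A (snd x) :: ennreal) \<in> borel_measurable (N0 \<Otimes>\<^sub>M obs n)"
    using A by measurable
  have B: "(\<integral>\<^sup>+\<omega>. ennreal (s * ?W \<omega> \<omega>) * indicator A \<omega> \<partial>P) =
    (\<integral>\<^sup>+\<omega>'. (\<integral>\<^sup>+\<omega>. ennreal (s * (likelihood n \<omega> \<omega>' * ?W \<omega> \<omega>')) \<partial>P) * indicator A \<omega>'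
      / (\<integral>\<^sup>+\<omega>. ennreal (likelihood n \<omega> \<omega>') \<partial>P) \<partial>P)" for s
  proof -
    have "(\<lambda>x. ennreal (s * ?W (fst x) (snd x)) * indicator A (snd x)) \<in> borel_measurable (N0 \<Otimes>\<^sub>M obs n)"
      using mW mA by measurable
    from Bayes[OF this]
    have "(\<integral>\<^sup>+\<omega>. ennreal (s * ?W \<omega> \<omega>) * indicator A \<omega> \<partial>P) =
      (\<integral>\<^sup>+\<omega>'. (\<integral>\<^sup>+\<omega>. ennreal (likelihood n \<omega> \<omega>') * (ennreal (s * ?W \<omega> \<omega>') * indicator A \<omega>') \<partial>P)
        / (\<integral>\<^sup>+\<omega>. ennreal (likelihood n \<omega> \<omega>') \<partial>P) \<partial>P)" by simp
    also have "\<dots> = (\<integral>\<^sup>+\<omega>'. (\<integral>\<^sup>+\<omega>. ennreal (s * (likelihood n \<omega> \<omega>' * ?W \<omega> \<omega>')) \<partial>P) * indicator A \<omega>'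
      / (\<integral>\<^sup>+\<omega>. ennreal (likelihood n \<omega> \<omega>') \<partial>P) \<partial>P)"
    proof (intro nn_integral_cong arg_cong2[of _ _ _ _ "(/)"] refl)
      fix \<omega>' assume \<omega>': "\<omega>' \<in> space P"
      have "(\<integral>\<^sup>+\<omega>. ennreal (likelihood n \<omega> \<omega>') * (ennreal (s * ?W \<omega> \<omega>') * indicator A \<omega>') \<partial>P)
        = (\<integral>\<^sup>+\<omega>. ennreal (s * (likelihood n \<omega> \<omega>' * ?W \<omega> \<omega>')) * indicator A \<omega>' \<partial>P)"
        by (intro nn_integral_cong, simp only: mult.left_commute[of s]
            ennreal_mult'[OF less_imp_le[OF likelihood_pos[OF \<omega>']]] mult.assoc)
      also have "\<dots> = (\<integral>\<^sup>+\<omega>. ennreal (s * (likelihood n \<omega> \<omega>' * ?W \<omega> \<omega>')) \<partial>P) * indicator A \<omega>'"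
        by (rule nn_integral_multc) (use borel_measurable_integrable[OF likelihood_moments(1)[OF \<omega>' p]] in measurable)
      finally show "(\<integral>\<^sup>+\<omega>. ennreal (likelihood n \<omega> \<omega>') * (ennreal (s * ?W \<omega> \<omega>') * indicator A \<omega>') \<partial>P)
        = (\<integral>\<^sup>+\<omega>. ennreal (s * (likelihood n \<omega> \<omega>' * ?W \<omega> \<omega>')) \<partial>P) * indicator A \<omega>'" .
    qed
    finally show ?thesis .
  qed
  have "(\<integral>\<^sup>+\<omega>. ennreal (?W \<omega> \<omega>) * indicator A \<omega> \<partial>P) = (\<integral>\<^sup>+\<omega>. ennreal (- ?W \<omega> \<omega>) * indicator A \<omega> \<partial>P)"
  proof -
    have "(\<integral>\<^sup>+\<omega>. ennreal (1 * ?W \<omega> \<omega>) * indicator A \<omega> \<partial>P) = (\<integral>\<^sup>+\<omega>. ennreal (-1 * ?W \<omega> \<omega>) * indicator A \<omega> \<partial>P)"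
      unfolding B using nn_integral_pos_neg_eq[OF likelihood_moments(1,2)[OF _ p]]
      by (intro nn_integral_cong) simp
    then show ?thesis by simp
  qed
  moreover have "ennreal (s * ?W \<omega> \<omega>) * indicator A \<omega> = ennreal (s * (indicator A \<omega> * ?W \<omega> \<omega>))" for s \<omega>
    by (simp split: split_indicator)
  from this[of 1] this[of "-1"] have "ennreal (?W \<omega> \<omega>) * indicator A \<omega> = ennreal (indicator A \<omega> * ?W \<omega> \<omega>)"
    "ennreal (- ?W \<omega> \<omega>) * indicator A \<omega> = ennreal (- (indicator A \<omega> * ?W \<omega> \<omega>))" for \<omega> by simp_all
  ultimately have "(\<integral>\<^sup>+\<omega>. ennreal (indicator A \<omega> * ?W \<omega> \<omega>) \<partial>P) = (\<integral>\<^sup>+\<omega>. ennreal (- (indicator A \<omega> * ?W \<omega> \<omega>)) \<partial>P)"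
    by simp
  moreover have "integrable P (\<lambda>\<omega>. indicator A \<omega> * ?W \<omega> \<omega>)"
  proof -
    have "A \<in> sets P" using measurable_sets[OF measurable_obs A] sets.sets_into_space[OF A] by (simp add: Int_absorb2)
    from integrable_real_mult_indicator[OF this post_error_square_integrable(2)[OF p]]
    show ?thesis by (simp add: mult.commute)
  qed
  ultimately show ?thesis by (simp add: real_lebesgue_integral_def)
qed

lemma prior_field_integrable:
  assumes p: "p \<in> space D" shows "integrable P (f p)"
  using Bochner_Integration.integrable_add[OF post_error_square_integrable(2)[OF p, of 0] integrable_const[of "m p"]]
  by (simp add: post_m_def)

lemma posterior_martingale:
  assumes p: "p \<in> space D"
  shows "closed_martingale P obs (f p) (\<lambda>n \<omega>. post_m n \<omega> p)"
proof
  show "(\<lambda>\<omega>. \<omega>) \<in> P \<rightarrow>\<^sub>M obs n" for n by (rule measurable_obs)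
  show "(\<lambda>\<omega>. \<omega>) \<in> obs n \<rightarrow>\<^sub>M obs k" if "k \<le> n" for k n by (rule obs_algebra_mono[OF that])
  show "(\<lambda>\<omega>. post_m n \<omega> p) \<in> borel_measurable (obs n)" for n
    by (rule post_m_measurable[OF measurable_ident_sets[OF refl]]) (use p in simp)
  show "integrable P (f p)" by (rule prior_field_integrable[OF p])
  then show "integrable P (\<lambda>\<omega>. post_m n \<omega> p)" for n
    using Bochner_Integration.integrable_diff[OF _ post_error_square_integrable(2)[OF p, of n], of "f p"] by simp
qed (simp_all add: post_error_orthogonal p)

lemma post_error_L1_le:
  assumes p: "p \<in> space D"
  shows "(LINT \<omega>|P. \<bar>f p \<omega> - post_m n \<omega> p\<bar>) \<le> sqrt (LINT \<omega>|P. post_k n \<omega> p p)"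
proof -
  \<comment> \<open>Nonnegativity of the variance of the absolute error.\<close>
  have "(LINT \<omega>|P. \<bar>f p \<omega> - post_m n \<omega> p\<bar>)\<^sup>2 \<le> (LINT \<omega>|P. \<bar>f p \<omega> - post_m n \<omega> p\<bar>\<^sup>2)"
    using variance_eq[of "\<lambda>\<omega>. \<bar>f p \<omega> - post_m n \<omega> p\<bar>"] variance_positive[of "\<lambda>\<omega>. \<bar>f p \<omega> - post_m n \<omega> p\<bar>"]
      post_error_square_integrable[OF p] by simp
  also have "\<dots> = (LINT \<omega>|P. post_k n \<omega> p p)" using post_error_square_integrable(4)[OF p] by simp
  finally show ?thesis by (rule real_le_rsqrt)
qed

theorem posterior_mean_consistent:
  assumes p: "p \<in> space D" and k: "AE \<omega> in P. (\<lambda>n. post_k n \<omega> p p) \<longlonglongrightarrow> 0"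
  shows "AE \<omega> in P. (\<lambda>n. post_m n \<omega> p) \<longlonglongrightarrow> f p \<omega>"
proof -
  interpret M: closed_martingale P obs "f p" "\<lambda>n \<omega>. post_m n \<omega> p" by (rule posterior_martingale[OF p])
  have "(\<lambda>n. LINT \<omega>|P. post_k n \<omega> p p) \<longlonglongrightarrow> (LINT \<omega>|P. 0)"
    by (rule integral_dominated_convergence[where w = "\<lambda>_. K p p"])
      (use k p post_k_diag_nonneg post_k_diag_le post_k_borel_measurable in \<open>auto intro!: AE_I2\<close>)
  then have "(\<lambda>n. sqrt (LINT \<omega>|P. post_k n \<omega> p p)) \<longlonglongrightarrow> 0"
    using tendsto_real_sqrt by fastforce
  then have "(\<lambda>n. LINT \<omega>|P. \<bar>f p \<omega> - post_m n \<omega> p\<bar>) \<longlonglongrightarrow> 0"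
    by (rule tendsto_sandwich[OF _ _ tendsto_const, rotated 2]) (auto simp: post_error_L1_le p)
  then show ?thesis by (rule M.AE_convergent)
qed

text \<open>Through \<open>f p\<close>, the posterior mean differs from the prior mean by the error
  at time 0 and the error at time \<open>n\<close>, each at most \<open>sqrt (K p p)\<close> in
  mean. The bound is uniform in \<open>n\<close>.\<close>

lemma post_m_L1_bound:
  assumes p: "p \<in> space D"
  shows "integrable P (\<lambda>\<omega>. post_m n \<omega> p)" "(LINT \<omega>|P. \<bar>post_m n \<omega> p\<bar>) \<le> \<bar>m p\<bar> + 2 * sqrt (K p p)"
proof -
  interpret M: closed_martingale P obs "f p" "\<lambda>n \<omega>. post_m n \<omega> p" by (rule posterior_martingale[OF p])
  show i: "integrable P (\<lambda>\<omega>. post_m n \<omega> p)" by (rule M.integrable)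
  have k: "(LINT \<omega>|P. post_k n \<omega> p p) \<le> K p p" for n
    using integral_mono[OF post_error_square_integrable(3)[OF p, of n] integrable_const[of "K p p"]] post_k_diag_le[OF _ p]
    by (simp add: prob_space)
  have e: "(LINT \<omega>|P. \<bar>f p \<omega> - post_m n \<omega> p\<bar>) \<le> sqrt (K p p)" for n
    using post_error_L1_le[OF p, of n] real_sqrt_le_mono[OF k[of n]] by linarith
  have "(LINT \<omega>|P. \<bar>post_m n \<omega> p\<bar>) \<le> (LINT \<omega>|P. \<bar>m p\<bar> + \<bar>f p \<omega> - post_m 0 \<omega> p\<bar> + \<bar>f p \<omega> - post_m n \<omega> p\<bar>)"
    by (intro integral_mono Bochner_Integration.integrable_add integrable_abs integrable_const i post_error_square_integrable(2)[OF p])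
      (simp add: post_m_def)
  also have "\<dots> = \<bar>m p\<bar> + (LINT \<omega>|P. \<bar>f p \<omega> - post_m 0 \<omega> p\<bar>) + (LINT \<omega>|P. \<bar>f p \<omega> - post_m n \<omega> p\<bar>)"
    using post_error_square_integrable(2)[OF p] by (simp add: prob_space)
  also have "\<dots> \<le> \<bar>m p\<bar> + 2 * sqrt (K p p)" using e[of 0] e[of n] by simp
  finally show "(LINT \<omega>|P. \<bar>post_m n \<omega> p\<bar>) \<le> \<bar>m p\<bar> + 2 * sqrt (K p p)" .
qed

end


section \<open>The covariate model as a Gaussian process over arms and locations\<close>

locale compact_covariate_sampling = covariate_sampling P M X \<mu>0 k0 lam \<theta> e a v y
  for P :: "'w measure" and M :: nat and X :: "'x::euclidean_space set"
    and \<mu>0 k0 lam \<theta> e a v y +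
  assumes compact_X: "compact X"
    and kernel_sym: "\<And>i x x'. i \<in> {1..M} \<Longrightarrow> x \<in> X \<Longrightarrow> x' \<in> X \<Longrightarrow> k0 i x x' = k0 i x' x"
    and kernel_continuous: "\<And>i. i \<in> {1..M} \<Longrightarrow> continuous_on (X \<times> X) (\<lambda>(x, x'). k0 i x x')"
    and mean_continuous: "\<And>i. i \<in> {1..M} \<Longrightarrow> continuous_on X (\<mu>0 i)"
    and noise_continuous: "\<And>i. i \<in> {1..M} \<Longrightarrow> continuous_on X (lam i)"
    and noise_pos: "\<And>i x. i \<in> {1..M} \<Longrightarrow> x \<in> X \<Longrightarrow> 0 < lam i x"
begin

abbreviation "XB \<equiv> restrict_space borel X"

abbreviation "arm_space \<equiv> count_space {1..M} \<Otimes>\<^sub>M XB"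

abbreviation "prior_algebra \<equiv> vimage_algebra (space P)
  (\<lambda>\<omega>. \<lambda>(i, x)\<in>{1..M} \<times> X. \<theta> i x \<omega>) (Pi\<^sub>M ({1..M} \<times> X) (\<lambda>_. borel))"

lemma space_XB [simp]: "space XB = X"
  by (simp add: space_restrict_space)

lemma space_arm_space [simp]: "space arm_space = {1..M} \<times> X"
  by (simp add: space_pair_measure)

\<comment> \<open>The simplifier rewrites \<open>{1..M}\<close> to \<open>{Suc 0..M}\<close>.\<close>
lemmas [simp] = space_arm_space[unfolded One_nat_def]

lemma borel_measurable_arms:
  assumes "\<And>i. i \<in> {1..M} \<Longrightarrow> (\<lambda>x. g i x) \<in> borel_measurable N" "h \<in> N \<rightarrow>\<^sub>M count_space {1..M}"
  shows "(\<lambda>x. g (h x) x) \<in> borel_measurable N"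
  by (rule measurable_compose_countable'[OF assms]) auto

lemma arm_functions_measurable:
  assumes "\<And>i. i \<in> {1..M} \<Longrightarrow> continuous_on X (g i)"
  shows "case_prod g \<in> borel_measurable arm_space"
proof -
  have "(\<lambda>p. g (fst p) (snd p)) \<in> borel_measurable arm_space"
  proof (rule borel_measurable_arms)
    fix i assume "i \<in> {1..M}"
    then have "g i \<in> borel_measurable XB" by (intro borel_measurable_continuous_on_restrict assms)
    then show "(\<lambda>p. g i (snd p)) \<in> borel_measurable arm_space" by measurable
  qed simp
  then show ?thesis by (simp add: case_prod_beta')
qed

lemma prior_component_measurable:
  assumes "i \<in> {1..M}" "x \<in> X" shows "\<theta> i x \<in> borel_measurable prior_algebra"
proof -
  have "(\<lambda>\<omega>. \<lambda>(i, x)\<in>{1..M} \<times> X. \<theta> i x \<omega>) \<in> prior_algebra \<rightarrow>\<^sub>M Pi\<^sub>M ({1..M} \<times> X) (\<lambda>_. borel)"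
    by (rule measurable_vimage_algebra1) (auto simp: space_PiM)
  from measurable_compose[OF this measurable_component_singleton[of "(i, x)"]]
  show ?thesis using assms by simp
qed

lemma prior_component_borel: 
  assumes "i \<in> {1..M}" "x \<in> X" shows "normal_rv P (\<theta> i x) (\<mu>0 i x) (k0 i x x)"
  using prior_gaussian[OF assms(1), unfolded gaussian_process_def, rule_format, of "{x}" "\<lambda>_. 1"] assms(2) by simp

text \<open>\<open>prior_measurable\<close> concerns one arm and the sigma-algebra of that arm
  alone; it is lifted to the algebra of all arms and glued over the finitely many arms.\<close>

lemma field_measurable: "(\<lambda>(p, \<omega>). (case p of (i, x) \<Rightarrow> \<theta> i x) \<omega>) \<in> borel_measurable (arm_space \<Otimes>\<^sub>M prior_algebra)"
proof -
  have "(\<lambda>z. \<theta> (fst (fst z)) (snd (fst z)) (snd z)) \<in> borel_measurable (arm_space \<Otimes>\<^sub>M prior_algebra)"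
  proof (rule borel_measurable_arms[where h = "\<lambda>z. fst (fst z)"])
    fix i assume i: "i \<in> {1..M}"
    let ?V = "vimage_algebra (space P) (\<lambda>\<omega>. \<lambda>x\<in>X. \<theta> i x \<omega>) (Pi\<^sub>M X (\<lambda>_. borel))"
    have "(\<lambda>\<omega>. \<lambda>x\<in>X. \<theta> i x \<omega>) \<in> prior_algebra \<rightarrow>\<^sub>M Pi\<^sub>M X (\<lambda>_. borel)"
      by (rule measurable_restrict) (rule prior_component_measurable[OF i])
    then have [measurable]: "(\<lambda>\<omega>. \<omega>) \<in> prior_algebra \<rightarrow>\<^sub>M ?V"
      by (intro measurable_vimage_algebra2) simp_all
    have "(\<lambda>z. (snd (fst z), snd z)) \<in> arm_space \<Otimes>\<^sub>M prior_algebra \<rightarrow>\<^sub>M XB \<Otimes>\<^sub>M ?V"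
      by (intro measurable_Pair measurable_compose[OF measurable_snd, of "\<lambda>\<omega>. \<omega>" prior_algebra]) measurable
    from measurable_compose[OF this prior_measurable[OF i]]
    show "(\<lambda>z. \<theta> i (snd (fst z)) (snd z)) \<in> borel_measurable (arm_space \<Otimes>\<^sub>M prior_algebra)" by simp
  qed measurable
  then show ?thesis by (simp add: case_prod_beta')
qed

lemma psd_on_prior_kernel: "i \<in> {1..M} \<Longrightarrow> psd_on X (k0 i)"
  by (rule gaussian_process_psd_on[OF prior_gaussian kernel_sym])

lemma joint_kernel_measurable: "case_prod (joint_kernel k0) \<in> borel_measurable (arm_space \<Otimes>\<^sub>M arm_space)"
proof -
  have "(\<lambda>z. if fst (fst z) = fst (snd z) then k0 (fst (fst z)) (snd (fst z)) (snd (snd z)) else 0)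
      \<in> borel_measurable (arm_space \<Otimes>\<^sub>M arm_space)"
  proof (rule borel_measurable_arms[where h = "\<lambda>z. fst (fst z)"])
    fix i assume i: "i \<in> {1..M}"
    have [measurable]: "(\<lambda>x. x) \<in> XB \<rightarrow>\<^sub>M borel" by (rule measurable_restrict_space1) simp
    have 1: "(\<lambda>z. snd (fst z)) \<in> arm_space \<Otimes>\<^sub>M arm_space \<rightarrow>\<^sub>M borel"
      by (rule measurable_compose[of _ _ XB]) measurable
    have 2: "(\<lambda>z. snd (snd z)) \<in> arm_space \<Otimes>\<^sub>M arm_space \<rightarrow>\<^sub>M borel"
      by (rule measurable_compose[of _ _ XB]) measurable
    have "(\<lambda>z. (snd (fst z), snd (snd z))) \<in> arm_space \<Otimes>\<^sub>M arm_space \<rightarrow>\<^sub>M restrict_space borel (X \<times> X)"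
      by (rule measurable_restrict_space2)
        (use measurable_Pair[OF 1 2] in \<open>auto simp: space_pair_measure borel_prod\<close>)
    from measurable_compose[OF this borel_measurable_continuous_on_restrict[OF kernel_continuous[OF i]]]
    have k: "(\<lambda>z. k0 i (snd (fst z)) (snd (snd z))) \<in> borel_measurable (arm_space \<Otimes>\<^sub>M arm_space)" by simp
    show "(\<lambda>z. if i = fst (snd z) then k0 i (snd (fst z)) (snd (snd z)) else 0) \<in> borel_measurable (arm_space \<Otimes>\<^sub>M arm_space)"
    proof (rule borel_measurable_arms[where h = "\<lambda>z. fst (snd z)"])
      fix j
      show "(\<lambda>z. if i = j then k0 i (snd (fst z)) (snd (snd z)) else 0) \<in> borel_measurable (arm_space \<Otimes>\<^sub>M arm_space)"
        using k by (cases "i = j") simp_all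
    qed measurable
  qed measurable
  then show ?thesis by (simp add: joint_kernel_def case_prod_beta')
qed

text \<open>The induction is strong because \<open>hist_algebra\<close> also records the earlier
  decisions, which are functions of the observations by the induction hypothesis.\<close>

lemma design_obs_algebra:
  "(\<lambda>\<omega>. (a n \<omega>, v n \<omega>)) \<in> obs_algebra (space P) y n \<rightarrow>\<^sub>M count_space UNIV \<Otimes>\<^sub>M borel"
proof (induction n rule: less_induct)
  case (less n)
  let ?O = "obs_algebra (space P) y n"
  have "(\<lambda>\<omega>. \<lambda>l\<in>{..<n}. (a l \<omega>, v l \<omega>, y (Suc l) \<omega>)) \<in> ?O \<rightarrow>\<^sub>M Pi\<^sub>M {..<n} (\<lambda>_. count_space UNIV \<Otimes>\<^sub>M borel \<Otimes>\<^sub>M borel)"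
  proof (rule measurable_restrict)
    fix k assume "k \<in> {..<n}"
    then have k: "k < n" by simp
    have av: "(\<lambda>\<omega>. (a k \<omega>, v k \<omega>)) \<in> ?O \<rightarrow>\<^sub>M count_space UNIV \<Otimes>\<^sub>M borel"
      using measurable_compose[OF obs_algebra_mono less.IH[OF k]] k by simp
    have "y (Suc k) \<in> borel_measurable ?O" by (rule measurable_observation) (use k in simp)
    then show "(\<lambda>\<omega>. (a k \<omega>, v k \<omega>, y (Suc k) \<omega>)) \<in> ?O \<rightarrow>\<^sub>M count_space UNIV \<Otimes>\<^sub>M borel \<Otimes>\<^sub>M borel"
      using measurable_compose[OF av measurable_fst] measurable_compose[OF av measurable_snd] by (intro measurable_Pair) simp_all
  qed
  then have "(\<lambda>\<omega>. \<omega>) \<in> ?O \<rightarrow>\<^sub>M hist_algebra P a v y n"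
    unfolding hist_algebra_def by (intro measurable_vimage_algebra2) simp_all
  from measurable_compose[OF this decision_adapted] show ?case .
qed

sublocale gp: gp_sampling P arm_space prior_algebra "case_prod \<theta>" "case_prod lam" e "\<lambda>n \<omega>. (a n \<omega>, v n \<omega>)" y
  "case_prod \<mu>0" "joint_kernel k0"
proof
  show "sets prior_algebra \<subseteq> sets P"
  proof (rule sets_image_in_sets)
    show "(\<lambda>\<omega>. \<lambda>(i, x)\<in>{1..M} \<times> X. \<theta> i x \<omega>) \<in> P \<rightarrow>\<^sub>M Pi\<^sub>M ({1..M} \<times> X) (\<lambda>_. borel)"
      by (rule measurable_restrict) (use prior_component_borel in \<open>auto simp: normal_rv_def\<close>)
  qed simp
  show "case_prod (case_prod \<theta>) \<in> borel_measurable (arm_space \<Otimes>\<^sub>M prior_algebra)" by (rule field_measurable)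
  show "case_prod lam \<in> borel_measurable arm_space" by (rule arm_functions_measurable[OF noise_continuous])
  show "0 < case_prod lam p" if "p \<in> space arm_space" for p
    using that noise_pos unfolding space_arm_space by auto
  show "(\<lambda>\<omega>. (a n \<omega>, v n \<omega>)) \<in> obs_algebra (space P) y n \<rightarrow>\<^sub>M arm_space" for n
  proof -
    have "a n \<in> obs_algebra (space P) y n \<rightarrow>\<^sub>M restrict_space (count_space UNIV) {1..M}"
      using measurable_compose[OF design_obs_algebra measurable_fst] decision_range
      by (intro measurable_restrict_space2) auto
    moreover have "v n \<in> obs_algebra (space P) y n \<rightarrow>\<^sub>M XB"
      using measurable_compose[OF design_obs_algebra measurable_snd] decision_range
      by (intro measurable_restrict_space2) auto
    ultimately show ?thesis by (simp add: restrict_count_space)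
  qed
  show "case_prod \<mu>0 \<in> borel_measurable arm_space" by (rule arm_functions_measurable[OF mean_continuous])
  show "gp_weight P (\<lambda>_. 1) (space arm_space) (case_prod \<theta>) (case_prod \<mu>0) (joint_kernel k0)"
    unfolding space_arm_space by (rule gp_weight_joint_prior[OF prior_gaussian prior_indep])
  show "psd_on (space arm_space) (joint_kernel k0)"
    unfolding space_arm_space by (rule psd_on_joint_kernel[OF psd_on_prior_kernel])
qed (use noise_normal noise_indep noise_prior_indep observation joint_kernel_measurable in auto)

lemma post_cov_eq:
  assumes "\<omega> \<in> space P" shows "post_cov k0 lam a v i n x x' \<omega> = gp.post_k n \<omega> (i, x) (i, x')"
  unfolding gp.post_k_def
  by (rule post_cov_eq_kcov[of "{1..M}" X]) (use psd_on_prior_kernel noise_pos decision_range[OF assms] in auto)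

lemma post_mean_eq:
  assumes "\<omega> \<in> space P" shows "post_mean \<mu>0 k0 lam a v y i n x \<omega> = gp.post_m n \<omega> (i, x)"
  unfolding gp.post_m_def
  by (rule post_mean_eq_kmean[of "{1..M}" X]) (use psd_on_prior_kernel noise_pos decision_range[OF assms] in auto)

end


section \<open>The integrated knowledge gradient\<close>

text \<open>The bracket in \<open>ikg\<close> at one location: \<open>m\<close> holds the posterior
  means there, and \<open>s\<close> is the standard deviation of the next change of the mean of arm
  \<open>i\<close>.\<close>

definition kg_factor :: "nat \<Rightarrow> (nat \<Rightarrow> real) \<Rightarrow> nat \<Rightarrow> real \<Rightarrow> real" where
  "kg_factor M m i s = (LINT z|std_normal_distribution. Max ((\<lambda>j. m j + (if j = i then s * z else 0)) ` {1..M}))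
     - Max (m ` {1..M})"

lemma Max_image_diff_le:
  fixes g h :: "'j \<Rightarrow> real"
  assumes J: "finite J" "J \<noteq> {}" and le: "\<And>j. j \<in> J \<Longrightarrow> \<bar>g j - h j\<bar> \<le> c"
  shows "\<bar>Max (g ` J) - Max (h ` J)\<bar> \<le> c"
proof -
  have *: "Max (g ` J) \<le> Max (h ` J) + c" if le: "\<And>j. j \<in> J \<Longrightarrow> \<bar>g j - h j\<bar> \<le> c" for g h :: "'j \<Rightarrow> real"
  proof -
    have "g j \<le> Max (h ` J) + c" if j: "j \<in> J" for j
    proof -
      have "h j \<le> Max (h ` J)" using J j by simp
      then show ?thesis using le[OF j] by linarith
    qed
    then show ?thesis using J by (simp add: Max_le_iff)
  qed
  from *[of g h] *[of h g] le show ?thesis by (simp add: abs_le_iff abs_minus_commute)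
qed

interpretation std_normal: prob_space std_normal_distribution
  by (rule prob_space_normal_density) simp

lemma std_normal_measure_UNIV [simp]: "measure std_normal_distribution UNIV = 1"
  using std_normal.prob_space by simp

lemma std_normal_integrable: "integrable std_normal_distribution (\<lambda>z. z)" "(LINT z|std_normal_distribution. z) = 0"
  using integrable_std_normal_distribution_moment[of 1] integral_std_normal_distribution_moment_odd[of 1] by simp_all

text \<open>Either half-line contains an interval of length 1, and the density is positive
  there.\<close>

lemma std_normal_tail_pos: "0 < measure std_normal_distribution {t<..}" "0 < measure std_normal_distribution {..<t}"
proof -
  have pos: "0 < measure std_normal_distribution A" if A: "A \<in> sets borel" and sub: "{b<..<b + 1} \<subseteq> A" for A and b :: real
  proof (rule ccontr)
    assume "\<not> 0 < measure std_normal_distribution A"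
    then have "emeasure std_normal_distribution A = 0"
      by (simp add: std_normal.emeasure_eq_measure zero_less_measure_iff)
    then have "AE z in lborel. ennreal (std_normal_density z) * indicator A z = 0"
      using A by (simp add: emeasure_density nn_integral_0_iff_AE)
    then have "AE z in lborel. z \<notin> A"
    proof (rule AE_mp, intro AE_I2 impI notI)
      fix z assume "ennreal (std_normal_density z) * indicator A z = 0" "z \<in> A"
      then show False using normal_density_pos[of 1 0 z] by (simp add: ennreal_eq_0_iff not_le)
    qed
    then have "AE z in lborel. z \<notin> {b<..<b + 1}" using sub by (auto elim!: eventually_mono)
    then have "emeasure lborel {b<..<b + 1} = 0"
      by (subst (asm) AE_iff_measurable[of "{b<..<b + 1}"]) auto
    then show False by simp
  qed
  show "0 < measure std_normal_distribution {t<..}" by (rule pos[of _ t]) auto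
  show "0 < measure std_normal_distribution {..<t}" by (rule pos[of _ "t - 1"]) auto
qed

section \<open>The gain at a single location\<close>

context
  fixes M :: nat and m :: "nat \<Rightarrow> real" and i :: nat and s :: real
  assumes M: "2 \<le> M" and i: "i \<in> {1..M}"
begin

definition kg_max :: "real \<Rightarrow> real" where
  "kg_max z = Max ((\<lambda>j. m j + (if j = i then s * z else 0)) ` {1..M})"

lemma kg_max_diff: "\<bar>kg_max z - Max (m ` {1..M})\<bar> \<le> \<bar>s\<bar> * \<bar>z\<bar>"
  unfolding kg_max_def by (rule Max_image_diff_le) (use M in \<open>auto simp: abs_mult\<close>)

lemma kg_max_ge: "j \<in> {1..M} \<Longrightarrow> m j + (if j = i then s * z else 0) \<le> kg_max z"
  unfolding kg_max_def by (rule Max_ge) (auto intro: rev_image_eqI)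

lemma kg_max_integrable: "integrable std_normal_distribution kg_max"
proof (rule Bochner_Integration.integrable_bound)
  show "integrable std_normal_distribution (\<lambda>z. \<bar>s\<bar> * \<bar>z\<bar> + \<bar>Max (m ` {1..M})\<bar>)"
    using integrable_abs[OF std_normal_integrable(1)] by (intro Bochner_Integration.integrable_add integrable_mult_right) simp_all
  have "kg_max \<in> borel_measurable borel"
    unfolding kg_max_def[abs_def] by (intro borel_measurable_Max) auto
  then show "kg_max \<in> borel_measurable std_normal_distribution" by simp
  show "AE z in std_normal_distribution. norm (kg_max z) \<le> norm (\<bar>s\<bar> * \<bar>z\<bar> + \<bar>Max (m ` {1..M})\<bar>)"
  proof (rule AE_I2)
    fix z
    show "norm (kg_max z) \<le> norm (\<bar>s\<bar> * \<bar>z\<bar> + \<bar>Max (m ` {1..M})\<bar>)"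
      using kg_max_diff[of z] by simp
  qed
qed

text \<open>A maximum is 1-Lipschitz in its entries, so the gain is at most the mean size of the
  perturbation.\<close>

lemma kg_factor_abs_le: "\<bar>kg_factor M m i s\<bar> \<le> \<bar>s\<bar> * (LINT z|std_normal_distribution. \<bar>z\<bar>)"
proof -
  have "kg_factor M m i s = (LINT z|std_normal_distribution. kg_max z - Max (m ` {1..M}))"
    unfolding kg_factor_def kg_max_def[symmetric] using kg_max_integrable by (simp add: std_normal.prob_space)
  also have "\<bar>\<dots>\<bar> \<le> (LINT z|std_normal_distribution. \<bar>kg_max z - Max (m ` {1..M})\<bar>)"
    by (rule integral_abs_bound)
  also have "\<dots> \<le> (LINT z|std_normal_distribution. \<bar>s\<bar> * \<bar>z\<bar>)"
    by (rule integral_mono) (use kg_max_integrable kg_max_diff integrable_abs[OF std_normal_integrable(1)] in auto)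
  finally show ?thesis by simp
qed

text \<open>If the current leader is not \<open>i\<close>, then \<open>i\<close> overtakes it when \<open>z\<close> is large; if it is \<open>i\<close>,
  then another arm overtakes \<open>i\<close> when \<open>- z\<close> is large. The bound is linear in \<open>B\<close>, so that it can be
  integrated over locations.\<close>

lemma kg_factor_bounds:
  shows kg_factor_nonneg: "0 \<le> kg_factor M m i s"
    and kg_factor_ge: "\<lbrakk>0 \<le> t; 0 \<le> s0; s0 \<le> s; \<And>j. j \<in> {1..M} \<Longrightarrow> \<bar>m j\<bar> \<le> B;
      q \<le> measure std_normal_distribution {t<..}; q \<le> measure std_normal_distribution {..<- t}; 0 \<le> q\<rbrakk>
      \<Longrightarrow> q * (s0 * t - 2 * B) \<le> kg_factor M m i s"
proof -
  let ?G = "Max (m ` {1..M})"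
  have "?G \<in> m ` {1..M}" using M by (intro Max_in) auto
  then obtain j0 where j0: "j0 \<in> {1..M}" "?G = m j0" by auto
  \<comment> \<open>Subtracting the current leader together with its own perturbation, instead of
    the constant maximum, leaves the integral unchanged because \<open>z\<close> has mean 0, and
    makes the integrand nonnegative for every \<open>z\<close>.\<close>
  define lead where "lead z = m j0 + (if j0 = i then s * z else 0)" for z
  have lead_int: "integrable std_normal_distribution lead"
    unfolding lead_def[abs_def] using std_normal_integrable(1) by (cases "j0 = i") simp_all
  have lead: "(LINT z|std_normal_distribution. lead z) = ?G"
    unfolding lead_def[abs_def] j0(2)
    by (cases "j0 = i") (simp_all add: std_normal_integrable std_normal.prob_space)
  have eq: "kg_factor M m i s = (LINT z|std_normal_distribution. kg_max z - lead z)"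
    unfolding kg_factor_def kg_max_def[symmetric] lead[symmetric] using kg_max_integrable lead_int by simp
  have ge0: "0 \<le> kg_max z - lead z" for z
    using kg_max_ge[OF j0(1), of z] by (simp add: lead_def)
  show nn: "0 \<le> kg_factor M m i s" unfolding eq using ge0 by (intro integral_nonneg_AE AE_I2)
  assume t: "0 \<le> t" "0 \<le> s0" "s0 \<le> s" and B: "\<And>j. j \<in> {1..M} \<Longrightarrow> \<bar>m j\<bar> \<le> B"
    and q: "q \<le> measure std_normal_distribution {t<..}" "q \<le> measure std_normal_distribution {..<- t}" "0 \<le> q"
  show "q * (s0 * t - 2 * B) \<le> kg_factor M m i s"
  proof (cases "s0 * t - 2 * B \<ge> 0")
    case False
    then show ?thesis using nn q(3) by (meson mult_nonneg_nonpos nle_le order_trans)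
  next
    case True
    define E where "E = (if j0 = i then {..<- t} else {t<..})"
    have E: "E \<in> sets std_normal_distribution" by (simp add: E_def)
    \<comment> \<open>On \<open>E\<close> the perturbation favours the challenger by at least
      \<open>s0 * t\<close>, while the two means involved differ by at most
      \<open>2 * B\<close>.\<close>
    have "s0 * t - 2 * B \<le> kg_max z - lead z" if z: "z \<in> E" for z
    proof (cases "j0 = i")
      case True
      \<comment> \<open>Any arm other than \<open>i\<close>; it exists because \<open>M\<close> is
        at least 2.\<close>
      define j where "j = (if i = 1 then 2 else 1::nat)"
      have j: "j \<in> {1..M}" "j \<noteq> i" using M i by (auto simp: j_def)
      have "s0 * t \<le> s * (- z)" using z t True by (intro mult_mono) (auto simp: E_def)
      then show ?thesis using kg_max_ge[OF j(1), of z] j(2) B[OF j(1)] B[OF j0(1)] True by (auto simp: lead_def)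
    next
      case False
      have "s0 * t \<le> s * z" using z t False by (intro mult_mono) (auto simp: E_def)
      then show ?thesis using kg_max_ge[OF i, of z] B[OF i] B[OF j0(1)] False by (auto simp: lead_def)
    qed
    then have pt: "indicator E z * (s0 * t - 2 * B) \<le> kg_max z - lead z" for z
      using ge0[of z] by (auto split: split_indicator)
    have "q * (s0 * t - 2 * B) \<le> measure std_normal_distribution E * (s0 * t - 2 * B)"
      using True q by (intro mult_right_mono) (auto simp: E_def)
    also have "\<dots> = (LINT z|std_normal_distribution. indicator E z * (s0 * t - 2 * B))"
      using E by simp
    also have "\<dots> \<le> kg_factor M m i s"
      unfolding eq using E kg_max_integrable lead_int pt
      by (intro integral_mono) (auto simp: std_normal.emeasure_eq_measure less_top[symmetric])
    finally show ?thesis .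
  qed
qed

end

lemma kg_factor_measurable:
  assumes m: "\<And>j. j \<in> {1..M} \<Longrightarrow> m j \<in> borel_measurable N" and s: "s \<in> borel_measurable N"
  shows "(\<lambda>x. kg_factor M (\<lambda>j. m j x) i (s x)) \<in> borel_measurable N"
proof -
  have "(\<lambda>p. Max ((\<lambda>j. m j (fst p) + (if j = i then s (fst p) * snd p else 0)) ` {1..M}))
      \<in> borel_measurable (N \<Otimes>\<^sub>M std_normal_distribution)"
  proof (rule borel_measurable_Max)
    fix j assume "j \<in> {1..M}"
    note [measurable] = m[OF this] s
    have "(\<lambda>p. m j (fst p)) \<in> borel_measurable (N \<Otimes>\<^sub>M std_normal_distribution)" by measurable
    moreover have [measurable]: "snd \<in> borel_measurable (N \<Otimes>\<^sub>M std_normal_distribution)"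
      using measurable_snd[of N std_normal_distribution] by (simp cong: measurable_cong_sets)
    moreover have "(\<lambda>p. s (fst p) * snd p) \<in> borel_measurable (N \<Otimes>\<^sub>M std_normal_distribution)" by measurable
    ultimately show "(\<lambda>p. m j (fst p) + (if j = i then s (fst p) * snd p else 0)) \<in> borel_measurable (N \<Otimes>\<^sub>M std_normal_distribution)"
      by (cases "j = i") simp_all
  qed simp
  then have "(\<lambda>x. LINT z|std_normal_distribution. Max ((\<lambda>j. m j x + (if j = i then s x * z else 0)) ` {1..M})) \<in> borel_measurable N"
    by (intro std_normal.borel_measurable_lebesgue_integral) (simp add: case_prod_beta')
  moreover have "(\<lambda>x. Max ((\<lambda>j. m j x) ` {1..M})) \<in> borel_measurable N"
    by (rule borel_measurable_Max) (use m in simp_all)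
  ultimately show ?thesis unfolding kg_factor_def by (rule borel_measurable_diff)
qed


section \<open>Sampling under the policy\<close>

locale ikg_sampling = compact_covariate_sampling P M X \<mu>0 k0 lam \<theta> e a v y
  for P :: "'w measure" and M :: nat and X :: "'x::euclidean_space set"
    and \<mu>0 k0 lam \<theta> e a v y +
  fixes \<gamma> :: "'x \<Rightarrow> real" and c :: "nat \<Rightarrow> 'x \<Rightarrow> real"
  assumes two_arms: "2 \<le> M"
    and density: "prob_density_on X \<gamma>"
    and density_positive: "positive_density_on X \<gamma>"
    and cost_continuous: "\<And>i. i \<in> {1..M} \<Longrightarrow> continuous_on X (c i)"
    and cost_pos: "\<And>i x. i \<in> {1..M} \<Longrightarrow> x \<in> X \<Longrightarrow> 0 < c i x"
    and policy: "ikg_policy P M X \<gamma> \<mu>0 k0 lam c a v y"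
begin

lemma arm_functions_bounded:
  fixes g :: "nat \<Rightarrow> 'x \<Rightarrow> real"
  assumes "\<And>i. i \<in> {1..M} \<Longrightarrow> continuous_on X (g i)"
  obtains C where "\<And>i x. i \<in> {1..M} \<Longrightarrow> x \<in> X \<Longrightarrow> \<bar>g i x\<bar> \<le> C"
proof -
  have "bounded (\<Union>i\<in>{1..M}. g i ` X)"
    by (intro bounded_UN ballI compact_imp_bounded compact_continuous_image assms compact_X) simp
  then obtain C where "\<forall>y\<in>(\<Union>i\<in>{1..M}. g i ` X). norm y \<le> C" by (auto simp: bounded_iff)
  then show thesis by (intro that[of C]) auto
qed

lemma kernel_diag_continuous: "i \<in> {1..M} \<Longrightarrow> continuous_on X (\<lambda>x. k0 i x x)"
  using continuous_on_compose2[OF kernel_continuous, of i X "\<lambda>x. (x, x)"] by (force intro!: continuous_intros)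

text \<open>The distribution of the covariate as a probability measure on \<open>X\<close>, on which
  Fubini's theorem and dominated convergence are applied.\<close>

definition location_measure :: "'x measure" where
  "location_measure = density (restrict_space lborel X) (\<lambda>u. ennreal (\<gamma> u))"

lemma X_borel [measurable]: "X \<in> sets borel"
  using compact_X by (rule borel_compact)

lemma sets_location_measure [measurable_cong]: "sets location_measure = sets XB"
  by (simp add: location_measure_def sets_restrict_space)

lemma space_location_measure [simp]: "space location_measure = X"
  by (simp add: location_measure_def space_restrict_space)

lemma density_measurable [measurable]: "\<gamma> \<in> borel_measurable (restrict_space lborel X)"
  using density
  by (auto simp: prob_density_on_def set_integrable_def borel_measurable_restrict_space_iff dest: borel_measurable_integrable)

lemma density_nonneg: "u \<in> X \<Longrightarrow> 0 \<le> \<gamma> u"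
  using density by (simp add: prob_density_on_def)

lemma integral_location_measure:
  fixes F :: "'x \<Rightarrow> real"
  assumes "F \<in> borel_measurable XB"
  shows "(LINT u:X|lborel. F u * \<gamma> u) = (LINT u|location_measure. F u)"
proof -
  have F: "F \<in> borel_measurable (restrict_space lborel X)"
    using assms by (simp cong: measurable_cong_sets add: sets_restrict_space)
  have "(LINT u|location_measure. F u) = (LINT u|restrict_space lborel X. \<gamma> u *\<^sub>R F u)"
    unfolding location_measure_def
    by (rule integral_density[OF F density_measurable]) (auto intro!: AE_I2 simp: space_restrict_space density_nonneg)
  also have "\<dots> = (LINT u|lborel. indicator X u *\<^sub>R (\<gamma> u *\<^sub>R F u))"
    by (rule integral_restrict_space) simp
  finally show ?thesis by (simp add: set_lebesgue_integral_def mult.commute)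
qed

lemma location_measure_prob: "prob_space location_measure"
proof (rule prob_spaceI)
  have int: "integrable (restrict_space lborel X) \<gamma>"
    using density by (simp add: prob_density_on_def set_integrable_def integrable_restrict_space)
  have "emeasure location_measure (space location_measure) = (\<integral>\<^sup>+u. \<gamma> u \<partial>restrict_space lborel X)"
    unfolding location_measure_def
    by (subst emeasure_density) (auto simp: space_restrict_space sets_restrict_space intro!: nn_integral_cong)
  also have "\<dots> = ennreal (LINT u|restrict_space lborel X. \<gamma> u)"
    by (rule nn_integral_eq_integral[OF int]) (auto intro!: AE_I2 simp: space_restrict_space density_nonneg)
  also have "(LINT u|restrict_space lborel X. \<gamma> u) = 1"
    using density by (subst integral_restrict_space) (simp_all add: prob_density_on_def set_lebesgue_integral_def)
  finally show "emeasure location_measure (space location_measure) = 1" by simp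
qed

sublocale loc: prob_space location_measure by (rule location_measure_prob)

text \<open>A gain that is bounded below near one point of \<open>X\<close> therefore survives
  integration over the locations.\<close>

lemma location_measure_pos:
  assumes "x \<in> X" "open U" "x \<in> U"
  shows "0 < measure location_measure (X \<inter> U)"
proof -
  have U: "X \<inter> U \<in> sets XB" using assms by (auto simp: sets_restrict_space)
  have "0 < (LINT u:X \<inter> U|lborel. \<gamma> u)"
    using density_positive assms by (auto simp: positive_density_on_def)
  also have "\<dots> = (LINT u:X|lborel. indicator (X \<inter> U) u * \<gamma> u)"
    unfolding set_lebesgue_integral_def by (intro Bochner_Integration.integral_cong) (auto split: split_indicator)
  also have "\<dots> = (LINT u|location_measure. indicator (X \<inter> U) u)"
    by (rule integral_location_measure) (use U in measurable)
  also have "\<dots> = measure location_measure (X \<inter> U)"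
    using U by (simp add: sets_location_measure inf_commute inf_left_commute)
  finally show ?thesis .
qed

abbreviation "IKG \<equiv> ikg M X \<gamma> \<mu>0 k0 lam c a v y"

definition sigma :: "nat \<Rightarrow> 'w \<Rightarrow> nat \<Rightarrow> 'x \<Rightarrow> 'x \<Rightarrow> real" where
  "sigma n \<omega> i u x = gp.post_k n \<omega> (i, u) (i, x) / sqrt (gp.post_k n \<omega> (i, x) (i, x) + lam i x)"

definition kg :: "nat \<Rightarrow> 'w \<Rightarrow> nat \<Rightarrow> 'x \<Rightarrow> 'x \<Rightarrow> real" where
  "kg n \<omega> i x u = kg_factor M (\<lambda>j. gp.post_m n \<omega> (j, u)) i (sigma n \<omega> i u x)"

lemma arm_location_measurable: "j \<in> {1..M} \<Longrightarrow> (\<lambda>u. (j, u)) \<in> XB \<rightarrow>\<^sub>M arm_space"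
  by (intro measurable_Pair) simp_all

lemma post_m_location_measurable:
  "\<omega> \<in> space P \<Longrightarrow> j \<in> {1..M} \<Longrightarrow> (\<lambda>u. gp.post_m n \<omega> (j, u)) \<in> borel_measurable XB"
  by (rule gp.post_m_measurable[of "\<lambda>_. \<omega>"]) (simp_all add: arm_location_measurable)

lemma post_k_location_measurable:
  "\<omega> \<in> space P \<Longrightarrow> j \<in> {1..M} \<Longrightarrow> p \<in> {1..M} \<times> X \<Longrightarrow> (\<lambda>u. gp.post_k n \<omega> (j, u) p) \<in> borel_measurable XB"
  by (rule gp.post_k_measurable[of "\<lambda>_. \<omega>" _ _ _ "\<lambda>_. p"], simp, rule arm_location_measurable, assumption,
      rule measurable_const, unfold space_arm_space)

lemma kg_measurable:
  assumes "\<omega> \<in> space P" "i \<in> {1..M}" "x \<in> X"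
  shows "kg n \<omega> i x \<in> borel_measurable XB"
proof -
  have "(\<lambda>u. sigma n \<omega> i u x) \<in> borel_measurable XB"
    unfolding sigma_def using assms
    by (intro borel_measurable_divide post_k_location_measurable borel_measurable_const) auto
  then show ?thesis
    unfolding kg_def[abs_def] by (intro kg_factor_measurable post_m_location_measurable assms)
qed

lemma ikg_eq:
  assumes \<omega>: "\<omega> \<in> space P" and ix: "i \<in> {1..M}" "x \<in> X"
  shows "IKG n i x \<omega> = (LINT u|location_measure. kg n \<omega> i x u) / c i x"
  unfolding ikg_def sigma_tilde_def post_cov_eq[OF \<omega>] post_mean_eq[OF \<omega>]
    integral_location_measure[OF kg_measurable[OF \<omega> ix], symmetric]
  by (simp add: kg_def kg_factor_def sigma_def)

lemma sigma_square_le: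
  assumes \<omega>: "\<omega> \<in> space P" and ix: "i \<in> {1..M}" "u \<in> X" "x \<in> X"
  shows "(sigma n \<omega> i u x)\<^sup>2 = (gp.post_k n \<omega> (i, u) (i, x))\<^sup>2 / (gp.post_k n \<omega> (i, x) (i, x) + lam i x)"
    and "(sigma n \<omega> i u x)\<^sup>2 \<le> k0 i u u"
proof -
  have "0 \<le> gp.post_k n \<omega> (i, x) (i, x) + lam i x"
    using gp.post_k_diag_nonneg[OF \<omega>, of "(i, x)" n] noise_pos[of i x] ix by simp
  then show eq: "(sigma n \<omega> i u x)\<^sup>2 = (gp.post_k n \<omega> (i, u) (i, x))\<^sup>2 / (gp.post_k n \<omega> (i, x) (i, x) + lam i x)"
    by (simp add: sigma_def power_divide)
  have "(gp.post_k n \<omega> (i, u) (i, x))\<^sup>2 / (gp.post_k n \<omega> (i, x) (i, x) + case_prod lam (i, x)) \<le> joint_kernel k0 (i, u) (i, u)"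
    unfolding gp.post_k_def
    by (rule kcov_gain_le[OF gp.psd]) (use gp.design_space[OF \<omega>] gp.noise_var(2) ix in auto)
  then show "(sigma n \<omega> i u x)\<^sup>2 \<le> k0 i u u" unfolding eq by (simp add: joint_kernel_def)
qed

lemma kg_abs_le:
  "i \<in> {1..M} \<Longrightarrow> \<bar>kg n \<omega> i x u\<bar> \<le> \<bar>sigma n \<omega> i u x\<bar> * (LINT z|std_normal_distribution. \<bar>z\<bar>)"
  unfolding kg_def by (rule kg_factor_abs_le[OF two_arms])

lemma kg_integrable:
  assumes \<omega>: "\<omega> \<in> space P" and ix: "i \<in> {1..M}" "x \<in> X"
  shows "integrable location_measure (kg n \<omega> i x)"
proof -
  obtain C where C: "\<And>i x. i \<in> {1..M} \<Longrightarrow> x \<in> X \<Longrightarrow> \<bar>k0 i x x\<bar> \<le> C"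
    using arm_functions_bounded[of "\<lambda>i x. k0 i x x", OF kernel_diag_continuous] by blast
  have z: "0 \<le> (LINT z|std_normal_distribution. \<bar>z\<bar>)" by (rule integral_nonneg_AE) simp
  show ?thesis
  proof (rule loc.integrable_const_bound[where B = "sqrt C * (LINT z|std_normal_distribution. \<bar>z\<bar>)"])
    show "AE u in location_measure. norm (kg n \<omega> i x u) \<le> sqrt C * (LINT z|std_normal_distribution. \<bar>z\<bar>)"
    proof (rule AE_I2)
      fix u assume "u \<in> space location_measure"
      then have u: "u \<in> X" by simp
      have "(sigma n \<omega> i u x)\<^sup>2 \<le> C"
        using sigma_square_le(2)[OF \<omega> ix(1) u ix(2), of n] C[OF ix(1) u] by linarith
      then have "\<bar>sigma n \<omega> i u x\<bar> \<le> sqrt C" by (simp add: real_le_rsqrt)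
      then show "norm (kg n \<omega> i x u) \<le> sqrt C * (LINT z|std_normal_distribution. \<bar>z\<bar>)"
        using kg_abs_le[OF ix(1), of n \<omega> x u] mult_right_mono[OF _ z] by fastforce
    qed
    show "kg n \<omega> i x \<in> borel_measurable location_measure"
      using kg_measurable[OF \<omega> ix] by measurable
  qed
qed

text \<open>Sampling at \<open>v n\<close> reduces the posterior variance at \<open>u\<close> by exactly \<open>sigma\<^sup>2\<close>, so these
  squares are summable along the sampling path.\<close>

lemma sampled_sigma_tendsto_0:
  assumes \<omega>: "\<omega> \<in> space P" and u: "u \<in> X"
  shows "(\<lambda>n. \<bar>sigma n \<omega> (a n \<omega>) u (v n \<omega>)\<bar>) \<longlonglongrightarrow> 0"
proof -
  let ?g = "\<lambda>n i. (gp.post_k n \<omega> (i, u) (a n \<omega>, v n \<omega>))\<^sup>2 /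
     (gp.post_k n \<omega> (a n \<omega>, v n \<omega>) (a n \<omega>, v n \<omega>) + case_prod lam (a n \<omega>, v n \<omega>))"
  have av: "a n \<omega> \<in> {1..M}" "v n \<omega> \<in> X" for n using decision_range[OF \<omega>] by auto
  \<comment> \<open>The sampled arm varies with \<open>n\<close>, whereas the gain tends to 0 for a
    fixed index \<open>(i, u)\<close>; the sum over all arms dominates the term of the sampled
    one.\<close>
  have "(\<lambda>n. \<Sum>i\<in>{1..M}. ?g n i) \<longlonglongrightarrow> (\<Sum>i\<in>{1..M}. 0)"
  proof (rule tendsto_sum)
    fix i assume "i \<in> {1..M}"
    then show "(\<lambda>n. ?g n i) \<longlonglongrightarrow> 0"
      unfolding gp.post_k_def
      by (intro kcov_gain_tendsto_0[OF gp.psd]) (use gp.design_space[OF \<omega>] gp.noise_var(2) u in auto)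
  qed
  then have lim: "(\<lambda>n. sqrt (\<Sum>i\<in>{1..M}. ?g n i)) \<longlonglongrightarrow> 0"
    using tendsto_real_sqrt by fastforce
  have nn: "0 \<le> ?g n i" for n i
    using gp.post_k_diag_nonneg[OF \<omega> gp.design_space[OF \<omega>], of n n] noise_pos[OF av(1)[of n] av(2)[of n]] by simp
  have "\<bar>sigma n \<omega> (a n \<omega>) u (v n \<omega>)\<bar> \<le> sqrt (\<Sum>i\<in>{1..M}. ?g n i)" for n
  proof (rule real_le_rsqrt)
    have "\<bar>sigma n \<omega> (a n \<omega>) u (v n \<omega>)\<bar>\<^sup>2 = ?g n (a n \<omega>)"
      by (simp add: sigma_square_le(1)[OF \<omega> av(1) u av(2)])
    also have "\<dots> \<le> (\<Sum>i\<in>{1..M}. ?g n i)"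
      by (rule member_le_sum) (use av nn in auto)
    finally show "\<bar>sigma n \<omega> (a n \<omega>) u (v n \<omega>)\<bar>\<^sup>2 \<le> (\<Sum>i\<in>{1..M}. ?g n i)" .
  qed
  then show ?thesis
    by (intro tendsto_sandwich[OF always_eventually always_eventually tendsto_const lim]) simp_all
qed

text \<open>Dominated convergence over the locations: for each \<open>u\<close> the integrand is at
  most a constant times the absolute value of \<open>sigma\<close>, which vanishes along the
  sampling path and never exceeds \<open>sqrt C\<close>. Costs are bounded away from 0 by
  compactness.\<close>

lemma ikg_sampled_tendsto_0:
  assumes \<omega>: "\<omega> \<in> space P"
  shows "(\<lambda>n. IKG n (a n \<omega>) (v n \<omega>) \<omega>) \<longlonglongrightarrow> 0"
proof -
  let ?z = "LINT z|std_normal_distribution. \<bar>z\<bar>"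
  have av: "a n \<omega> \<in> {1..M}" "v n \<omega> \<in> X" for n using decision_range[OF \<omega>] by auto
  obtain C where C: "\<And>i x. i \<in> {1..M} \<Longrightarrow> x \<in> X \<Longrightarrow> \<bar>k0 i x x\<bar> \<le> C"
    using arm_functions_bounded[of "\<lambda>i x. k0 i x x", OF kernel_diag_continuous] by blast
  have "continuous_on X (\<lambda>x. 1 / c i x)" if "i \<in> {1..M}" for i
    using cost_pos[OF that] by (intro continuous_intros cost_continuous[OF that]) (auto simp: less_imp_neq[symmetric])
  then obtain D where D: "\<And>i x. i \<in> {1..M} \<Longrightarrow> x \<in> X \<Longrightarrow> \<bar>1 / c i x\<bar> \<le> D"
    using arm_functions_bounded[of "\<lambda>i x. 1 / c i x"] by blast
  have z: "0 \<le> ?z" by (rule integral_nonneg_AE) simp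
  have sig_le: "\<bar>sigma n \<omega> (a n \<omega>) u (v n \<omega>)\<bar> \<le> sqrt C" if "u \<in> X" for n u
    by (rule real_le_rsqrt) (use sigma_square_le(2)[OF \<omega> av(1)[of n] that av(2)[of n], of n] C[OF av(1)[of n] that] in simp)
  have "(\<lambda>n. LINT u|location_measure. kg n \<omega> (a n \<omega>) (v n \<omega>) u) \<longlonglongrightarrow> (LINT u|location_measure. 0)"
  proof (rule integral_dominated_convergence[where w = "\<lambda>_. sqrt C * ?z"])
    show "AE u in location_measure. (\<lambda>n. kg n \<omega> (a n \<omega>) (v n \<omega>) u) \<longlonglongrightarrow> 0"
    proof (rule AE_I2)
      fix u assume "u \<in> space location_measure"
      then have "(\<lambda>n. \<bar>sigma n \<omega> (a n \<omega>) u (v n \<omega>)\<bar> * ?z) \<longlonglongrightarrow> 0 * ?z"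
        by (intro tendsto_intros sampled_sigma_tendsto_0[OF \<omega>]) simp
      then show "(\<lambda>n. kg n \<omega> (a n \<omega>) (v n \<omega>) u) \<longlonglongrightarrow> 0"
        unfolding mult_zero_left
        by (rule Lim_null_comparison[rotated], intro always_eventually allI, unfold real_norm_def)
          (rule kg_abs_le[OF av(1)])
    qed
    show "AE u in location_measure. norm (kg n \<omega> (a n \<omega>) (v n \<omega>) u) \<le> sqrt C * ?z" for n
    proof (rule AE_I2)
      fix u assume "u \<in> space location_measure"
      then show "norm (kg n \<omega> (a n \<omega>) (v n \<omega>) u) \<le> sqrt C * ?z"
        using order_trans[OF kg_abs_le[OF av(1)] mult_right_mono[OF sig_le z]] by simp
    qed
    show "kg n \<omega> (a n \<omega>) (v n \<omega>) \<in> borel_measurable location_measure" for n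
      using kg_measurable[OF \<omega> av(1) av(2)] by measurable
  qed simp_all
  then have "(\<lambda>n. D * \<bar>LINT u|location_measure. kg n \<omega> (a n \<omega>) (v n \<omega>) u\<bar>) \<longlonglongrightarrow> 0"
    by (intro tendsto_mult_right_zero tendsto_rabs_zero) simp
  then show ?thesis
  proof (rule Lim_null_comparison[rotated], intro eventuallyI)
    fix n
    show "norm (IKG n (a n \<omega>) (v n \<omega>) \<omega>) \<le> D * \<bar>LINT u|location_measure. kg n \<omega> (a n \<omega>) (v n \<omega>) u\<bar>"
      using mult_right_mono[OF D[OF av(1)[of n] av(2)[of n]], of "\<bar>LINT u|location_measure. kg n \<omega> (a n \<omega>) (v n \<omega>) u\<bar>"]
      by (simp add: ikg_eq[OF \<omega> av] abs_mult)
  qed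
qed

lemma ikg_le_sampled:
  assumes \<omega>: "\<omega> \<in> space P" and ix: "i \<in> {1..M}" "x \<in> X"
  shows "IKG n i x \<omega> \<le> IKG n (a n \<omega>) (v n \<omega>) \<omega>"
  using policy \<omega> ix unfolding ikg_policy_def is_arg_max_def by (fastforce simp: not_less)

text \<open>By Fatou's lemma the posterior means are almost surely bounded in \<open>L\<^sup>1\<close> along a (random)
  subsequence.\<close>

lemma post_m_frequently_bounded:
  "AE \<omega> in P. \<exists>C. \<exists>\<^sub>F n in sequentially.
     (\<integral>\<^sup>+u. ennreal (\<Sum>j\<in>{1..M}. \<bar>gp.post_m n \<omega> (j, u)\<bar>) \<partial>location_measure) \<le> ennreal C"
proof -
  interpret LP: pair_sigma_finite location_measure P ..
  \<comment> \<open>As an \<open>ennreal\<close>, this integral admits Fubini and Fatou before it is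
    known to be finite for a given outcome.\<close>
  define B where "B n \<omega> = (\<integral>\<^sup>+u. ennreal (\<Sum>j\<in>{1..M}. \<bar>gp.post_m n \<omega> (j, u)\<bar>) \<partial>location_measure)" for n \<omega>
  obtain C1 where C1: "\<And>i x. i \<in> {1..M} \<Longrightarrow> x \<in> X \<Longrightarrow> \<bar>\<mu>0 i x\<bar> \<le> C1"
    using arm_functions_bounded[of \<mu>0, OF mean_continuous] by blast
  obtain C2 where C2: "\<And>i x. i \<in> {1..M} \<Longrightarrow> x \<in> X \<Longrightarrow> \<bar>k0 i x x\<bar> \<le> C2"
    using arm_functions_bounded[of "\<lambda>i x. k0 i x x", OF kernel_diag_continuous] by blast
  define C where "C = real M * (C1 + 2 * sqrt C2)"
  have meas: "(\<lambda>z. \<Sum>j\<in>{1..M}. \<bar>gp.post_m n (snd z) (j, fst z)\<bar>) \<in> borel_measurable (location_measure \<Otimes>\<^sub>M P)" for n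
  proof (intro borel_measurable_sum borel_measurable_abs gp.post_m_measurable)
    show "snd \<in> location_measure \<Otimes>\<^sub>M P \<rightarrow>\<^sub>M obs_algebra (space P) y n"
      by (rule measurable_compose[OF measurable_snd gp.measurable_obs])
    have f: "fst \<in> location_measure \<Otimes>\<^sub>M P \<rightarrow>\<^sub>M XB"
      using measurable_fst[of location_measure P] by (simp cong: measurable_cong_sets add: sets_location_measure)
    show "(\<lambda>z. (j, fst z)) \<in> location_measure \<Otimes>\<^sub>M P \<rightarrow>\<^sub>M arm_space" if "j \<in> {1..M}" for j
      by (rule measurable_compose[OF f arm_location_measurable[OF that]])
  qed
  have B_meas: "B n \<in> borel_measurable P" for n
    unfolding B_def
    by (intro loc.borel_measurable_nn_integral)
      (use measurable_compose[OF measurable_pair_swap' meas[of n]] in \<open>simp add: case_prod_beta'\<close>)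
  have B_le: "(\<integral>\<^sup>+\<omega>. B n \<omega> \<partial>P) \<le> ennreal C" for n
  proof -
    have "(\<integral>\<^sup>+\<omega>. B n \<omega> \<partial>P) = (\<integral>\<^sup>+u. \<integral>\<^sup>+\<omega>. ennreal (\<Sum>j\<in>{1..M}. \<bar>gp.post_m n \<omega> (j, u)\<bar>) \<partial>P \<partial>location_measure)"
      unfolding B_def by (rule LP.Fubini') (use meas[of n] in \<open>simp add: case_prod_beta'\<close>)
    also have "\<dots> \<le> (\<integral>\<^sup>+u. ennreal C \<partial>location_measure)"
    proof (rule nn_integral_mono)
      fix u assume "u \<in> space location_measure"
      then have p: "(j, u) \<in> space arm_space" "u \<in> X" if "j \<in> {1..M}" for j using that by auto
      have int: "integrable P (\<lambda>\<omega>. \<Sum>j\<in>{1..M}. \<bar>gp.post_m n \<omega> (j, u)\<bar>)"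
        by (intro Bochner_Integration.integrable_sum integrable_abs gp.post_m_L1_bound p)
      have "(\<integral>\<^sup>+\<omega>. ennreal (\<Sum>j\<in>{1..M}. \<bar>gp.post_m n \<omega> (j, u)\<bar>) \<partial>P) = ennreal (LINT \<omega>|P. (\<Sum>j\<in>{1..M}. \<bar>gp.post_m n \<omega> (j, u)\<bar>))"
        by (rule nn_integral_eq_integral[OF int]) (auto intro!: AE_I2 sum_nonneg)
      also have "(LINT \<omega>|P. (\<Sum>j\<in>{1..M}. \<bar>gp.post_m n \<omega> (j, u)\<bar>)) = (\<Sum>j\<in>{1..M}. (LINT \<omega>|P. \<bar>gp.post_m n \<omega> (j, u)\<bar>))"
        by (intro Bochner_Integration.integral_sum integrable_abs gp.post_m_L1_bound p)
      also have "\<dots> \<le> (\<Sum>j\<in>{1..M}. C1 + 2 * sqrt C2)"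
      proof (rule sum_mono)
        fix j assume j: "j \<in> {1..M}"
        have "k0 j u u \<le> C2" using C2[OF j p(2)[OF j]] by simp
        then have "sqrt (k0 j u u) \<le> sqrt C2" by simp
        moreover have "(LINT \<omega>|P. \<bar>gp.post_m n \<omega> (j, u)\<bar>) \<le> \<bar>\<mu>0 j u\<bar> + 2 * sqrt (k0 j u u)"
          using gp.post_m_L1_bound(2)[OF p(1)[OF j], of n] by (simp add: joint_kernel_def)
        ultimately show "(LINT \<omega>|P. \<bar>gp.post_m n \<omega> (j, u)\<bar>) \<le> C1 + 2 * sqrt C2"
          using C1[OF j p(2)[OF j]] by linarith
      qed
      also have "\<dots> = C" by (simp add: C_def)
      finally show "(\<integral>\<^sup>+\<omega>. ennreal (\<Sum>j\<in>{1..M}. \<bar>gp.post_m n \<omega> (j, u)\<bar>) \<partial>P) \<le> ennreal C"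
        by (simp add: ennreal_leI)
    qed
    also have "\<dots> = ennreal C" by (simp add: loc.emeasure_space_1[simplified])
    finally show ?thesis .
  qed
  have "(\<integral>\<^sup>+\<omega>. liminf (\<lambda>n. B n \<omega>) \<partial>P) \<le> liminf (\<lambda>n. \<integral>\<^sup>+\<omega>. B n \<omega> \<partial>P)"
    by (rule nn_integral_liminf) (rule B_meas)
  also have "\<dots> \<le> liminf (\<lambda>n. ennreal C)"
    by (rule Liminf_mono) (simp add: B_le)
  also have "\<dots> = ennreal C" by (simp add: Liminf_const)
  also have "\<dots> < \<infinity>" by simp
  finally have "AE \<omega> in P. liminf (\<lambda>n. B n \<omega>) \<noteq> \<infinity>"
    by (intro nn_integral_PInf_AE) (use B_meas in auto)
  then show ?thesis
  proof (rule AE_mp, intro AE_I2 impI)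
    fix \<omega> assume fin: "liminf (\<lambda>n. B n \<omega>) \<noteq> \<infinity>"
    define r where "r = enn2real (liminf (\<lambda>n. B n \<omega>))"
    have r: "liminf (\<lambda>n. B n \<omega>) = ennreal r" "0 \<le> r" using fin by (auto simp: r_def less_top)
    \<comment> \<open>One unit above the lower limit leaves room for infinitely many
      \<open>n\<close>.\<close>
    have "\<exists>\<^sub>F n in sequentially. B n \<omega> \<le> ennreal (r + 1)"
    proof (rule ccontr)
      assume "\<not> (\<exists>\<^sub>F n in sequentially. B n \<omega> \<le> ennreal (r + 1))"
      then have "\<forall>\<^sub>F n in sequentially. ennreal (r + 1) \<le> B n \<omega>"
        unfolding not_frequently by (rule eventually_mono) simp
      then have "ennreal (r + 1) \<le> liminf (\<lambda>n. B n \<omega>)" by (rule Liminf_bounded)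
      then show False using r by (simp add: ennreal_le_iff)
    qed
    then show "\<exists>C. \<exists>\<^sub>F n in sequentially. (\<integral>\<^sup>+u. ennreal (\<Sum>j\<in>{1..M}. \<bar>gp.post_m n \<omega> (j, u)\<bar>) \<partial>location_measure) \<le> ennreal C"
      unfolding B_def by blast
  qed
qed

text \<open>The neighbourhood has to serve all times. Cauchy-Schwarz compares the posterior kernel
  at \<open>(u, x)\<close> with its value at \<open>(x, x)\<close>, and
  \<open>kcov_increment_le\<close> bounds the difference by the prior kernel for every
  \<open>n\<close>.\<close>

lemma sigma_bounded_below:
  assumes \<omega>: "\<omega> \<in> space P" and ix: "i \<in> {1..M}" "x \<in> X"
    and \<delta>: "0 < \<delta>" "\<And>n. \<delta> \<le> gp.post_k n \<omega> (i, x) (i, x)"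
  obtains U s0 where "open U" "x \<in> U" "0 < s0" "\<And>n u. u \<in> X \<inter> U \<Longrightarrow> s0 \<le> sigma n \<omega> i u x"
proof -
  let ?K = "\<lambda>n u u'. gp.post_k n \<omega> (i, u) (i, u')"
  \<comment> \<open>\<open>Q u\<close> bounds the square of the change of the kernel between
    \<open>x\<close> and \<open>u\<close> at every time; it is continuous and vanishes at
    \<open>x\<close>.\<close>
  define Q where "Q u = (k0 i u u - 2 * k0 i u x + k0 i x x) * k0 i x x" for u
  have le: "?K n x x \<le> k0 i x x" for n
    using gp.post_k_diag_le[OF \<omega>, of "(i, x)" n] ix by (simp add: joint_kernel_def)
  have "continuous_on X (\<lambda>u. case (u, x) of (x, x') \<Rightarrow> k0 i x x')"
    by (rule continuous_on_compose2[OF kernel_continuous[OF ix(1)]]) (use ix in \<open>auto intro!: continuous_intros\<close>)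
  then have "continuous_on X Q"
    unfolding Q_def by (intro continuous_intros kernel_diag_continuous[OF ix(1)]) simp
  then have "(Q \<longlongrightarrow> Q x) (at x within X)" using ix(2) by (auto simp: continuous_on_def)
  moreover have Qx: "Q x < (\<delta> / 2)\<^sup>2" using \<delta>(1) by (simp add: Q_def)
  ultimately have "\<forall>\<^sub>F u in at x within X. Q u < (\<delta> / 2)\<^sup>2" by (rule order_tendstoD(2))
  then obtain U where U: "open U" "x \<in> U" "\<And>u. u \<in> U \<Longrightarrow> u \<noteq> x \<Longrightarrow> u \<in> X \<Longrightarrow> Q u < (\<delta> / 2)\<^sup>2"
    unfolding eventually_at_topological by blast
  \<comment> \<open>The numerator of \<open>sigma\<close> stays above \<delta> minus
    \<open>\<delta> / 2\<close>, and its denominator below the value for the prior kernel.\<close>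
  define s0 where "s0 = (\<delta> / 2) / sqrt (k0 i x x + lam i x)"
  have pos: "0 < k0 i x x" "0 < lam i x" using \<delta>(1) \<delta>(2)[of 0] le[of 0] noise_pos[OF ix] by linarith+
  show thesis
  proof (rule that[OF U(1,2)])
    show "0 < s0" using pos \<delta>(1) by (simp add: s0_def)
    fix n u assume u: "u \<in> X \<inter> U"
    have "(?K n u x - ?K n x x)\<^sup>2 \<le> (?K n u u - 2 * ?K n u x + ?K n x x) * ?K n x x"
      by (rule psd_on_increment_Cauchy_Schwarz[OF gp.psd_on_post_k[OF \<omega>]]) (use ix u in auto)
    also have "\<dots> \<le> (k0 i u u - 2 * k0 i u x + k0 i x x) * ?K n x x"
    proof (rule mult_right_mono)
      have "?K n u u - 2 * ?K n u x + ?K n x x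
        \<le> joint_kernel k0 (i, u) (i, u) - 2 * joint_kernel k0 (i, u) (i, x) + joint_kernel k0 (i, x) (i, x)"
        unfolding gp.post_k_def
        by (rule kcov_increment_le[OF gp.psd]) (use gp.design_space[OF \<omega>] gp.noise_var(2) ix u in auto)
      then show "?K n u u - 2 * ?K n u x + ?K n x x \<le> k0 i u u - 2 * k0 i u x + k0 i x x"
        by (simp add: joint_kernel_def)
    qed (use \<delta>(1) \<delta>(2)[of n] in linarith)
    also have "\<dots> \<le> Q u"
      unfolding Q_def
    proof (rule mult_left_mono[OF le])
      have "0 \<le> (\<Sum>p\<in>{u, x}. \<Sum>q\<in>{u, x}. (if p = u then 1 else - 1) * (if q = u then 1 else - 1) * k0 i p q)"
        by (rule psd_on_nonneg[OF psd_on_prior_kernel[OF ix(1)]]) (use u ix in auto)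
      then show "0 \<le> k0 i u u - 2 * k0 i u x + k0 i x x"
        using kernel_sym[OF ix(1), of u x] u ix by (cases "u = x") simp_all
    qed
    also have "\<dots> \<le> (\<delta> / 2)\<^sup>2" using U(3)[of u] Qx u by (cases "u = x") auto
    finally have "\<bar>?K n u x - ?K n x x\<bar> \<le> \<delta> / 2"
      using \<delta>(1) by (simp add: abs_le_square_iff[symmetric])
    then have "\<delta> / 2 \<le> ?K n u x" using \<delta>(2)[of n] by linarith
    moreover have "sqrt (?K n x x + lam i x) \<le> sqrt (k0 i x x + lam i x)" using le by simp
    moreover have "0 < sqrt (?K n x x + lam i x)" using \<delta>(1) \<delta>(2)[of n] pos by simp
    ultimately show "s0 \<le> sigma n \<omega> i u x"
      unfolding s0_def sigma_def using \<delta>(1) by (intro frac_le) auto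
  qed
qed

text \<open>The exceptional null set comes from \<open>post_m_frequently_bounded\<close> alone. The
  rest argues on a single path, so one null set serves all arms and locations.\<close>

theorem posterior_variance_tendsto_0:
  "AE \<omega> in P. \<forall>i\<in>{1..M}. \<forall>x\<in>X. (\<lambda>n. gp.post_k n \<omega> (i, x) (i, x)) \<longlonglongrightarrow> 0"
  using post_m_frequently_bounded
proof (rule AE_mp, intro AE_I2 impI ballI)
  fix \<omega> i x
  assume \<omega>: "\<omega> \<in> space P" and ix: "i \<in> {1..M}" "x \<in> X"
    and "\<exists>C. \<exists>\<^sub>F n in sequentially. (\<integral>\<^sup>+u. ennreal (\<Sum>j\<in>{1..M}. \<bar>gp.post_m n \<omega> (j, u)\<bar>) \<partial>location_measure) \<le> ennreal C"
  then obtain C where C: "\<exists>\<^sub>F n in sequentially.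
      (\<integral>\<^sup>+u. ennreal (\<Sum>j\<in>{1..M}. \<bar>gp.post_m n \<omega> (j, u)\<bar>) \<partial>location_measure) \<le> ennreal C" by blast
  \<comment> \<open>\<open>ennreal\<close> sends negative numbers to 0, hence the
    truncation.\<close>
  define C' where "C' = max C 0"
  let ?V = "\<lambda>n. gp.post_k n \<omega> (i, x) (i, x)"
  let ?B = "\<lambda>n u. \<Sum>j\<in>{1..M}. \<bar>gp.post_m n \<omega> (j, u)\<bar>"
  have V0: "0 \<le> ?V n" for n using gp.post_k_diag_nonneg[OF \<omega>, of "(i, x)" n] ix by simp
  have "decseq ?V"
    unfolding gp.post_k_def by (rule kcov_diag_antimono[OF gp.psd]) (use gp.design_space[OF \<omega>] gp.noise_var(2) ix in auto)
  then obtain L where L: "?V \<longlonglongrightarrow> L" "\<And>n. L \<le> ?V n"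
    using decseq_convergent[of ?V 0] V0 by blast
  have "L = 0"
  proof (rule ccontr)
    assume "L \<noteq> 0"
    moreover have "0 \<le> L" by (rule LIMSEQ_le_const[OF L(1)]) (use V0 in auto)
    ultimately have "0 < L" by simp
    then obtain U s0 where U: "open U" "x \<in> U" and s0: "0 < s0" "\<And>n u. u \<in> X \<inter> U \<Longrightarrow> s0 \<le> sigma n \<omega> i u x"
      using sigma_bounded_below[OF \<omega> ix _ L(2)] by metis
    let ?A = "X \<inter> U"
    have A: "?A \<in> sets location_measure" using U by (auto simp: sets_location_measure sets_restrict_space)
    define p where "p = measure location_measure ?A"
    have p: "0 < p" unfolding p_def by (rule location_measure_pos[OF ix(2) U])
    \<comment> \<open>With this \<open>t\<close> the lower bound
      \<open>q * (s0 * t * p - 2 * C')\<close> equals \<open>q\<close>, however large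
      \<open>C'\<close> is.\<close>
    define t where "t = (2 * C' + 1) / (s0 * p)"
    have t: "0 \<le> t" using s0(1) p by (simp add: t_def C'_def)
    define q where "q = min (measure std_normal_distribution {t<..}) (measure std_normal_distribution {..<- t})"
    have q: "0 < q" using std_normal_tail_pos by (simp add: q_def)
    have lower: "q / c i x \<le> IKG n (a n \<omega>) (v n \<omega>) \<omega>"
      if n: "(\<integral>\<^sup>+u. ennreal (?B n u) \<partial>location_measure) \<le> ennreal C" for n
    proof -
      have Bm: "?B n \<in> borel_measurable location_measure"
        by (intro borel_measurable_sum borel_measurable_abs)
          (use post_m_location_measurable[OF \<omega>] in \<open>simp cong: measurable_cong_sets add: sets_location_measure\<close>)
      have Bi: "integrable location_measure (?B n)"
        by (rule integrableI_nonneg[OF Bm]) (use n in \<open>auto intro!: AE_I2 sum_nonneg intro: order.strict_trans1\<close>)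
      have "ennreal (LINT u|location_measure. ?B n u) \<le> ennreal C"
        using n by (subst nn_integral_eq_integral[symmetric, OF Bi]) (auto intro!: AE_I2 sum_nonneg)
      also have "\<dots> \<le> ennreal C'" by (rule ennreal_leI) (simp add: C'_def)
      finally have BC: "(LINT u|location_measure. ?B n u) \<le> C'"
        by (subst (asm) ennreal_le_iff) (simp_all add: C'_def)
      have nonneg: "0 \<le> kg n \<omega> i x u" for u
        unfolding kg_def by (rule kg_factor_nonneg[OF two_arms ix(1)])
      have iA: "integrable location_measure (\<lambda>u. indicator ?A u * g u)" if "integrable location_measure g" for g :: "'x \<Rightarrow> real"
        using integrable_real_mult_indicator[OF A that] by (simp add: mult.commute)
      have "q = q * (s0 * t * p - 2 * C')" using s0(1) p by (simp add: t_def)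
      also have "\<dots> \<le> q * (s0 * t * p - 2 * (LINT u|location_measure. ?B n u))"
        using q BC by simp
      also have "\<dots> \<le> q * (s0 * t * p - 2 * (LINT u|location_measure. indicator ?A u * ?B n u))"
      proof -
        have "(LINT u|location_measure. indicator ?A u * ?B n u) \<le> (LINT u|location_measure. ?B n u)"
          by (rule integral_mono[OF iA[OF Bi] Bi]) (auto split: split_indicator intro!: sum_nonneg)
        then show ?thesis using q by simp
      qed
      also have "\<dots> = (LINT u|location_measure. q * (s0 * t * indicator ?A u - 2 * (indicator ?A u * ?B n u)))"
        using A iA[OF Bi]
        by (simp add: p_def loc.emeasure_eq_measure less_top[symmetric] inf_commute inf_left_commute)
      also have "\<dots> \<le> (LINT u|location_measure. kg n \<omega> i x u)"
      proof (rule integral_mono)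
        show "integrable location_measure (\<lambda>u. q * (s0 * t * indicator ?A u - 2 * (indicator ?A u * ?B n u)))"
          using A iA[OF Bi] by (intro integrable_mult_right Bochner_Integration.integrable_diff)
            (auto simp: loc.emeasure_eq_measure less_top[symmetric])
        show "integrable location_measure (kg n \<omega> i x)" by (rule kg_integrable[OF \<omega> ix])
        fix u assume "u \<in> space location_measure"
        show "q * (s0 * t * indicator ?A u - 2 * (indicator ?A u * ?B n u)) \<le> kg n \<omega> i x u"
        proof (cases "u \<in> ?A")
          case True
          have "q * (s0 * t - 2 * ?B n u) \<le> kg n \<omega> i x u"
            unfolding kg_def
          proof (rule kg_factor_ge[OF two_arms ix(1) t _ s0(2)[OF True]])
            show "\<bar>gp.post_m n \<omega> (j, u)\<bar> \<le> ?B n u" if "j \<in> {1..M}" for j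
              using that by (intro member_le_sum) auto
          qed (use s0 q in \<open>auto simp: q_def\<close>)
          then show ?thesis using True by simp
        qed (use nonneg in simp)
      qed
      finally have "q / c i x \<le> IKG n i x \<omega>"
        unfolding ikg_eq[OF \<omega> ix] using cost_pos[OF ix] by (simp add: divide_right_mono)
      also have "\<dots> \<le> IKG n (a n \<omega>) (v n \<omega>) \<omega>"
        by (rule ikg_le_sampled[OF \<omega> ix])
      finally show ?thesis .
    qed
    have "\<forall>\<^sub>F n in sequentially. IKG n (a n \<omega>) (v n \<omega>) \<omega> < q / c i x"
      using q cost_pos[OF ix] by (intro order_tendstoD(2)[OF ikg_sampled_tendsto_0[OF \<omega>]]) simp
    then have "\<forall>\<^sub>F n in sequentially. \<not> (\<integral>\<^sup>+u. ennreal (?B n u) \<partial>location_measure) \<le> ennreal C"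
      by (rule eventually_mono) (use lower in fastforce)
    with C show False by (simp add: frequently_def)
  qed
  with L(1) show "?V \<longlonglongrightarrow> 0" by simp
qed

text \<open>Costs are bounded away from 0, so every budget is exceeded and the \<open>LEAST\<close>
  is attained; they are bounded above, so boundedly many samples cannot exhaust a large
  budget.\<close>

lemma budget_time_at_top:
  assumes \<omega>: "\<omega> \<in> space P"
  shows "filterlim (\<lambda>B. budget_time c a v B \<omega>) sequentially at_top"
proof -
  have av: "a n \<omega> \<in> {1..M}" "v n \<omega> \<in> X" for n using decision_range[OF \<omega>] by auto
  let ?c = "\<lambda>n. c (a n \<omega>) (v n \<omega>)"
  obtain C where C: "\<And>i x. i \<in> {1..M} \<Longrightarrow> x \<in> X \<Longrightarrow> \<bar>c i x\<bar> \<le> C"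
    using arm_functions_bounded[of c, OF cost_continuous] by blast
  have "continuous_on X (\<lambda>x. 1 / c i x)" if "i \<in> {1..M}" for i
    using cost_pos[OF that] by (intro continuous_intros cost_continuous[OF that]) (auto simp: less_imp_neq[symmetric])
  then obtain D where D: "\<And>i x. i \<in> {1..M} \<Longrightarrow> x \<in> X \<Longrightarrow> \<bar>1 / c i x\<bar> \<le> D"
    using arm_functions_bounded[of "\<lambda>i x. 1 / c i x"] by blast
  have cpos: "0 < ?c n" for n using cost_pos[OF av] .
  have cD: "1 / ?c n \<le> D" for n by (rule order_trans[OF abs_ge_self D[OF av]])
  have "0 < 1 / ?c 0" using cpos[of 0] by simp
  with cD[of 0] have D0: "0 < D" by linarith
  have lower: "1 / D \<le> ?c n" for n using cpos[of n] D0 cD[of n] by (simp add: field_simps)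
  have ex: "\<exists>N. B < (\<Sum>n=0..N. ?c n)" for B
  proof -
    obtain N :: nat where "B * D < real N" using reals_Archimedean2 by blast
    then have "B < real (Suc N) * (1 / D)" using D0 by (simp add: field_simps)
    also have "\<dots> = (\<Sum>n=0..N. 1 / D)" by simp
    also have "\<dots> \<le> (\<Sum>n=0..N. ?c n)" by (rule sum_mono) (rule lower)
    finally show ?thesis by blast
  qed
  show ?thesis
    unfolding filterlim_at_top
  proof
    fix N0
    show "\<forall>\<^sub>F B in at_top. N0 \<le> budget_time c a v B \<omega>"
      using eventually_ge_at_top[of "real N0 * C"]
    proof eventually_elim
      case (elim B)
      let ?N = "budget_time c a v B \<omega>"
      show ?case
      proof (rule ccontr)
        assume "\<not> N0 \<le> ?N"
        then have N: "Suc ?N \<le> N0" by simp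
        have "B < (\<Sum>n=0..?N. ?c n)"
          unfolding budget_time_def by (rule LeastI_ex[OF ex])
        also have "\<dots> \<le> (\<Sum>n=0..?N. C)"
          using C[OF av] by (intro sum_mono) (meson abs_le_D1)
        \<comment> \<open>The sum starts at 0 and so has \<open>Suc ?N\<close> terms.\<close>
        also have "\<dots> = real (Suc ?N) * C" by simp
        also have "\<dots> \<le> real N0 * C"
          using N cpos[of 0] C[OF av(1)[of 0] av(2)[of 0]] by (intro mult_right_mono) linarith+
        finally show False using elim by simp
      qed
    qed
  qed
qed

text \<open>The difference of two independent normal variables has a density, so ties have
  probability 0. At a tie the order of the posterior means could keep changing, and the argmax need
  not settle.\<close>

lemma arms_distinct:
  assumes ij: "i \<in> {1..M}" "j \<in> {1..M}" "i \<noteq> j" and x: "x \<in> X" and pos: "0 < k0 i x x" "0 < k0 j x x"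
  shows "AE \<omega> in P. \<theta> i x \<omega> \<noteq> \<theta> j x \<omega>"
proof -
  have dist: "distributed P lborel (\<theta> i' x) (normal_density (\<mu>0 i' x) (sqrt (k0 i' x x)))" if "i' \<in> {i, j}" for i'
    using prior_component_borel[of i' x] that ij x pos by (auto simp: normal_rv_def)
  have "indep_vars (\<lambda>_. borel) (\<lambda>i \<omega>. (\<lambda>x\<in>X. \<theta> i x \<omega>) x) {1..M}"
    by (rule indep_vars_compose2[OF prior_indep]) (rule measurable_component_singleton[OF x])
  then have "indep_vars (\<lambda>_. borel) (\<lambda>i \<omega>. \<theta> i x \<omega>) {1..M}" using x by simp
  then have "indep_var (Pi\<^sub>M {i} (\<lambda>_. borel)) (\<lambda>\<omega>. \<lambda>i\<in>{i}. \<theta> i x \<omega>) (Pi\<^sub>M {j} (\<lambda>_. borel)) (\<lambda>\<omega>. \<lambda>j\<in>{j}. \<theta> j x \<omega>)"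
    by (rule indep_var_restrict) (use ij in auto)
  from indep_var_compose[OF this, of "\<lambda>h. h i" borel "\<lambda>h. h j" borel]
  have "indep_var borel (\<theta> i x) borel (\<theta> j x)"
    by (simp add: comp_def measurable_component_singleton)
  then have D: "distributed P lborel (\<lambda>\<omega>. \<theta> i x \<omega> - \<theta> j x \<omega>)
      (normal_density (\<mu>0 i x - \<mu>0 j x) (sqrt ((sqrt (k0 i x x))\<^sup>2 + (sqrt (k0 j x x))\<^sup>2)))"
    by (rule diff_indep_normal) (use pos dist in auto)
  have "AE z in density lborel (normal_density (\<mu>0 i x - \<mu>0 j x) (sqrt ((sqrt (k0 i x x))\<^sup>2 + (sqrt (k0 j x x))\<^sup>2))). z \<noteq> 0"
    using AE_lborel_singleton[of 0] by (subst AE_density) auto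
  then have "AE z in distr P lborel (\<lambda>\<omega>. \<theta> i x \<omega> - \<theta> j x \<omega>). z \<noteq> 0"
    unfolding distributed_distr_eq_density[OF D] .
  then show ?thesis
    using distributed_measurable[OF D] by (subst (asm) AE_distr_iff) auto
qed

end

text \<open>\<open>is_arg_max\<close> depends on the strict comparisons only, and without ties in
  the limit these eventually agree with those of the limit.\<close>

lemma argmax_eventually_eq:
  fixes f :: "'b \<Rightarrow> 'j \<Rightarrow> real"
  assumes J: "finite J" and lim: "\<And>j. j \<in> J \<Longrightarrow> ((\<lambda>b. f b j) \<longlongrightarrow> g j) F" and inj: "inj_on g J"
  shows "\<forall>\<^sub>F b in F. {i. is_arg_max (f b) (\<lambda>j. j \<in> J) i} = {i. is_arg_max g (\<lambda>j. j \<in> J) i}"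
proof -
  have "\<forall>\<^sub>F b in F. \<forall>i\<in>J. \<forall>j\<in>J. f b i < f b j \<longleftrightarrow> g i < g j"
  proof (intro eventually_ball_finite J ballI)
    have lt: "\<forall>\<^sub>F b in F. f b i < f b j" if ij: "i \<in> J" "j \<in> J" "g i < g j" for i j
    proof -
      have "((\<lambda>b. f b j - f b i) \<longlongrightarrow> g j - g i) F" using ij by (intro tendsto_diff lim)
      from order_tendstoD(1)[OF this, of 0] ij(3) show ?thesis by simp
    qed
    fix i j assume ij: "i \<in> J" "j \<in> J"
    consider "g i < g j" | "g j < g i" | "i = j" using inj ij by (meson inj_onD linorder_neqE_linordered_idom)
    then show "\<forall>\<^sub>F b in F. f b i < f b j \<longleftrightarrow> g i < g j"
    proof cases
      case 1
      then show ?thesis using lt[OF ij] by simp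
    next
      case 2
      then show ?thesis using lt[OF ij(2,1)] by (auto elim: eventually_mono)
    qed simp
  qed
  then show ?thesis
    by (rule eventually_mono) (auto simp: is_arg_max_def)
qed


theorem theorem1:
  fixes P :: "'w measure"
    and M :: nat
    and X :: "(real ^ 'd) set"
    and \<gamma> :: "real ^ 'd \<Rightarrow> real"
    and \<mu>0 :: "nat \<Rightarrow> real ^ 'd \<Rightarrow> real"
    and k0 :: "nat \<Rightarrow> real ^ 'd \<Rightarrow> real ^ 'd \<Rightarrow> real"
    and lam c :: "nat \<Rightarrow> real ^ 'd \<Rightarrow> real"
    and \<theta> :: "nat \<Rightarrow> real ^ 'd \<Rightarrow> 'w \<Rightarrow> real"
    and e :: "nat \<Rightarrow> 'w \<Rightarrow> real"
    and a :: "nat \<Rightarrow> 'w \<Rightarrow> nat"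
    and v :: "nat \<Rightarrow> 'w \<Rightarrow> real ^ 'd"
    and y :: "nat \<Rightarrow> 'w \<Rightarrow> real"
    and \<tau> :: "nat \<Rightarrow> real"
    and \<rho> :: "nat \<Rightarrow> real ^ 'd \<Rightarrow> real"
  assumes "M \<ge> 2"
    and "prob_density_on X \<gamma>"
    and model: "covariate_sampling P M X \<mu>0 k0 lam \<theta> e a v y"
    and policy: "ikg_policy P M X \<gamma> \<mu>0 k0 lam c a v y"
    and "\<And>i. i \<in> {1..M} \<Longrightarrow> \<tau> i > 0"
    and "\<And>i \<delta>. i \<in> {1..M} \<Longrightarrow> \<rho> i \<delta> > 0"
    and "\<And>i. i \<in> {1..M} \<Longrightarrow> continuous_on UNIV (\<rho> i)"
    and "\<And>i x x'. i \<in> {1..M} \<Longrightarrow> x \<in> X \<Longrightarrow> x' \<in> X \<Longrightarrow> k0 i x x' = (\<tau> i)\<^sup>2 * \<rho> i (x - x')"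
    and "\<And>i \<delta>. i \<in> {1..M} \<Longrightarrow> \<rho> i \<bar>\<delta>\<bar> = \<rho> i \<delta>"
    and "\<And>i \<delta> \<delta>'. i \<in> {1..M} \<Longrightarrow> 0 \<le> \<delta> \<Longrightarrow> \<delta> \<le> \<delta>' \<Longrightarrow> \<rho> i \<delta>' \<le> \<rho> i \<delta>"
    and "\<And>i. i \<in> {1..M} \<Longrightarrow> \<rho> i 0 = 1"
    and "\<And>i. i \<in> {1..M} \<Longrightarrow> (\<rho> i \<longlongrightarrow> 0) at_infinity"
    and "\<And>i. i \<in> {1..M} \<Longrightarrow> log_modulus (\<rho> i)"
    and "compact X" and "interior X \<noteq> {}"
    and "\<And>i. i \<in> {1..M} \<Longrightarrow> continuous_on X (\<mu>0 i)"
    and "\<And>i. i \<in> {1..M} \<Longrightarrow> continuous_on X (lam i)"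
    and "\<And>i x. i \<in> {1..M} \<Longrightarrow> x \<in> X \<Longrightarrow> lam i x > 0"
    and "\<And>i. i \<in> {1..M} \<Longrightarrow> continuous_on X (c i)"
    and "\<And>i x. i \<in> {1..M} \<Longrightarrow> x \<in> X \<Longrightarrow> c i x > 0"
    and "positive_density_on X \<gamma>"
  shows
    "(\<forall>i\<in>{1..M}. \<forall>x\<in>X. AE \<omega> in P.
        ((\<lambda>B. post_cov k0 lam a v i (budget_time c a v B \<omega>) x x \<omega>) \<longlongrightarrow> 0) at_top) \<and>
     (\<forall>i\<in>{1..M}. \<forall>x\<in>X. AE \<omega> in P.
        ((\<lambda>B. post_mean \<mu>0 k0 lam a v y i (budget_time c a v B \<omega>) x \<omega>) \<longlongrightarrow> \<theta> i x \<omega>) at_top) \<and>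
     (\<forall>x\<in>X. AE \<omega> in P. eventually (\<lambda>B.
        {i. is_arg_max (\<lambda>j. post_mean \<mu>0 k0 lam a v y j (budget_time c a v B \<omega>) x \<omega>)
              (\<lambda>j. j \<in> {1..M}) i} =
        {i. is_arg_max (\<lambda>j. \<theta> j x \<omega>) (\<lambda>j. j \<in> {1..M}) i}) at_top)"
proof -
  interpret covariate_sampling P M X \<mu>0 k0 lam \<theta> e a v y by (rule model)
  interpret ikg_sampling P M X \<mu>0 k0 lam \<theta> e a v y \<gamma> c
  proof
    fix i x x' assume i: "i \<in> {1..M}" and x: "x \<in> X" "x' \<in> X"
    \<comment> \<open>The two arguments have the same componentwise absolute value.\<close>
    have "\<rho> i (x - x') = \<rho> i (x' - x)"
      using assms(9)[OF i, of "x - x'"] assms(9)[OF i, of "x' - x"] by (simp add: abs_minus_commute)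
    then show "k0 i x x' = k0 i x' x" using assms(8)[OF i] x by simp
  next
    fix i assume i: "i \<in> {1..M}"
    have "continuous_on (X \<times> X) (\<lambda>p. (\<tau> i)\<^sup>2 * \<rho> i (fst p - snd p))"
      by (intro continuous_intros continuous_on_compose2[OF assms(7)[OF i]]) auto
    then show "continuous_on (X \<times> X) (\<lambda>(x, x'). k0 i x x')"
      by (rule continuous_on_cong[THEN iffD1, rotated -1]) (auto simp: assms(8)[OF i])
  qed (use assms in auto)
  have mean: "AE \<omega> in P. ((\<lambda>B. post_mean \<mu>0 k0 lam a v y i (budget_time c a v B \<omega>) x \<omega>) \<longlongrightarrow> \<theta> i x \<omega>) at_top"
    if ix: "i \<in> {1..M}" "x \<in> X" for i x
  proof -
    have "AE \<omega> in P. (\<lambda>n. gp.post_m n \<omega> (i, x)) \<longlonglongrightarrow> case_prod \<theta> (i, x) \<omega>"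
      by (rule gp.posterior_mean_consistent) (use posterior_variance_tendsto_0 ix in auto)
    then show ?thesis
    proof (rule AE_mp, intro AE_I2 impI)
      fix \<omega> assume \<omega>: "\<omega> \<in> space P" and "(\<lambda>n. gp.post_m n \<omega> (i, x)) \<longlonglongrightarrow> case_prod \<theta> (i, x) \<omega>"
      from filterlim_compose[OF this(2) budget_time_at_top[OF \<omega>]]
      show "((\<lambda>B. post_mean \<mu>0 k0 lam a v y i (budget_time c a v B \<omega>) x \<omega>) \<longlongrightarrow> \<theta> i x \<omega>) at_top"
        by (simp add: post_mean_eq[OF \<omega>])
    qed
  qed
  have argmax: "AE \<omega> in P. eventually (\<lambda>B.
        {i. is_arg_max (\<lambda>j. post_mean \<mu>0 k0 lam a v y j (budget_time c a v B \<omega>) x \<omega>) (\<lambda>j. j \<in> {1..M}) i} =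
        {i. is_arg_max (\<lambda>j. \<theta> j x \<omega>) (\<lambda>j. j \<in> {1..M}) i}) at_top" if x: "x \<in> X" for x
  proof -
    have "0 < k0 i x x" if "i \<in> {1..M}" for i
      using assms(5)[OF that] assms(8)[OF that x x] assms(11)[OF that] by simp
    then have "AE \<omega> in P. \<forall>i\<in>{1..M}. \<forall>j\<in>{1..M}. i \<noteq> j \<longrightarrow> \<theta> i x \<omega> \<noteq> \<theta> j x \<omega>"
      using arms_distinct[OF _ _ _ x] by (intro AE_finite_allI finite_atLeastAtMost) (auto intro: AE_impI)
    moreover have "AE \<omega> in P. \<forall>i\<in>{1..M}. ((\<lambda>B. post_mean \<mu>0 k0 lam a v y i (budget_time c a v B \<omega>) x \<omega>) \<longlongrightarrow> \<theta> i x \<omega>) at_top"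
      by (intro AE_finite_allI finite_atLeastAtMost mean x)
    ultimately show ?thesis
    proof eventually_elim
      case (elim \<omega>)
      show ?case
        by (rule argmax_eventually_eq) (use elim in \<open>auto simp: inj_on_def\<close>)
    qed
  qed
  have cov: "AE \<omega> in P. ((\<lambda>B. post_cov k0 lam a v i (budget_time c a v B \<omega>) x x \<omega>) \<longlongrightarrow> 0) at_top"
    if ix: "i \<in> {1..M}" "x \<in> X" for i x
    using posterior_variance_tendsto_0
  proof (rule AE_mp, intro AE_I2 impI)
    fix \<omega> assume \<omega>: "\<omega> \<in> space P" and "\<forall>i\<in>{1..M}. \<forall>x\<in>X. (\<lambda>n. gp.post_k n \<omega> (i, x) (i, x)) \<longlonglongrightarrow> 0"
    with ix have "(\<lambda>n. gp.post_k n \<omega> (i, x) (i, x)) \<longlonglongrightarrow> 0" by blast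
    from filterlim_compose[OF this budget_time_at_top[OF \<omega>]]
    show "((\<lambda>B. post_cov k0 lam a v i (budget_time c a v B \<omega>) x x \<omega>) \<longlongrightarrow> 0) at_top"
      by (simp add: post_cov_eq[OF \<omega>])
  qed
  show ?thesis using cov mean argmax by blast
qed

end
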